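(* Let $\phi\colon X\to\mathbb R$ be acceptable and satisfy $P(\phi)<\infty$. Suppose there exists an induced system $(\Sigma,\tau|_\Sigma)$ for which the induced potentials $\Phi_\gamma$, $\gamma\in\mathbb R$, associated with $\phi$ are locally H\"older continuous, and there exists $\gamma_0\in\mathbb R$ such that $P(\Phi_{\gamma_0})=0$. Assume that the minimizer of the rate function $I_\phi$ (i.e. the element $\mu\in\mathcal M(X)$ with $I_\phi(\mu)=0$) is unique, denoted by $\mu_{\min}$. Then for any bounded continuous function $\tilde\varphi\colon\mathcal M(X)\to\mathbb R$ we have $$\lim_{n\to\infty}\frac{1}{Z_n(\phi)}\sum_{x\in E_n}\exp(S_n\phi(x))\,\tilde\varphi(V_n(x))=\tilde\varphi(\mu_{\min}).$$
   Context: Full shift. $\mathbb N=\{1,2,\dots\}$ is discrete and $X=\mathbb N^{\mathbb N}$ has the product topology, with metric $d_X(x,y)=\exp(-\inf\{n\ge1: x_n\ne y_n\})$ ($\exp(-\infty)=0$). For $p_1\cdots p_n\in\mathbb N^n$, $[p_1\cdots p_n]=\{x\in X: x_k=p_k,\ 1\le k\le n\}$. $\sigma\colon X\to X$ is the left shift. For $\phi\colon X\to\mathbb R$, $S_n\phi=\sum_{k=0}^{n-1}\phi\circ\sigma^k$. $\phi$ is acceptable if it is uniformly continuous and $\sup_{p\in\mathbb N}(\sup_{[p]}\phi-\inf_{[p]}\phi)<\infty$. $\phi$ is locally H\"older continuous if there are $C>0$, $\alpha\in(0,1]$ such that $|\phi(x)-\phi(y)|\le C d_X(x,y)^\alpha$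 for all $p\in\mathbb N$ and $x,y\in[p]$. The pressure is $P(\phi)=\lim_{n\to\infty}\frac1n\log\sum_{p_1\cdots p_n\in\mathbb N^n}\sup_{[p_1\cdots p_n]}\exp S_n\phi$. The same definitions are used for the full shift over any countably infinite alphabet. Induced systems. Fix an integer $p^*\ge2$ and put $\mathbb N^*=\mathbb N\cap[p^*,\infty)$, $\mathbb N_*=\mathbb N\cap[1,p^* )$, $X^*=X\setminus\bigcup_{p\in\mathbb N_*}[p]$. Let $R\colon X^*\to\mathbb N\cup\{\infty\}$, $R(x)=\inf\{n\ge1:\sigma^nx\in X^*\}$; $\tau(x)=\sigma^{R(x)}x$ on $\{R<\infty\}=\bigcup_{k\geq 1}\{R=k\}$; $\Sigma=\bigcap_{n=0}^\infty\tau^{-n}(\bigcup_{k=1}^\infty\{R=k\})$. The pair $(\Sigma,\tau|_\Sigma)$ is called an induced system (one for each choice of $p^*$). The induced potentials are $\Phi_\gamma\colon\Sigma\to\mathbb R$, $\Phi_\gamma(x)=S_{R(x)}\phi(x)-\gamma R(x)$, $\gamma\in\mathbb R$. Let $W_0(\mathbb N_* )$ be the set of finite words (including the empty one) over $\mathbb N_*$ and let $\mathbb A=\{\bigcup_{q\in\mathbb N^*}[p\omega q]: p\in\mathbb N^*,\ \omega\in W_0(\mathbb N_* )\}$, a countably infinite alphabet. Let $\mathbb A^{\mathbb N}$ be the full shift over $\mathbb A$ with left shift $\theta$. The map $\Pi\colon\mathbb A^{\mathbb N}\to\Sigma$ sending $(z_n)_n$, $z_n=\bigcup_{q\in\mathbb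 N^*}[p_n\omega^{(n)}q]$, to the infinite concatenation $p_1\omega^{(1)}p_2\omega^{(2)}\cdots$ is a homeomorphism with $\Pi\circ\theta=\tau|_\Sigma\circ\Pi$. $\Phi_\gamma$ is called locally H\"older continuous if $\Phi_\gamma\circ\Pi$ is so on the full shift $\mathbb A^{\mathbb N}$, and $P(\Phi_\gamma)$ is the pressure of $\Phi_\gamma\circ\Pi$ on $(\mathbb A^{\mathbb N},\theta)$. Measures and rate function. $\mathcal M(X)$ is the space of Borel probability measures on $X$ with the weak* topology (tested against bounded continuous functions). $V_n(x)=\frac1n\sum_{k=0}^{n-1}\delta_{\sigma^kx}$; $E_n=\{x\in X:\sigma^nx=x\}$; $Z_n(\phi)=\sum_{x\in E_n}\exp S_n\phi(x)$. $\mathcal M(X,\sigma)$ is the set of $\sigma$-invariant elements of $\mathcal M(X)$, $\mathcal M_\phi(X,\sigma)=\{\mu\in\mathcal M(X,\sigma):\int\phi\,d\mu>-\infty\}$, and $h(\mu)$ is the measure-theoretic entropy of $\mu$ with respect to $\sigma$. Put $F_\phi(\mu)=h(\mu)+\int\phi\,d\mu-P(\phi)$ if $\mu\in\mathcal M_\phi(X,\sigma)$ and $F_\phi(\mu)=-\infty$ otherwise, and $I_\phi(\mu)=-\inf_{\mathcal G\ni\mu}\sup_{\mathcal G}F_\phi$, the infimum being over all open $\mathcal G\subset\mathcal M(X)$ containing $\mu$. *)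

theory Defs
  imports "HOL-Probability.Probability"
begin

section \<open>Full shifts over a countable alphabet\<close>

text \<open>
  An alphabet is a set \<open>A\<close>, and its full shift is carried by \<open>full_shift A\<close>. Coordinates are
  numbered from \<open>0\<close>, so the coordinate \<open>x k\<close> is the one usually written with index \<open>k + 1\<close>;
  letters are not renumbered.
\<close>

definition full_shift :: "'a set \<Rightarrow> (nat \<Rightarrow> 'a) set" where
  "full_shift A = {x. \<forall>k. x k \<in> A}"

definition shift :: "(nat \<Rightarrow> 'a) \<Rightarrow> (nat \<Rightarrow> 'a)" where
  "shift x = (\<lambda>k. x (Suc k))"

definition words :: "'a set \<Rightarrow> nat \<Rightarrow> 'a list set" where
  "words A n = {w. length w = n \<and> set w \<subseteq> A}"

definition cylinder :: "'a set \<Rightarrow> 'a list \<Rightarrow> (nat \<Rightarrow> 'a) set" where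
  "cylinder A w = {x \<in> full_shift A. \<forall>k < length w. x k = w ! k}"

text \<open>The exponent is \<open>- inf {n \<ge> 1. x\<^sub>n \<noteq> y\<^sub>n}\<close> for coordinates numbered from \<open>1\<close>, whence the
  \<open>Suc\<close>; the infimum of the empty set is \<open>\<infinity>\<close> and \<open>exp (-\<infinity>) = 0\<close>.\<close>

definition shift_dist :: "(nat \<Rightarrow> 'a) \<Rightarrow> (nat \<Rightarrow> 'a) \<Rightarrow> real" where
  "shift_dist x y = (if x = y then 0 else exp (- real (Suc (LEAST k. x k \<noteq> y k))))"

definition birkhoff_sum :: "((nat \<Rightarrow> 'a) \<Rightarrow> real) \<Rightarrow> nat \<Rightarrow> (nat \<Rightarrow> 'a) \<Rightarrow> real" where
  "birkhoff_sum \<phi> n x = (\<Sum>k<n. \<phi> ((shift ^^ k) x))"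

definition acceptable :: "'a set \<Rightarrow> ((nat \<Rightarrow> 'a) \<Rightarrow> real) \<Rightarrow> bool" where
  "acceptable A \<phi> \<longleftrightarrow>
    (\<forall>e>0. \<exists>d>0. \<forall>x \<in> full_shift A. \<forall>y \<in> full_shift A.
        shift_dist x y < d \<longrightarrow> \<bar>\<phi> x - \<phi> y\<bar> < e) \<and>
    (SUP p\<in>A. (SUP x\<in>cylinder A [p]. ereal (\<phi> x)) - (INF x\<in>cylinder A [p]. ereal (\<phi> x))) < \<infinity>"

definition locally_Hoelder :: "'a set \<Rightarrow> ((nat \<Rightarrow> 'a) \<Rightarrow> real) \<Rightarrow> bool" where
  "locally_Hoelder A \<phi> \<longleftrightarrow>
    (\<exists>C>0. \<exists>\<alpha>. 0 < \<alpha> \<and> \<alpha> \<le> 1 \<and>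
      (\<forall>p\<in>A. \<forall>x \<in> cylinder A [p]. \<forall>y \<in> cylinder A [p].
         \<bar>\<phi> x - \<phi> y\<bar> \<le> C * shift_dist x y powr \<alpha>))"

definition elog :: "ennreal \<Rightarrow> ereal" where
  "elog t = (if t = 0 then -\<infinity> else if t = \<infinity> then \<infinity> else ereal (ln (enn2real t)))"

text \<open>The limit exists in the extended reals for acceptable and for locally Hoelder \<open>\<phi>\<close>: by
  bounded oscillation on the sets \<open>cylinder A [p]\<close> either all sums are infinite or none is, and
  their logarithms are subadditive in \<open>n\<close>.\<close>

definition pressure :: "'a set \<Rightarrow> ((nat \<Rightarrow> 'a) \<Rightarrow> real) \<Rightarrow> ereal" where
  "pressure A \<phi> =
    lim (\<lambda>n. elog (\<Sum>\<^sub>\<infinity>w\<in>words A n. SUP x\<in>cylinder A w. ennreal (exp (birkhoff_sum \<phi> n x)))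
             / ereal (real n))"

section \<open>The full shift over the positive integers and its induced systems\<close>

abbreviation pos_nats :: "nat set" where
  "pos_nats \<equiv> {1..}"

abbreviation X :: "(nat \<Rightarrow> nat) set" where
  "X \<equiv> full_shift pos_nats"

text \<open>The parameter \<open>ps\<close> stands for the threshold \<open>p\<^sup>* \<ge> 2\<close>: letters below it are the ones removed
  by inducing.\<close>

definition X_star :: "nat \<Rightarrow> (nat \<Rightarrow> nat) set" where
  "X_star ps = X - (\<Union>p\<in>{1..<ps}. cylinder pos_nats [p])"

definition return_time :: "nat \<Rightarrow> (nat \<Rightarrow> nat) \<Rightarrow> enat" where
  "return_time ps x = (INF n\<in>{n. n \<ge> 1 \<and> (shift ^^ n) x \<in> X_star ps}. enat n)"

text \<open>\<open>induced_map\<close> and \<open>induced_potential\<close> carry meaning only where the return time is finite;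
  \<open>induced_domain\<close> collects the points whose whole orbit under \<open>induced_map\<close> stays there.\<close>

definition induced_map :: "nat \<Rightarrow> (nat \<Rightarrow> nat) \<Rightarrow> (nat \<Rightarrow> nat)" where
  "induced_map ps x = (shift ^^ the_enat (return_time ps x)) x"

definition induced_domain :: "nat \<Rightarrow> (nat \<Rightarrow> nat) set" where
  "induced_domain ps =
    (\<Inter>n. {x. (induced_map ps ^^ n) x \<in> (\<Union>k\<in>{1..}. {y \<in> X_star ps. return_time ps y = enat k})})"

definition induced_potential ::
    "((nat \<Rightarrow> nat) \<Rightarrow> real) \<Rightarrow> nat \<Rightarrow> real \<Rightarrow> (nat \<Rightarrow> nat) \<Rightarrow> real" where
  "induced_potential \<phi> ps \<gamma> x =
    birkhoff_sum \<phi> (the_enat (return_time ps x)) x - \<gamma> * real (the_enat (return_time ps x))"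

definition induced_letter :: "nat \<Rightarrow> nat \<Rightarrow> nat list \<Rightarrow> (nat \<Rightarrow> nat) set" where
  "induced_letter ps p \<omega> = (\<Union>q\<in>{ps..}. cylinder pos_nats (p # \<omega> @ [q]))"

definition induced_alphabet :: "nat \<Rightarrow> (nat \<Rightarrow> nat) set set" where
  "induced_alphabet ps = {induced_letter ps p \<omega> | p \<omega>. p \<ge> ps \<and> \<omega> \<in> lists {1..<ps}}"

text \<open>A letter determines \<open>p\<close> and \<open>\<omega>\<close>, so the description is unique on \<open>induced_alphabet ps\<close>.\<close>

definition letter_word :: "nat \<Rightarrow> (nat \<Rightarrow> nat) set \<Rightarrow> nat list" where
  "letter_word ps a =
    (THE w. \<exists>p \<omega>. p \<ge> ps \<and> \<omega> \<in> lists {1..<ps} \<and> w = p # \<omega> \<and> a = induced_letter ps p \<omega>)"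

text \<open>For nonempty words \<open>u 0, u 1, \<dots>\<close> the first \<open>k + 1\<close> of them already determine the
  \<open>k\<close>-th letter of the concatenation.\<close>

definition infinite_concat :: "(nat \<Rightarrow> 'a list) \<Rightarrow> (nat \<Rightarrow> 'a)" where
  "infinite_concat u = (\<lambda>k. concat (map u [0..<Suc k]) ! k)"

text \<open>The conjugacy from the full shift over \<open>induced_alphabet ps\<close> to the induced system on
  \<open>induced_domain ps\<close>.\<close>

definition induced_coding :: "nat \<Rightarrow> (nat \<Rightarrow> (nat \<Rightarrow> nat) set) \<Rightarrow> (nat \<Rightarrow> nat)" where
  "induced_coding ps z = infinite_concat (\<lambda>n. letter_word ps (z n))"

definition induced_locally_Hoelder :: "((nat \<Rightarrow> nat) \<Rightarrow> real) \<Rightarrow> nat \<Rightarrow> real \<Rightarrow> bool" where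
  "induced_locally_Hoelder \<phi> ps \<gamma> \<longleftrightarrow>
    locally_Hoelder (induced_alphabet ps) (induced_potential \<phi> ps \<gamma> \<circ> induced_coding ps)"

definition induced_pressure :: "((nat \<Rightarrow> nat) \<Rightarrow> real) \<Rightarrow> nat \<Rightarrow> real \<Rightarrow> ereal" where
  "induced_pressure \<phi> ps \<gamma> =
    pressure (induced_alphabet ps) (induced_potential \<phi> ps \<gamma> \<circ> induced_coding ps)"

section \<open>Borel probability measures and the weak* topology\<close>

abbreviation borel_X :: "(nat \<Rightarrow> nat) measure" where
  "borel_X \<equiv> restrict_space borel X"

definition prob_measures :: "(nat \<Rightarrow> nat) measure set" where
  "prob_measures = {\<mu>. prob_space \<mu> \<and> sets \<mu> = sets borel_X}"

definition weak_star :: "(nat \<Rightarrow> nat) measure topology" where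
  "weak_star = topology_generated_by
    {{\<mu> \<in> prob_measures. (\<integral>x. f x \<partial>\<mu>) \<in> U} | f (U :: real set).
       continuous_on X f \<and> bounded (f ` X) \<and> open U}"

definition empirical_measure :: "nat \<Rightarrow> (nat \<Rightarrow> nat) \<Rightarrow> (nat \<Rightarrow> nat) measure" where
  "empirical_measure n x =
    measure_of (space borel_X) (sets borel_X)
      (\<lambda>B. (\<Sum>k<n. emeasure (return borel_X ((shift ^^ k) x)) B) / of_nat n)"

definition periodic_points :: "nat \<Rightarrow> (nat \<Rightarrow> nat) set" where
  "periodic_points n = {x \<in> X. (shift ^^ n) x = x}"

text \<open>Summable for \<open>n \<ge> 1\<close> when \<open>\<phi>\<close> is acceptable with finite pressure.\<close>

definition partition_sum :: "((nat \<Rightarrow> nat) \<Rightarrow> real) \<Rightarrow> nat \<Rightarrow> real" where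
  "partition_sum \<phi> n = (\<Sum>\<^sub>\<infinity>x\<in>periodic_points n. exp (birkhoff_sum \<phi> n x))"

section \<open>Measure-theoretic entropy\<close>

text \<open>Terms of measure zero vanish because \<open>0 * ln 0 = 0\<close>.\<close>

definition partition_entropy :: "'a measure \<Rightarrow> 'a set set \<Rightarrow> real" where
  "partition_entropy M P = - (\<Sum>B\<in>P. measure M B * ln (measure M B))"

definition measurable_partitions :: "'a measure \<Rightarrow> 'a set set set" where
  "measurable_partitions M = {P. finite P \<and> P \<subseteq> sets M \<and> partition_on (space M) P}"

text \<open>The join of the preimages of \<open>P\<close> under \<open>T ^^ k\<close>, \<open>k < n\<close>: its atoms are the sets of points
  with a common itinerary \<open>f\<close>. The empty atom may occur, without effect on the entropy.\<close>

definition partition_refinement ::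
    "'a measure \<Rightarrow> ('a \<Rightarrow> 'a) \<Rightarrow> 'a set set \<Rightarrow> nat \<Rightarrow> 'a set set" where
  "partition_refinement M T P n =
    (\<lambda>f. {x \<in> space M. \<forall>k<n. (T ^^ k) x \<in> f k}) ` (PiE {..<n} (\<lambda>_. P))"

definition measure_entropy :: "'a measure \<Rightarrow> ('a \<Rightarrow> 'a) \<Rightarrow> ereal" where
  "measure_entropy M T =
    (SUP P\<in>measurable_partitions M.
       ereal (lim (\<lambda>n. partition_entropy M (partition_refinement M T P n) / real n)))"

section \<open>The rate function\<close>

definition invariant_measures :: "(nat \<Rightarrow> nat) measure set" where
  "invariant_measures = {\<mu> \<in> prob_measures. distr \<mu> borel_X shift = \<mu>}"

text \<open>The extended-valued integral. It is used for acceptable potentials of finite pressure; these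
  are bounded above, so the first term is finite and \<open>\<infinity> - \<infinity>\<close> does not arise.\<close>

definition ext_integral :: "'a measure \<Rightarrow> ('a \<Rightarrow> real) \<Rightarrow> ereal" where
  "ext_integral \<mu> \<phi> =
    enn2ereal (\<integral>\<^sup>+x. ennreal (\<phi> x) \<partial>\<mu>) - enn2ereal (\<integral>\<^sup>+x. ennreal (- \<phi> x) \<partial>\<mu>)"

definition invariant_measures_for :: "((nat \<Rightarrow> nat) \<Rightarrow> real) \<Rightarrow> (nat \<Rightarrow> nat) measure set" where
  "invariant_measures_for \<phi> = {\<mu> \<in> invariant_measures. ext_integral \<mu> \<phi> > -\<infinity>}"

definition free_energy :: "((nat \<Rightarrow> nat) \<Rightarrow> real) \<Rightarrow> (nat \<Rightarrow> nat) measure \<Rightarrow> ereal" where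
  "free_energy \<phi> \<mu> =
    (if \<mu> \<in> invariant_measures_for \<phi>
     then measure_entropy \<mu> shift + ext_integral \<mu> \<phi> - pressure pos_nats \<phi>
     else -\<infinity>)"

definition rate_function :: "((nat \<Rightarrow> nat) \<Rightarrow> real) \<Rightarrow> (nat \<Rightarrow> nat) measure \<Rightarrow> ereal" where
  "rate_function \<phi> \<mu> =
    - (INF G\<in>{G. openin weak_star G \<and> \<mu> \<in> G}. SUP \<nu>\<in>G. free_energy \<phi> \<nu>)"

end

theory Submission
  imports Defs
begin

text \<open>
  Periodic points are weighted by \<open>exp (S\<^sub>n \<phi>)\<close>. Given periodic points of period \<open>n\<close> whose empirical
  measures lie in a small convex neighbourhood of \<open>\<mu>\<close>, independent concatenation of their periods
  yields an invariant measure near \<open>\<mu>\<close> whose free energy is, up to \<open>o(1)\<close>, the exponential growth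
  rate of their total weight minus the pressure. So if the free energy is at most \<open>-c < 0\<close> near
  \<open>\<mu>\<close>, those points carry an exponentially small proportion of the partition sum. The variational
  inequality makes the rate function nonnegative, so by uniqueness this applies to every
  \<open>\<mu> \<noteq> \<mu>\<^sub>m\<^sub>i\<^sub>n\<close>.

  Compactness is obtained by describing a measure through its cylinder probabilities, a point of the
  cube of functions from words to the unit interval, which is compact. A point of the cube that does
  not come from a measure violates finite additivity, or loses mass to infinity; the latter has
  negligible weight since finite pressure makes large letters exponentially rare.
\<close>

section \<open>Entropy of simple functions\<close>

text \<open>The space is not compact and entropy need not be upper semicontinuous, so the upper
  bound forms no limit measure. The comparison happens at a fixed large \<open>n\<close>:
  \<open>rate_function\<close> regularizes \<open>free_energy\<close>, so positivity at
  \<open>\<mu>\<close> is already uniform on a neighbourhood, and the block measure only has to land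
  there. Two features of \<open>\<phi>\<close> shape the rest. It can be unbounded below; blocks are
  therefore drawn from finite sets of periodic points, whose letters are bounded, and a bound
  uniform over finite sets passes to the infinite sum. Its Birkhoff sums over a common cylinder
  differ by up to \<open>e n + K\<close> with \<open>e\<close> arbitrarily small; \<open>e\<close>
  is taken as a fraction of the gained rate \<open>c\<close>. A last mismatch:
  \<open>measure_entropy\<close> ranges over all finite Borel partitions, while word sums see only
  cylinders. Every such partition is almost determined by finitely many coordinates with capped
  letters, and strong subadditivity controls the loss per time step. Entropy is attached to
  finite-valued functions, so that joins are pairs and refinement is functional dependence.\<close>

definition level_prob :: "'a measure \<Rightarrow> ('a \<Rightarrow> 'b) \<Rightarrow> 'b \<Rightarrow> real" where
  "level_prob M f v = measure M {x \<in> space M. f x = v}"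

definition ent :: "'a measure \<Rightarrow> ('a \<Rightarrow> 'b) \<Rightarrow> real" where
  "ent M f = (\<Sum>v\<in>f ` space M. level_prob M f v * - ln (level_prob M f v))"

context prob_space
begin

lemma level_prob_nonneg: "level_prob M f v \<ge> 0"
  by (simp add: level_prob_def)

lemma level_prob_le_1: "level_prob M f v \<le> 1"
  by (simp add: level_prob_def)

lemma level_prob_outside: "v \<notin> f ` space M \<Longrightarrow> level_prob M f v = 0"
  unfolding level_prob_def by (metis (mono_tags, lifting) Collect_empty_eq image_eqI measure_empty)

lemma simple_function_level_sets:
  assumes "simple_function M f"
  shows "{x \<in> space M. f x \<in> A} \<in> sets M"
proof -
  have "{x \<in> space M. f x \<in> A} = f -` A \<inter> space M" by auto
  thus ?thesis using simple_functionD(2)[OF assms] by simp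
qed

lemma level_prob_comp:
  assumes "simple_function M g"
  shows "level_prob M (\<lambda>x. h (g x)) v = (\<Sum>u\<in>{u\<in>g ` space M. h u = v}. level_prob M g u)"
proof -
  let ?U = "{u\<in>g ` space M. h u = v}"
  have fin: "finite ?U" using assms by (simp add: simple_functionD)
  have "{x \<in> space M. h (g x) = v} = (\<Union>u\<in>?U. {x \<in> space M. g x = u})" by auto
  also have "measure M \<dots> = (\<Sum>u\<in>?U. measure M {x \<in> space M. g x = u})"
    using simple_function_level_sets[OF assms, of "{_}"]
    by (intro finite_measure_finite_Union) (auto simp: fin disjoint_family_on_def)
  finally show ?thesis unfolding level_prob_def .
qed

text \<open>Change of variables. It lets all marginal entropies of a tuple be written as sums over
  the values of the joint function, where they can be compared term by term.\<close>

lemma sum_level_prob_comp: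
  assumes "simple_function M g"
  shows "(\<Sum>v\<in>(\<lambda>x. h (g x)) ` space M. level_prob M (\<lambda>x. h (g x)) v * c v)
       = (\<Sum>u\<in>g ` space M. level_prob M g u * c (h u))"
proof -
  have fin: "finite (g ` space M)" using assms by (simp add: simple_functionD)
  have "(\<Sum>u\<in>g ` space M. level_prob M g u * c (h u))
      = (\<Sum>v\<in>h ` g ` space M. \<Sum>u\<in>{u\<in>g ` space M. h u = v}. level_prob M g u * c (h u))"
    by (rule sum.image_gen[OF fin])
  also have "\<dots> = (\<Sum>v\<in>h ` g ` space M. \<Sum>u\<in>{u\<in>g ` space M. h u = v}. level_prob M g u * c v)"
    by (intro sum.cong) auto
  also have "\<dots> = (\<Sum>v\<in>(\<lambda>x. h (g x)) ` space M. level_prob M (\<lambda>x. h (g x)) v * c v)"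
    by (simp add: level_prob_comp[OF assms] image_image sum_distrib_right)
  finally show ?thesis by simp
qed

lemma sum_level_prob:
  assumes "simple_function M g"
  shows "(\<Sum>u\<in>g ` space M. level_prob M g u) = 1"
proof -
  have "(\<Sum>u\<in>g ` space M. level_prob M g u * 1) = (\<Sum>v\<in>(\<lambda>x. True) ` space M. level_prob M (\<lambda>x. True) v * 1)"
    using sum_level_prob_comp[OF assms, of "\<lambda>_. True" "\<lambda>_. 1"] by simp
  also have "\<dots> = 1"
  proof -
    have "(\<lambda>x. True) ` space M = {True}" using not_empty by auto
    thus ?thesis by (simp add: level_prob_def prob_space)
  qed
  finally show ?thesis by simp
qed

lemma ent_nonneg: "0 \<le> ent M f"
  unfolding ent_def
proof (intro sum_nonneg mult_nonneg_nonneg)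
  show "0 \<le> - ln (level_prob M f v)" for v
    using level_prob_nonneg[of f v] level_prob_le_1[of f v] by (cases "level_prob M f v = 0") auto
qed (rule level_prob_nonneg)

lemma level_prob_comp_ge:
  assumes "simple_function M g"
  shows "level_prob M g u \<le> level_prob M (\<lambda>x. h (g x)) (h u)"
  unfolding level_prob_def
proof (rule finite_measure_mono)
  have "simple_function M (\<lambda>x. h (g x))" using simple_function_compose[OF assms, of h] by (simp add: comp_def)
  from simple_function_level_sets[OF this, of "{h u}"]
  show "{x \<in> space M. h (g x) = h u} \<in> events" by simp
qed auto

lemma ent_comp_le:
  assumes "simple_function M g"
  shows "ent M (\<lambda>x. h (g x)) \<le> ent M g"
proof -
  have eq: "ent M (\<lambda>x. h (g x)) = (\<Sum>u\<in>g ` space M. level_prob M g u * - ln (level_prob M (\<lambda>x. h (g x)) (h u)))"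
    unfolding ent_def by (rule sum_level_prob_comp[OF assms])
  have "level_prob M g u * - ln (level_prob M (\<lambda>x. h (g x)) (h u)) \<le> level_prob M g u * - ln (level_prob M g u)" for u
    using level_prob_comp_ge[OF assms, of u h] level_prob_nonneg[of g u]
    by (cases "level_prob M g u = 0") (auto intro!: mult_left_mono)
  thus ?thesis unfolding eq ent_def[of M g] by (intro sum_mono)
qed

lemma ent_cong: "(\<And>x. x \<in> space M \<Longrightarrow> f x = g x) \<Longrightarrow> ent M f = ent M g"
  by (simp add: ent_def level_prob_def cong: image_cong conj_cong)

lemma determined_imp_factors:
  assumes "\<And>x y. x \<in> A \<Longrightarrow> y \<in> A \<Longrightarrow> g x = g y \<Longrightarrow> f x = f y"
  shows "\<exists>h. \<forall>x\<in>A. f x = h (g x)"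
proof (intro exI ballI)
  fix x assume x: "x \<in> A"
  have "(SOME y. y \<in> A \<and> g y = g x) \<in> A \<and> g (SOME y. y \<in> A \<and> g y = g x) = g x"
    by (rule someI[of _ x]) (use x in auto)
  thus "f x = f (SOME y. y \<in> A \<and> g y = g x)" using assms x by metis
qed

text \<open>Refinement is phrased as pointwise dependence, so that later comparisons of partitions
  reduce to checking which coordinates determine which.\<close>

lemma ent_mono:
  assumes "simple_function M g"
    and det: "\<And>x y. x \<in> space M \<Longrightarrow> y \<in> space M \<Longrightarrow> g x = g y \<Longrightarrow> f x = f y"
  shows "ent M f \<le> ent M g"
proof -
  obtain h where "\<forall>x\<in>space M. f x = h (g x)"
    using determined_imp_factors[where A = "space M", OF det] ..
  hence "ent M f = ent M (\<lambda>x. h (g x))" by (intro ent_cong) (rule bspec)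
  thus ?thesis using ent_comp_le[OF assms(1)] by simp
qed

lemma simple_function_determined:
  assumes "simple_function M g"
    and det: "\<And>x y. x \<in> space M \<Longrightarrow> y \<in> space M \<Longrightarrow> g x = g y \<Longrightarrow> f x = f y"
  shows "simple_function M f"
proof -
  obtain h where "\<forall>x\<in>space M. f x = h (g x)"
    using determined_imp_factors[where A = "space M", OF det] ..
  thus ?thesis using simple_function_cong[of M f "h \<circ> g"] simple_function_compose[OF assms(1), of h] by simp
qed

lemma ent_eq:
  assumes "simple_function M g"
    and "\<And>x y. x \<in> space M \<Longrightarrow> y \<in> space M \<Longrightarrow> g x = g y \<longleftrightarrow> f x = f y"
  shows "ent M f = ent M g"
  using ent_mono[OF assms(1), of f] ent_mono[OF simple_function_determined[OF assms(1), of f], of g] assms(2)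
  by fastforce

text \<open>Gibbs' inequality: \<open>ln t \<le> t - 1\<close> at
  \<open>t = b v / (p v * S)\<close>, averaged against \<open>p\<close>. This is the finite form of
  the variational principle; it will be used with \<open>b v\<close> a weight
  \<open>exp (S n x)\<close>.\<close>

lemma ent_gibbs:
  assumes f: "simple_function M f" and b: "\<And>v. v \<in> f ` space M \<Longrightarrow> b v > 0"
  shows "ent M f + (\<Sum>v\<in>f ` space M. level_prob M f v * ln (b v)) \<le> ln (\<Sum>v\<in>f ` space M. b v)"
proof -
  let ?V = "f ` space M" let ?p = "level_prob M f"
  define S where "S = sum b ?V"
  have fin: "finite ?V" using f by (simp add: simple_functionD)
  have S: "S > 0" unfolding S_def using not_empty b fin by (intro sum_pos) auto
  have "?p v * - ln (?p v) + ?p v * ln (b v) - ?p v * ln S \<le> b v / S - ?p v" if v: "v \<in> ?V" for v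
  proof (cases "?p v = 0")
    case True thus ?thesis using b[OF v] S by simp
  next
    case False
    hence p: "?p v > 0" using level_prob_nonneg[of f v] by simp
    have "ln (b v / (?p v * S)) \<le> b v / (?p v * S) - 1"
      using b[OF v] S p by (intro ln_le_minus_one) simp
    hence "?p v * ln (b v / (?p v * S)) \<le> ?p v * (b v / (?p v * S) - 1)"
      using p by (intro mult_left_mono) auto
    also have "\<dots> = b v / S - ?p v" using p S by (simp add: field_simps)
    also have "ln (b v / (?p v * S)) = ln (b v) - ln (?p v) - ln S"
      using b[OF v] S p by (simp add: ln_div ln_mult)
    finally show ?thesis by (simp add: algebra_simps)
  qed
  hence "(\<Sum>v\<in>?V. ?p v * - ln (?p v) + ?p v * ln (b v) - ?p v * ln S) \<le> (\<Sum>v\<in>?V. b v / S - ?p v)"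
    by (rule sum_mono)
  also have "\<dots> = 0"
    using S by (simp add: sum_subtractf sum_level_prob[OF f] sum_divide_distrib[symmetric] S_def[symmetric])
  finally show ?thesis
    by (simp add: sum_subtractf sum.distrib ent_def S_def[symmetric] sum_negf sum_distrib_right[symmetric] sum_level_prob[OF f])
qed

lemma ent_le_ln_card:
  assumes "simple_function M f" "f ` space M \<subseteq> V" "finite V"
  shows "ent M f \<le> ln (real (card V))"
proof -
  have "ent M f \<le> ln (real (card (f ` space M)))"
    using ent_gibbs[OF assms(1), of "\<lambda>_. 1"] by simp
  also have "\<dots> \<le> ln (real (card V))"
    using assms not_empty by (subst ln_le_cancel_iff) (auto simp: card_gt_0_iff intro!: card_mono dest: finite_subset)
  finally show ?thesis .
qed

text \<open>Conditional mutual information is nonnegative: \<open>ln t \<le> t - 1\<close> is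
  applied to the ratio of \<open>r\<close>, the law making \<open>f\<close> and \<open>g\<close>
  conditionally independent given \<open>h\<close>, to the joint law.\<close>

lemma ent_strong_subadditive:
  assumes f: "simple_function M f" and g: "simple_function M g" and h: "simple_function M h"
  shows "ent M (\<lambda>x. (f x, g x, h x)) + ent M h \<le> ent M (\<lambda>x. (f x, h x)) + ent M (\<lambda>x. (g x, h x))"
proof -
  define F where "F = (\<lambda>x. (f x, g x, h x))"
  have F: "simple_function M F" unfolding F_def by (intro simple_function_Pair f g h)
  have fh: "simple_function M (\<lambda>x. (f x, h x))" and gh: "simple_function M (\<lambda>x. (g x, h x))"
    by (intro simple_function_Pair f g h)+
  let ?p = "level_prob M F" and ?pf = "level_prob M (\<lambda>x. (f x, h x))"
    and ?pg = "level_prob M (\<lambda>x. (g x, h x))" and ?ph = "level_prob M h"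
  define hf where "hf = (\<lambda>(a::'b,b::'c,c::'d). (a,c))"
  define hg where "hg = (\<lambda>(a::'b,b::'c,c::'d). (b,c))"
  define hh where "hh = (\<lambda>(a::'b,b::'c,c::'d). c)"
  have comps: "(\<lambda>x. hf (F x)) = (\<lambda>x. (f x, h x))" "(\<lambda>x. hg (F x)) = (\<lambda>x. (g x, h x))" "(\<lambda>x. hh (F x)) = h"
    by (auto simp: hf_def hg_def hh_def F_def)
  have eqs: "ent M (\<lambda>x. (f x, h x)) = (\<Sum>u\<in>F ` space M. ?p u * - ln (?pf (hf u)))"
    "ent M (\<lambda>x. (g x, h x)) = (\<Sum>u\<in>F ` space M. ?p u * - ln (?pg (hg u)))"
    "ent M h = (\<Sum>u\<in>F ` space M. ?p u * - ln (?ph (hh u)))"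
    using sum_level_prob_comp[OF F, of hf "\<lambda>v. - ln (?pf v)"]
      sum_level_prob_comp[OF F, of hg "\<lambda>v. - ln (?pg v)"]
      sum_level_prob_comp[OF F, of hh "\<lambda>v. - ln (?ph v)"]
    unfolding comps by (simp_all only: ent_def)
  have ge: "?p u \<le> ?pf (hf u)" "?p u \<le> ?pg (hg u)" "?p u \<le> ?ph (hh u)" for u
    using level_prob_comp_ge[OF F, of u hf] level_prob_comp_ge[OF F, of u hg] level_prob_comp_ge[OF F, of u hh]
    by (simp_all add: comps)
  define r where "r u = ?pf (hf u) * ?pg (hg u) / ?ph (hh u)" for u
  have r_nonneg: "r u \<ge> 0" for u by (simp add: r_def level_prob_nonneg)
  have ptw: "?p u * - ln (?p u) + ?p u * - ln (?ph (hh u)) - ?p u * - ln (?pf (hf u)) - ?p u * - ln (?pg (hg u)) \<le> r u - ?p u"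
    for u
  proof (cases "?p u = 0")
    case True thus ?thesis using r_nonneg by simp
  next
    case False
    hence p: "?p u > 0" using level_prob_nonneg[of F u] by simp
    hence pos: "?pf (hf u) > 0" "?pg (hg u) > 0" "?ph (hh u) > 0" using ge[of u] by linarith+
    have "ln (r u / ?p u) \<le> r u / ?p u - 1"
      using pos p by (intro ln_le_minus_one) (simp add: r_def)
    hence "?p u * ln (r u / ?p u) \<le> ?p u * (r u / ?p u - 1)"
      using p by (intro mult_left_mono) auto
    also have "\<dots> = r u - ?p u" using p by (simp add: field_simps)
    also have "ln (r u / ?p u) = ln (?pf (hf u)) + ln (?pg (hg u)) - ln (?ph (hh u)) - ln (?p u)"
      using pos p by (simp add: r_def ln_div ln_mult)
    finally show ?thesis by (simp add: algebra_simps)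
  qed
  have fin: "finite (f ` space M)" "finite (g ` space M)" "finite (h ` space M)"
    using f g h by (simp_all add: simple_functionD)
  have marg: "(\<Sum>a\<in>k ` space M. level_prob M (\<lambda>x. (k x, h x)) (a, c)) = ?ph c"
    if k: "simple_function M k" for k :: "'a \<Rightarrow> 'e" and c
  proof -
    have kh: "simple_function M (\<lambda>x. (k x, h x))" by (intro simple_function_Pair k h)
    have "?ph c = (\<Sum>u\<in>{u \<in> (\<lambda>x. (k x, h x)) ` space M. snd u = c}. level_prob M (\<lambda>x. (k x, h x)) u)"
      using level_prob_comp[OF kh, of snd c] by simp
    also have "\<dots> = (\<Sum>u\<in>k ` space M \<times> {c}. level_prob M (\<lambda>x. (k x, h x)) u)"
      using k by (intro sum.mono_neutral_left) (auto simp: simple_functionD intro!: level_prob_outside)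
    also have "\<dots> = (\<Sum>a\<in>k ` space M. level_prob M (\<lambda>x. (k x, h x)) (a, c))"
      using sum.cartesian_product[of "\<lambda>a b. level_prob M (\<lambda>x. (k x, h x)) (a, b)" "{c}" "k ` space M"] by simp
    finally show ?thesis by simp
  qed
  \<comment> \<open>\<open>r\<close> may charge triples that \<open>F\<close> never takes; the sum
    is enlarged to the full product of ranges, where it factors for each value of
    \<open>h\<close>.\<close>
  have "(\<Sum>u\<in>F ` space M. r u) \<le> (\<Sum>u\<in>f ` space M \<times> g ` space M \<times> h ` space M. r u)"
    using fin r_nonneg by (intro sum_mono2) (auto simp: F_def)
  also have "\<dots> = (\<Sum>a\<in>f ` space M. \<Sum>b\<in>g ` space M. \<Sum>c\<in>h ` space M. ?pf (a,c) * ?pg (b,c) / ?ph c)"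
    by (simp add: sum.cartesian_product r_def hf_def hg_def hh_def split_def)
  also have "\<dots> = (\<Sum>c\<in>h ` space M. \<Sum>a\<in>f ` space M. \<Sum>b\<in>g ` space M. ?pf (a,c) * ?pg (b,c) / ?ph c)"
    by (subst (2) sum.swap, subst sum.swap) simp
  also have "\<dots> = (\<Sum>c\<in>h ` space M. ?ph c * ?ph c / ?ph c)"
  proof (rule sum.cong[OF refl])
    fix c
    have "(\<Sum>a\<in>f ` space M. \<Sum>b\<in>g ` space M. ?pf (a,c) * ?pg (b,c) / ?ph c)
        = (\<Sum>a\<in>f ` space M. ?pf (a,c)) * (\<Sum>b\<in>g ` space M. ?pg (b,c)) / ?ph c"
      by (simp only: sum_product sum_divide_distrib)
    thus "(\<Sum>a\<in>f ` space M. \<Sum>b\<in>g ` space M. ?pf (a,c) * ?pg (b,c) / ?ph c) = ?ph c * ?ph c / ?ph c"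
      by (simp only: marg[OF f] marg[OF g])
  qed
  \<comment> \<open>Also valid where \<open>?ph c = 0\<close>, because division by zero yields
    zero.\<close>
  also have "\<dots> = (\<Sum>c\<in>h ` space M. ?ph c)" by simp
  also have "\<dots> = 1" by (rule sum_level_prob[OF h])
  finally have r1: "(\<Sum>u\<in>F ` space M. r u) \<le> 1" .
  have "ent M F + ent M h - ent M (\<lambda>x. (f x, h x)) - ent M (\<lambda>x. (g x, h x))
    = (\<Sum>u\<in>F ` space M. ?p u * - ln (?p u) + ?p u * - ln (?ph (hh u)) - ?p u * - ln (?pf (hf u)) - ?p u * - ln (?pg (hg u)))"
    unfolding eqs ent_def[of M F] sum_subtractf sum.distrib by simp
  also have "\<dots> \<le> (\<Sum>u\<in>F ` space M. r u - ?p u)" by (intro sum_mono ptw)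
  also have "\<dots> \<le> 0" using r1 sum_level_prob[OF F] by (simp add: sum_subtractf)
  finally show ?thesis by (simp add: F_def)
qed

lemma ent_const: "ent M (\<lambda>x. c) = 0"
  unfolding ent_def level_prob_def using not_empty by (simp add: image_constant_conv prob_space)

text \<open>Strong subadditivity conditioned on a constant.\<close>

lemma ent_pair_le:
  assumes f: "simple_function M f" and g: "simple_function M g"
  shows "ent M (\<lambda>x. (f x, g x)) \<le> ent M f + ent M g"
proof -
  have "ent M (\<lambda>x. (f x, g x, ())) + ent M (\<lambda>x. ()) \<le> ent M (\<lambda>x. (f x, ())) + ent M (\<lambda>x. (g x, ()))"
    by (rule ent_strong_subadditive) (use f g in auto)
  moreover have "ent M (\<lambda>x. (f x, g x)) = ent M (\<lambda>x. (f x, g x, ()))"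
    by (rule ent_eq) (use f g in \<open>auto intro!: simple_function_Pair\<close>)
  moreover have "ent M (\<lambda>x. (f x, ())) = ent M f" "ent M (\<lambda>x. (g x, ())) = ent M g"
    by (rule ent_eq; use f g in auto)+
  ultimately show ?thesis using ent_const[of "()"] by simp
qed

lemma ent_distr:
  assumes "T \<in> measurable M N"
    and that: "simple_function (distr M N T) f"
  shows "ent (distr M N T) f = ent M (\<lambda>x. f (T x))"
proof -
  interpret D: prob_space "distr M N T" by (rule prob_space_distr[OF assms(1)])
  have f': "{x \<in> space N. f x = v} \<in> sets N" for v
    using D.simple_function_level_sets[OF that, of "{v}"] by simp
  have lp: "level_prob (distr M N T) f v = level_prob M (\<lambda>x. f (T x)) v" for v
    unfolding level_prob_def using assms f'[of v]
    by (subst measure_distr) (auto intro!: arg_cong[where f="measure M"] dest: measurable_space)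
  have "(\<Sum>v\<in>f ` space N. level_prob M (\<lambda>x. f (T x)) v * - ln (level_prob M (\<lambda>x. f (T x)) v))
      = (\<Sum>v\<in>(\<lambda>x. f (T x)) ` space M. level_prob M (\<lambda>x. f (T x)) v * - ln (level_prob M (\<lambda>x. f (T x)) v))"
    using that assms by (intro sum.mono_neutral_right) (auto simp: simple_function_def level_prob_outside dest: measurable_space)
  thus ?thesis unfolding ent_def lp by simp
qed

end

section \<open>Entropy rates of measure-preserving maps\<close>

lemma subadditive_multiple:
  fixes u :: "nat \<Rightarrow> real"
  assumes "\<And>m n. u (m + n) \<le> u m + u n"
  shows "u (q * m + r) \<le> real q * u m + u r"
proof (induction q)
  case (Suc q)
  have "u (Suc q * m + r) = u (m + (q * m + r))" by (simp add: algebra_simps)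
  also have "\<dots> \<le> u m + u (q * m + r)" by (rule assms)
  finally show ?case using Suc by (simp add: algebra_simps)
qed simp

text \<open>Fekete's lemma. The linear lower bound keeps the infimum finite. That the limit is this
  infimum is recorded too, since it gives bounds valid at every \<open>n\<close>.\<close>

lemma fekete:
  fixes u :: "nat \<Rightarrow> real"
  assumes sub: "\<And>m n. u (m + n) \<le> u m + u n" and lower: "\<And>n. u n \<ge> c * real n"
  obtains l where "(\<lambda>n. u n / real n) \<longlonglongrightarrow> l" "\<And>n. n \<ge> 1 \<Longrightarrow> l \<le> u n / real n"
proof -
  define l where "l = (INF n\<in>{1..}. u n / real n)"
  have bdd: "bdd_below ((\<lambda>n. u n / real n) ` {1..})"
    by (rule bdd_belowI[of _ c]) (use lower in \<open>auto simp: field_simps\<close>)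
  have l_le: "l \<le> u n / real n" if "n \<ge> 1" for n
    unfolding l_def using that by (intro cINF_lower[OF bdd]) auto
  have "(\<lambda>n. u n / real n) \<longlonglongrightarrow> l"
  proof (rule LIMSEQ_I)
    fix e :: real assume e: "e > 0"
    have "\<exists>m\<in>{1..}. u m / real m < l + e / 2"
      using cINF_less_iff[OF _ bdd, of "l + e/2"] e unfolding l_def by auto
    then obtain m where m: "m \<ge> 1" "u m / real m < l + e / 2" by auto
    \<comment> \<open>Absorbs the remainder term \<open>u r\<close> and the fraction
      \<open>r / m\<close> of \<open>u m\<close> left over when \<open>n\<close> is divided by
      \<open>m\<close>.\<close>
    define K where "K = \<bar>u m\<bar> + (\<Sum>r<m. \<bar>u r\<bar>)"
    have upper: "u n / real n \<le> u m / real m + K / real n" if n: "n \<ge> 1" for n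
    proof -
      define q r where "q = n div m" and "r = n mod m"
      have nqr: "n = q * m + r" by (simp add: q_def r_def)
      have r: "r < m" using m by (simp add: r_def)
      have "u n \<le> real q * u m + u r" unfolding nqr by (rule subadditive_multiple[OF sub])
      moreover have "\<bar>u r\<bar> \<le> (\<Sum>r<m. \<bar>u r\<bar>)" by (rule member_le_sum) (use r in auto)
      moreover have "real q * u m = real n * (u m / real m) - real r / real m * u m"
      proof -
        have "real n = real q * real m + real r" using nqr by (metis of_nat_add of_nat_mult)
        thus ?thesis using m by (simp add: field_simps)
      qed
      moreover have "\<bar>real r / real m * u m\<bar> \<le> 1 * \<bar>u m\<bar>"
        unfolding abs_mult using r by (intro mult_right_mono) auto
      ultimately have "u n \<le> real n * (u m / real m) + K" unfolding K_def by linarith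
      thus ?thesis using n by (simp add: field_simps)
    qed
    obtain n0 where n0: "real n0 > 2 * K / e" using reals_Archimedean2 by blast
    have "norm (u n / real n - l) < e" if "n \<ge> Suc n0" for n
    proof -
      have n: "n \<ge> 1" "real n > 2 * K / e" using that n0 by auto
      have "K / real n < e / 2" using n e by (simp add: field_simps)
      hence "u n / real n - l < e" using upper[OF n(1)] m by linarith
      thus ?thesis using l_le[OF n(1)] by simp
    qed
    thus "\<exists>n0. \<forall>n\<ge>n0. norm (u n / real n - l) < e" by blast
  qed
  with l_le that show ?thesis by blast
qed

definition itinerary :: "('a \<Rightarrow> 'a) \<Rightarrow> ('a \<Rightarrow> 'b) \<Rightarrow> nat \<Rightarrow> 'a \<Rightarrow> 'b list" where
  "itinerary T f n x = map (\<lambda>k. f ((T ^^ k) x)) [0..<n]"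

lemma itinerary_eq_iff: "itinerary T f n x = itinerary T f n y \<longleftrightarrow> (\<forall>k<n. f ((T ^^ k) x) = f ((T ^^ k) y))"
  by (auto simp: itinerary_def)

lemma itinerary_add: "itinerary T f (m + n) x = itinerary T f m x @ itinerary T f n ((T ^^ m) x)"
proof -
  have "itinerary T f n ((T ^^ m) x) = map (\<lambda>k. f ((T ^^ k) x)) [m..<m + n]"
    unfolding itinerary_def by (rule nth_equalityI) (auto simp: funpow_add[symmetric, THEN fun_cong, simplified] add.commute)
  thus ?thesis by (simp add: itinerary_def upt_add_eq_append[of 0 m n])
qed

lemma itinerary_Suc: "itinerary T f (Suc n) x = itinerary T f n x @ [f ((T ^^ n) x)]"
  by (simp add: itinerary_def)

locale measure_preserving_map = prob_space M for M :: "'a measure" +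
  fixes T :: "'a \<Rightarrow> 'a"
  assumes T_measurable: "T \<in> measurable M M" and T_preserves: "distr M M T = M"
begin

lemma T_funpow_measurable: "(T ^^ k) \<in> measurable M M"
  by (induction k) (auto simp: comp_def intro: measurable_compose[OF _ T_measurable])

lemma T_funpow_preserves: "distr M M (T ^^ k) = M"
proof (induction k)
  case 0
  show ?case by (simp add: id_def distr_id)
next
  case (Suc k)
  have "distr M M (T ^^ Suc k) = distr (distr M M (T ^^ k)) M T"
    using distr_distr[OF T_measurable T_funpow_measurable[of k]] by simp
  thus ?case by (simp only: Suc T_preserves)
qed

lemma simple_function_funpow:
  assumes "simple_function M f" shows "simple_function M (\<lambda>x. f ((T ^^ k) x))"
  unfolding simple_function_def
proof (intro conjI ballI)
  have sp: "(T ^^ k) x \<in> space M" if "x \<in> space M" for x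
    using measurable_space[OF T_funpow_measurable that] .
  show "finite ((\<lambda>x. f ((T ^^ k) x)) ` space M)"
    by (rule finite_subset[OF _ simple_functionD(1)[OF assms]]) (use sp in auto)
  fix v
  have "(\<lambda>x. f ((T ^^ k) x)) -` {v} \<inter> space M = (T ^^ k) -` (f -` {v} \<inter> space M) \<inter> space M"
    using sp by auto
  thus "(\<lambda>x. f ((T ^^ k) x)) -` {v} \<inter> space M \<in> events"
    using measurable_sets[OF T_funpow_measurable simple_functionD(2)[OF assms]] by simp
qed

lemma ent_funpow:
  assumes "simple_function M f" shows "ent M (\<lambda>x. f ((T ^^ k) x)) = ent M f"
  using ent_distr[OF T_funpow_measurable[of k], where f = f] assms by (simp add: T_funpow_preserves)

lemma simple_function_itinerary:
  assumes "simple_function M f" shows "simple_function M (itinerary T f n)"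
proof (induction n)
  case (Suc n)
  have "simple_function M (\<lambda>x. (itinerary T f n x, f ((T ^^ n) x)))"
    by (intro simple_function_Pair Suc simple_function_funpow assms)
  thus ?case by (rule simple_function_determined) (simp add: itinerary_Suc)
qed (simp add: itinerary_def)

lemma ent_itinerary_subadditive:
  assumes "simple_function M f"
  shows "ent M (itinerary T f (m + n)) \<le> ent M (itinerary T f m) + ent M (itinerary T f n)"
proof -
  note sf = simple_function_itinerary[OF assms]
  have pair: "simple_function M (\<lambda>x. (itinerary T f m x, itinerary T f n ((T ^^ m) x)))"
    by (intro simple_function_Pair sf simple_function_funpow[of "itinerary T f n" m])
  have "ent M (itinerary T f (m + n)) \<le> ent M (\<lambda>x. (itinerary T f m x, itinerary T f n ((T ^^ m) x)))"
    by (rule ent_mono[OF pair]) (simp add: itinerary_add)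
  also have "\<dots> \<le> ent M (itinerary T f m) + ent M (\<lambda>x. itinerary T f n ((T ^^ m) x))"
    by (intro ent_pair_le sf simple_function_funpow[of "itinerary T f n" m])
  also have "ent M (\<lambda>x. itinerary T f n ((T ^^ m) x)) = ent M (itinerary T f n)"
    by (rule ent_funpow[OF sf])
  finally show ?thesis .
qed

lemma ent_rate_exists:
  assumes "simple_function M f"
  obtains l where "(\<lambda>n. ent M (itinerary T f n) / real n) \<longlonglongrightarrow> l"
proof (rule fekete)
  show "ent M (itinerary T f (m + n)) \<le> ent M (itinerary T f m) + ent M (itinerary T f n)" for m n
    by (rule ent_itinerary_subadditive[OF assms])
  show "ent M (itinerary T f n) \<ge> 0 * real n" for n using ent_nonneg by simp
qed (rule that)

section \<open>Entropy of a map through itineraries of finite-valued functions\<close>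

definition cell :: "'a set set \<Rightarrow> 'a \<Rightarrow> 'a set" where
  "cell P x = (THE B. B \<in> P \<and> x \<in> B)"

lemma cell_eqI:
  assumes "partition_on A P" "B \<in> P" "x \<in> B" shows "cell P x = B"
  unfolding cell_def using assms
  by (intro the_equality) (auto simp: partition_on_def disjoint_def)

lemma cell_in:
  assumes "partition_on A P" "x \<in> A" shows "cell P x \<in> P" "x \<in> cell P x"
proof -
  obtain B where "B \<in> P" "x \<in> B" using assms by (auto simp: partition_on_def)
  with cell_eqI[OF assms(1)] show "cell P x \<in> P" "x \<in> cell P x" by auto
qed

lemma simple_function_cell:
  assumes "P \<in> measurable_partitions M" shows "simple_function M (cell P)"
  unfolding simple_function_def
proof (intro conjI ballI)
  have P: "finite P" "P \<subseteq> events" "partition_on (space M) P"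
    using assms by (auto simp: measurable_partitions_def)
  have "cell P ` space M \<subseteq> P" using cell_in[OF P(3)] by auto
  thus "finite (cell P ` space M)" using P(1) finite_subset by blast
  fix B assume "B \<in> cell P ` space M"
  hence "B \<in> P" using cell_in[OF P(3)] by auto
  moreover have "cell P -` {B} \<inter> space M = B"
  proof (intro equalityI subsetI)
    fix x assume "x \<in> cell P -` {B} \<inter> space M"
    thus "x \<in> B" using cell_in(2)[OF P(3), of x] by auto
  next
    fix x assume x: "x \<in> B"
    have "x \<in> space M" using x P(2) \<open>B \<in> P\<close> sets.sets_into_space by blast
    thus "x \<in> cell P -` {B} \<inter> space M" using cell_eqI[OF P(3) \<open>B \<in> P\<close> x] by simp
  qed
  ultimately show "cell P -` {B} \<inter> space M \<in> events" using P(2) by auto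
qed

text \<open>The nonempty atoms of the refinement are exactly the level sets of the itinerary of
  cells; an empty atom contributes \<open>0 * ln 0 = 0\<close>.\<close>

lemma partition_entropy_refinement:
  assumes "P \<in> measurable_partitions M"
  shows "partition_entropy M (partition_refinement M T P n) = ent M (itinerary T (cell P) n)"
proof -
  have P: "finite P" "P \<subseteq> events" "partition_on (space M) P"
    using assms by (auto simp: measurable_partitions_def)
  have sp: "(T ^^ k) x \<in> space M" if "x \<in> space M" for x k
    using measurable_space[OF T_funpow_measurable that] .
  let ?I = "itinerary T (cell P) n"
  let ?L = "\<lambda>v. {x \<in> space M. ?I x = v}"
  let ?R = "partition_refinement M T P n"
  have fin: "finite ?R" unfolding partition_refinement_def using P(1) by (intro finite_imageI finite_PiE) auto
  have eq: "?R - {{}} = ?L ` ?I ` space M"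
  proof (intro equalityI subsetI)
    fix B assume B: "B \<in> ?R - {{}}"
    then obtain f where f: "f \<in> {..<n} \<rightarrow>\<^sub>E P" "B = {x \<in> space M. \<forall>k<n. (T ^^ k) x \<in> f k}"
      by (auto simp: partition_refinement_def)
    obtain x where x: "x \<in> B" using B by auto
    hence xs: "x \<in> space M" using f by auto
    have fk: "f k = cell P ((T ^^ k) x)" if "k < n" for k
      using cell_eqI[OF P(3), of "f k" "(T ^^ k) x"] f x that by auto
    have "B = ?L (?I x)"
    proof (intro equalityI subsetI)
      fix y assume y: "y \<in> B"
      hence "cell P ((T ^^ k) y) = f k" if "k < n" for k
        using cell_eqI[OF P(3), of "f k" "(T ^^ k) y"] f that by auto
      thus "y \<in> ?L (?I x)" using y f fk by (auto simp: itinerary_eq_iff)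
    next
      fix y assume y: "y \<in> ?L (?I x)"
      hence "\<forall>k<n. cell P ((T ^^ k) y) = f k" using fk by (auto simp: itinerary_eq_iff)
      thus "y \<in> B" using y f cell_in(2)[OF P(3) sp[of y]] by auto
    qed
    thus "B \<in> ?L ` ?I ` space M" using xs by auto
  next
    fix B assume "B \<in> ?L ` ?I ` space M"
    then obtain x where x: "x \<in> space M" "B = ?L (?I x)" by auto
    define f where "f = (\<lambda>k\<in>{..<n}. cell P ((T ^^ k) x))"
    have "f \<in> {..<n} \<rightarrow>\<^sub>E P" using cell_in(1)[OF P(3) sp[OF x(1)]] by (auto simp: f_def)
    moreover have "B = {y \<in> space M. \<forall>k<n. (T ^^ k) y \<in> f k}"
    proof -
      have "(T ^^ k) y \<in> cell P ((T ^^ k) x) \<longleftrightarrow> cell P ((T ^^ k) y) = cell P ((T ^^ k) x)"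
        if "y \<in> space M" for y k
        using cell_in[OF P(3) sp[OF that, of k]] cell_in[OF P(3) sp[OF x(1), of k]] cell_eqI[OF P(3)] by metis
      thus ?thesis unfolding x(2) by (auto simp: itinerary_eq_iff f_def)
    qed
    moreover have "x \<in> B" using x by auto
    ultimately show "B \<in> ?R - {{}}" unfolding partition_refinement_def by blast
  qed
  have "partition_entropy M ?R = - (\<Sum>B\<in>?R - {{}}. measure M B * ln (measure M B))"
    unfolding partition_entropy_def using fin
    by (intro arg_cong[where f=uminus] sum.mono_neutral_right) auto
  also have "\<dots> = - (\<Sum>v\<in>?I ` space M. measure M (?L v) * ln (measure M (?L v)))"
    unfolding eq by (subst sum.reindex) (auto simp: inj_on_def)
  also have "\<dots> = ent M ?I"
    by (simp add: ent_def level_prob_def sum_negf)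
  finally show ?thesis .
qed

definition level_partition :: "('a \<Rightarrow> 'b) \<Rightarrow> 'a set set" where
  "level_partition f = (\<lambda>v. {x \<in> space M. f x = v}) ` f ` space M"

lemma level_partition_on: "partition_on (space M) (level_partition f)"
  by (rule partition_onI) (auto simp: level_partition_def disjnt_def)

lemma level_partition_measurable:
  assumes "simple_function M f" shows "level_partition f \<in> measurable_partitions M"
  unfolding measurable_partitions_def
  using level_partition_on simple_functionD(1)[OF assms] simple_function_level_sets[OF assms, of "{_}"]
  by (auto simp: level_partition_def)

lemma cell_level_partition:
  assumes "x \<in> space M" shows "cell (level_partition f) x = {y \<in> space M. f y = f x}"
  by (rule cell_eqI[OF level_partition_on]) (use assms in \<open>auto simp: level_partition_def\<close>)

lemma ent_itinerary_level_partition: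
  assumes "simple_function M f"
  shows "ent M (itinerary T (cell (level_partition f)) n) = ent M (itinerary T f n)"
proof (rule ent_eq[OF simple_function_itinerary[OF assms]])
  fix x y assume xy: "x \<in> space M" "y \<in> space M"
  have sp: "(T ^^ k) x \<in> space M" if "x \<in> space M" for x k
    using measurable_space[OF T_funpow_measurable that] .
  have "{z \<in> space M. f z = f x'} = {z \<in> space M. f z = f y'} \<longleftrightarrow> f x' = f y'"
    if "x' \<in> space M" "y' \<in> space M" for x' y' using that by auto
  note this[OF sp[OF xy(1)] sp[OF xy(2)]]
  thus "itinerary T f n x = itinerary T f n y \<longleftrightarrow>
    itinerary T (cell (level_partition f)) n x = itinerary T (cell (level_partition f)) n y"
    unfolding itinerary_eq_iff using cell_level_partition[OF sp[OF xy(1)], where f = f] cell_level_partition[OF sp[OF xy(2)], where f = f]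
      by simp
qed

text \<open>A lower bound on entropy may be read off from a function with values in any type, by
  passing to its level partition.\<close>

lemma measure_entropy_ge:
  assumes "simple_function M f" "(\<lambda>n. ent M (itinerary T f n) / real n) \<longlonglongrightarrow> l"
  shows "ereal l \<le> measure_entropy M T"
proof -
  have "(\<lambda>n. partition_entropy M (partition_refinement M T (level_partition f) n) / real n) \<longlonglongrightarrow> l"
    using assms(2) partition_entropy_refinement[OF level_partition_measurable[OF assms(1)]]
      ent_itinerary_level_partition[OF assms(1)] by simp
  hence "lim (\<lambda>n. partition_entropy M (partition_refinement M T (level_partition f) n) / real n) = l"
    by (rule limI)
  thus ?thesis unfolding measure_entropy_def
    using level_partition_measurable[OF assms(1)] by (intro SUP_upper2[of "level_partition f"]) auto
qed

text \<open>For upper bounds set-valued functions suffice, since every measurable partition is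
  recovered from the function \<open>cell P\<close>.\<close>

lemma measure_entropy_le:
  assumes "\<And>(f :: 'a \<Rightarrow> 'a set) l. simple_function M f \<Longrightarrow>
      (\<lambda>n. ent M (itinerary T f n) / real n) \<longlonglongrightarrow> l \<Longrightarrow> ereal l \<le> C"
  shows "measure_entropy M T \<le> C"
  unfolding measure_entropy_def
proof (rule SUP_least)
  fix P assume P: "P \<in> measurable_partitions M"
  obtain l where l: "(\<lambda>n. ent M (itinerary T (cell P) n) / real n) \<longlonglongrightarrow> l"
    using ent_rate_exists[OF simple_function_cell[OF P]] .
  hence "lim (\<lambda>n. partition_entropy M (partition_refinement M T P n) / real n) = l"
    using partition_entropy_refinement[OF P] by (intro limI) simp
  thus "ereal (lim (\<lambda>n. partition_entropy M (partition_refinement M T P n) / real n)) \<le> C"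
    using assms[OF simple_function_cell[OF P] l] by simp
qed

text \<open>Passing from \<open>n\<close> to \<open>Suc n\<close> costs at most the conditional entropy of \<open>f\<close> given \<open>g\<close>.\<close>

lemma ent_itinerary_compare:
  assumes f: "simple_function M f" and g: "simple_function M g"
    and close: "ent M (\<lambda>x. (f x, g x)) \<le> ent M g + e"
  shows "ent M (itinerary T f n) \<le> ent M (itinerary T g n) + real n * e"
proof -
  let ?F = "itinerary T f" and ?G = "itinerary T g"
  note sF = simple_function_itinerary[OF f] and sG = simple_function_itinerary[OF g]
  \<comment> \<open>The \<open>g\<close>-itinerary stays in the pair because the later symbols of
    \<open>f\<close> are conditioned on it.\<close>
  have "ent M (\<lambda>x. (?F n x, ?G n x)) \<le> ent M (?G n) + real n * e"
  proof (induction n)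
    case 0
    have "ent M (\<lambda>x. (?F 0 x, ?G 0 x)) \<le> ent M (?G 0)"
      by (rule ent_mono[OF sG]) (simp add: itinerary_def)
    thus ?case by simp
  next
    case (Suc n)
    let ?f = "\<lambda>x. f ((T ^^ n) x)" and ?g = "\<lambda>x. g ((T ^^ n) x)"
    note sf = simple_function_funpow[OF f, of n] and sg = simple_function_funpow[OF g, of n]
    have "ent M (\<lambda>x. (?F (Suc n) x, ?G (Suc n) x)) \<le> ent M (\<lambda>x. (?F n x, ?f x, ?G (Suc n) x))"
      by (rule ent_mono[OF simple_function_Pair[OF sF simple_function_Pair[OF sf sG]]]) (simp add: itinerary_Suc)
    also have "\<dots> \<le> ent M (\<lambda>x. (?F n x, ?G (Suc n) x)) + ent M (\<lambda>x. (?f x, ?G (Suc n) x)) - ent M (?G (Suc n))"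
      using ent_strong_subadditive[OF sF[of n] sf sG[of "Suc n"]] by simp
    also have "ent M (\<lambda>x. (?F n x, ?G (Suc n) x)) \<le> ent M (?G (Suc n)) + real n * e"
    proof -
      have "ent M (\<lambda>x. (?F n x, ?G (Suc n) x)) \<le> ent M (\<lambda>x. (?F n x, ?g x, ?G n x))"
        by (rule ent_mono[OF simple_function_Pair[OF sF simple_function_Pair[OF sg sG]]]) (simp add: itinerary_Suc)
      also have "\<dots> \<le> ent M (\<lambda>x. (?F n x, ?G n x)) + ent M (\<lambda>x. (?g x, ?G n x)) - ent M (?G n)"
        using ent_strong_subadditive[OF sF[of n] sg sG[of n]] by simp
      also have "ent M (\<lambda>x. (?g x, ?G n x)) \<le> ent M (?G (Suc n))"
        by (rule ent_mono[OF sG]) (simp add: itinerary_Suc)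
      finally show ?thesis using Suc by simp
    qed
    also have "ent M (\<lambda>x. (?f x, ?G (Suc n) x)) \<le> ent M (?G (Suc n)) + e"
    proof -
      have "ent M (\<lambda>x. (?f x, ?G (Suc n) x)) \<le> ent M (\<lambda>x. (?f x, ?G n x, ?g x))"
        by (rule ent_mono[OF simple_function_Pair[OF sf simple_function_Pair[OF sG sg]]]) (simp add: itinerary_Suc)
      also have "\<dots> \<le> ent M (\<lambda>x. (?f x, ?g x)) + ent M (\<lambda>x. (?G n x, ?g x)) - ent M ?g"
        using ent_strong_subadditive[OF sf sG[of n] sg] by simp
      also have "ent M (\<lambda>x. (?G n x, ?g x)) \<le> ent M (?G (Suc n))"
        by (rule ent_mono[OF sG]) (simp add: itinerary_Suc)
      also have "ent M (\<lambda>x. (?f x, ?g x)) = ent M (\<lambda>x. (f x, g x))"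
        by (rule ent_funpow[OF simple_function_Pair[OF f g]])
      also have "ent M ?g = ent M g" by (rule ent_funpow[OF g])
      finally show ?thesis using close by simp
    qed
    finally show ?case by (simp add: algebra_simps)
  qed
  moreover have "ent M (?F n) \<le> ent M (\<lambda>x. (?F n x, ?G n x))"
    by (rule ent_mono[OF simple_function_Pair[OF sF sG]]) simp
  ultimately show ?thesis by simp
qed

end

section \<open>Finite approximation of Borel partitions of the shift space\<close>

text \<open>Otherwise \<open>{1..}\<close> inside the abbreviation \<open>X\<close> is rewritten to \<open>{Suc 0..}\<close>.\<close>

declare One_nat_def [simp del]

lemma space_borel_X [simp]: "space borel_X = X"
  by (simp add: space_restrict_space)

lemma full_shiftD: "x \<in> full_shift A \<Longrightarrow> x k \<in> A"
  by (simp add: full_shift_def)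

lemma shift_funpow: "(shift ^^ k) x = (\<lambda>i. x (k + i))"
  by (induction k arbitrary: x) (auto simp: shift_def)

lemma shift_funpow_apply [simp]: "(shift ^^ k) x i = x (k + i)"
  by (simp add: shift_funpow)

lemma shift_funpow_in: "x \<in> full_shift A \<Longrightarrow> (shift ^^ k) x \<in> full_shift A"
  by (simp add: full_shift_def)

lemma shift_in: "x \<in> full_shift A \<Longrightarrow> shift x \<in> full_shift A"
  by (simp add: full_shift_def shift_def)

text \<open>With countably many coordinates the Borel sets of the product topology are generated by
  the coordinates, so measurability can be checked coordinatewise.\<close>

lemma sets_borel_sequences: "sets (borel :: (nat \<Rightarrow> nat) measure) = sets (Pi\<^sub>M UNIV (\<lambda>_. count_space UNIV))"
  unfolding sets_PiM_equal_borel[symmetric] by (rule sets_PiM_cong) (simp_all add: sets_borel_eq_count_space)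

lemma coordinate_measurable_borel: "(\<lambda>x :: nat \<Rightarrow> nat. x k) \<in> measurable borel (count_space UNIV)"
  by (subst measurable_cong_sets[OF sets_borel_sequences refl]) (rule measurable_component_singleton, simp)

lemma coordinate_measurable: "(\<lambda>x. x k) \<in> measurable borel_X (count_space UNIV)"
  by (rule measurable_restrict_space1[OF coordinate_measurable_borel])

lemma measurable_into_borel_X:
  assumes "\<And>k. (\<lambda>\<omega>. f \<omega> k) \<in> measurable M (count_space UNIV)" "\<And>\<omega>. \<omega> \<in> space M \<Longrightarrow> f \<omega> \<in> X"
  shows "f \<in> measurable M borel_X"
proof (rule measurable_restrict_space2)
  show "f \<in> space M \<rightarrow> X" using assms(2) by auto
  show "f \<in> borel_measurable M"
    by (subst measurable_cong_sets[OF refl sets_borel_sequences], rule measurable_PiM_single')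
       (use assms(1) in auto)
qed

lemma shift_measurable: "shift \<in> measurable borel_X borel_X"
  by (rule measurable_into_borel_X) (use coordinate_measurable[of "Suc _"] in \<open>auto simp: shift_in, simp add: shift_def\<close>)

lemma shift_funpow_measurable: "(shift ^^ k) \<in> measurable borel_X borel_X"
  by (rule measurable_into_borel_X) (auto simp: shift_funpow_in intro: coordinate_measurable)

lemma sets_borel_X_coordinates:
  "finite I \<Longrightarrow> {x \<in> X. \<forall>i\<in>I. x i \<in> S i} \<in> sets borel_X"
proof -
  assume I: "finite I"
  have "{x \<in> space borel_X. \<forall>i\<in>I. x i \<in> S i} \<in> sets borel_X"
  proof (intro sets.sets_Collect_finite_All I)
    fix i
    have "(\<lambda>x. x i) -` S i \<inter> space borel_X \<in> sets borel_X"
      by (rule measurable_sets[OF coordinate_measurable]) simp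
    thus "{x \<in> space borel_X. x i \<in> S i} \<in> sets borel_X" by (simp add: vimage_def Int_def conj_commute)
  qed
  thus ?thesis by simp
qed

lemma cylinder_sets: "cylinder pos_nats w \<in> sets borel_X"
  using sets_borel_X_coordinates[of "{..<length w}" "\<lambda>i. {w ! i}"]
  by (simp add: cylinder_def lessThan_iff[symmetric] Ball_def del: lessThan_iff)

text \<open>Finite-valued despite the infinite alphabet: all letters from \<open>L\<close> on are
  merged. One parameter governs both the window and the cap, so the level partitions refine each
  other as \<open>L\<close> grows and exhaust all coordinates.\<close>

definition truncation :: "nat \<Rightarrow> (nat \<Rightarrow> nat) \<Rightarrow> nat list" where
  "truncation L x = map (\<lambda>i. min (x i) L) [0..<L]"

lemma truncation_eq_iff: "truncation L x = truncation L y \<longleftrightarrow> (\<forall>i<L. min (x i) L = min (y i) L)"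
  by (auto simp: truncation_def)

lemma truncation_mono: "L \<le> L' \<Longrightarrow> truncation L' x = truncation L' y \<Longrightarrow> truncation L x = truncation L y"
  unfolding truncation_eq_iff
proof (intro allI impI)
  fix i assume "L \<le> L'" "\<forall>i<L'. min (x i) L' = min (y i) L'" "i < L"
  hence "L \<le> L'" "min (x i) L' = min (y i) L'" by auto
  thus "min (x i) L = min (y i) L" by linarith
qed

lemma truncation_range: "truncation L x \<in> {w. set w \<subseteq> {..L} \<and> length w = L}"
  by (auto simp: truncation_def)

lemma truncation_sets: "{x \<in> X. truncation L x \<in> S} \<in> sets borel_X"
proof -
  have "{x \<in> X. truncation L x \<in> S} = (\<Union>w\<in>S \<inter> {w. set w \<subseteq> {..L} \<and> length w = L}. {x \<in> X. truncation L x = w})"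
    using truncation_range by auto
  also have "\<dots> \<in> sets borel_X"
  proof (intro sets.finite_UN)
    show "finite (S \<inter> {w. set w \<subseteq> {..L} \<and> length w = L})" by (simp add: finite_lists_length_eq)
    fix w assume "w \<in> S \<inter> {w. set w \<subseteq> {..L} \<and> length w = L}"
    hence "{x \<in> X. truncation L x = w} = {x \<in> X. \<forall>i\<in>{..<L}. x i \<in> {p. min p L = w ! i}}"
      by (auto simp: truncation_def list_eq_iff_nth_eq)
    thus "{x \<in> X. truncation L x = w} \<in> sets borel_X"
      using sets_borel_X_coordinates[of "{..<L}" "\<lambda>i. {p. min p L = w ! i}"] by simp
  qed
  finally show ?thesis .
qed

locale shift_measure = prob_space \<mu> for \<mu> :: "(nat \<Rightarrow> nat) measure" +
  assumes sets_eq: "sets \<mu> = sets borel_X"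
begin

lemma space_eq: "space \<mu> = X"
  using sets_eq_imp_space_eq[OF sets_eq] by simp

lemma X_sets: "X \<in> sets \<mu>" using sets.top[of \<mu>] by (simp add: space_eq)

lemma simple_function_truncation: "simple_function \<mu> (truncation L)"
  unfolding simple_function_def
proof (intro conjI ballI)
  show "finite (truncation L ` space \<mu>)"
    by (rule finite_subset[OF _ finite_lists_length_eq[of "{..L}" L]]) (use truncation_range in auto)
  fix w
  show "truncation L -` {w} \<inter> space \<mu> \<in> events"
    using truncation_sets[of L "{w}"] by (simp add: sets_eq space_eq vimage_def Int_def conj_commute)
qed

definition truncation_set :: "nat \<Rightarrow> (nat \<Rightarrow> nat) set \<Rightarrow> bool" where
  "truncation_set L D \<longleftrightarrow> D \<subseteq> X \<and>
    (\<forall>x\<in>X. \<forall>y\<in>X. truncation L x = truncation L y \<longrightarrow> (x \<in> D \<longleftrightarrow> y \<in> D))"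

lemma truncation_set_mono: "truncation_set L D \<Longrightarrow> L \<le> L' \<Longrightarrow> truncation_set L' D"
  unfolding truncation_set_def using truncation_mono by blast

lemma truncation_set_sets:
  assumes "truncation_set L D" shows "D \<in> sets \<mu>"
proof -
  have "D = {x \<in> X. truncation L x \<in> truncation L ` D}"
    using assms by (auto simp: truncation_set_def)
  thus ?thesis using truncation_sets[of L "truncation L ` D"] sets_eq by simp
qed

text \<open>Approximation in symmetric difference. These sets form a sigma-algebra containing the
  coordinate sets, hence are all the Borel sets.\<close>

definition approximable :: "(nat \<Rightarrow> nat) set \<Rightarrow> bool" where
  "approximable B \<longleftrightarrow> B \<in> sets \<mu> \<and>
    (\<forall>e>0. \<exists>L D. truncation_set L D \<and> measure \<mu> ((B - D) \<union> (D - B)) < e)"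

lemma approximable_Compl:
  assumes "approximable B" shows "approximable (X - B)"
  unfolding approximable_def
proof (intro conjI allI impI)
  have B: "B \<in> sets \<mu>" "B \<subseteq> X" using assms sets.sets_into_space space_eq by (auto simp: approximable_def)
  show "X - B \<in> events" using B X_sets by auto
  fix e :: real assume "e > 0"
  then obtain L D where LD: "truncation_set L D" "measure \<mu> ((B - D) \<union> (D - B)) < e"
    using assms by (auto simp: approximable_def)
  have "D \<subseteq> X" using LD(1) by (simp add: truncation_set_def)
  hence "((X - B) - (X - D)) \<union> ((X - D) - (X - B)) = (B - D) \<union> (D - B)" using B by auto
  hence "measure \<mu> (((X - B) - (X - D)) \<union> ((X - D) - (X - B))) < e" using LD(2) by (simp only:)
  moreover have "truncation_set L (X - D)" using LD(1) unfolding truncation_set_def by blast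
  ultimately show "\<exists>L D. truncation_set L D \<and> measure \<mu> (((X - B) - D) \<union> (D - (X - B))) < e"
    by blast
qed

lemma approximable_Un:
  assumes "approximable A" "approximable B" shows "approximable (A \<union> B)"
  unfolding approximable_def
proof (intro conjI allI impI)
  have AB: "A \<in> sets \<mu>" "B \<in> sets \<mu>" using assms by (auto simp: approximable_def)
  thus "A \<union> B \<in> events" by auto
  fix e :: real assume e: "e > 0"
  obtain L D where D: "truncation_set L D" "measure \<mu> ((A - D) \<union> (D - A)) < e / 2"
    using assms(1) e unfolding approximable_def by (meson half_gt_zero)
  obtain L' D' where D': "truncation_set L' D'" "measure \<mu> ((B - D') \<union> (D' - B)) < e / 2"
    using assms(2) e unfolding approximable_def by (meson half_gt_zero)
  have sets: "D \<in> sets \<mu>" "D' \<in> sets \<mu>" using D D' truncation_set_sets by auto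
  have "truncation_set (max L L') D" "truncation_set (max L L') D'"
    using D D' truncation_set_mono by auto
  hence "truncation_set (max L L') (D \<union> D')" unfolding truncation_set_def by blast
  moreover have "measure \<mu> ((A \<union> B - (D \<union> D')) \<union> (D \<union> D' - (A \<union> B)))
      \<le> measure \<mu> (((A - D) \<union> (D - A)) \<union> ((B - D') \<union> (D' - B)))"
    using AB sets by (intro finite_measure_mono) auto
  moreover have "\<dots> \<le> measure \<mu> ((A - D) \<union> (D - A)) + measure \<mu> ((B - D') \<union> (D' - B))"
    using AB sets by (intro measure_Un_le) auto
  ultimately show "\<exists>L D. truncation_set L D \<and> measure \<mu> ((A \<union> B - D) \<union> (D - (A \<union> B))) < e"
    using D(2) D'(2) by (intro exI[of _ "max L L'"] exI[of _ "D \<union> D'"]) auto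
qed

lemma approximable_limit:
  assumes "B \<in> sets \<mu>"
    and "\<And>e. e > 0 \<Longrightarrow> \<exists>A. approximable A \<and> measure \<mu> ((B - A) \<union> (A - B)) < e"
  shows "approximable B"
  unfolding approximable_def
proof (intro conjI allI impI)
  show "B \<in> events" by fact
  fix e :: real assume e: "e > 0"
  obtain A where A: "approximable A" "measure \<mu> ((B - A) \<union> (A - B)) < e / 2"
    using assms(2)[of "e/2"] e by auto
  obtain L D where D: "truncation_set L D" "measure \<mu> ((A - D) \<union> (D - A)) < e / 2"
    using A(1) e unfolding approximable_def by (meson half_gt_zero)
  have sets: "D \<in> sets \<mu>" "A \<in> sets \<mu>" using D A truncation_set_sets by (auto simp: approximable_def)
  have "measure \<mu> ((B - D) \<union> (D - B)) \<le> measure \<mu> (((B - A) \<union> (A - B)) \<union> ((A - D) \<union> (D - A)))"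
    using assms sets by (intro finite_measure_mono) auto
  also have "\<dots> \<le> measure \<mu> ((B - A) \<union> (A - B)) + measure \<mu> ((A - D) \<union> (D - A))"
    using assms sets by (intro measure_Un_le) auto
  finally show "\<exists>L D. truncation_set L D \<and> measure \<mu> ((B - D) \<union> (D - B)) < e"
    using D A by (intro exI[of _ L] exI[of _ D]) auto
qed

lemma truncation_set_approximable: "truncation_set L D \<Longrightarrow> approximable D"
  unfolding approximable_def using truncation_set_sets by fastforce

text \<open>By continuity from below a countable union is nearly a finite one, so closure under
  finite unions and limits is enough.\<close>

lemma approximable_UN:
  fixes A :: "nat \<Rightarrow> (nat \<Rightarrow> nat) set"
  assumes "\<And>i. approximable (A i)" shows "approximable (\<Union>i. A i)"
proof (rule approximable_limit)
  have sets: "A i \<in> sets \<mu>" for i using assms by (auto simp: approximable_def)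
  thus B: "(\<Union>i. A i) \<in> events" by auto
  fix e :: real assume e: "e > 0"
  have fin: "approximable (\<Union>i<n. A i)" for n
  proof (induction n)
    case 0
    show ?case by (simp, rule truncation_set_approximable[of 0]) (auto simp: truncation_set_def)
  next
    case (Suc n)
    thus ?case using approximable_Un[OF assms Suc] by (simp add: lessThan_Suc)
  qed
  have "(\<lambda>n. measure \<mu> (\<Union>i<n. A i)) \<longlonglongrightarrow> measure \<mu> (\<Union>n. \<Union>i<n. A i)"
    using sets by (intro finite_Lim_measure_incseq) (force simp: incseq_def)+
  moreover have "(\<Union>n. \<Union>i<n. A i) = (\<Union>i. A i)" by auto
  ultimately have "(\<lambda>n. measure \<mu> (\<Union>i<n. A i)) \<longlonglongrightarrow> measure \<mu> (\<Union>i. A i)" by simp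
  from LIMSEQ_D[OF this e] obtain n where n: "\<bar>measure \<mu> (\<Union>i<n. A i) - measure \<mu> (\<Union>i. A i)\<bar> < e"
    by auto
  have "measure \<mu> ((\<Union>i. A i) - (\<Union>i<n. A i)) = measure \<mu> (\<Union>i. A i) - measure \<mu> (\<Union>i<n. A i)"
    using sets by (intro finite_measure_Diff) auto
  moreover have "((\<Union>i. A i) - (\<Union>i<n. A i)) \<union> ((\<Union>i<n. A i) - (\<Union>i. A i)) = (\<Union>i. A i) - (\<Union>i<n. A i)" by auto
  ultimately show "\<exists>A'. approximable A' \<and> measure \<mu> (((\<Union>i. A i) - A') \<union> (A' - (\<Union>i. A i))) < e"
    using fin[of n] n by (intro exI[of _ "\<Union>i<n. A i"]) auto
qed

lemma coordinate_tail:
  assumes "e > 0" shows "\<exists>N. \<forall>L\<ge>N. measure \<mu> {x \<in> X. x i \<ge> L} < e"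
proof -
  have sets: "{x \<in> X. x i \<ge> L} \<in> sets \<mu>" for L
    using sets_borel_X_coordinates[of "{i}" "\<lambda>_. {L..}"] by (simp add: sets_eq)
  have "(\<lambda>L. measure \<mu> {x \<in> X. x i \<ge> L}) \<longlonglongrightarrow> measure \<mu> (\<Inter>L. {x \<in> X. x i \<ge> L})"
    using sets by (intro finite_Lim_measure_decseq) (auto simp: decseq_def)
  moreover have "(\<Inter>L. {x \<in> X. x i \<ge> L}) = {}" using not_less_eq_eq by blast
  ultimately have "(\<lambda>L. measure \<mu> {x \<in> X. x i \<ge> L}) \<longlonglongrightarrow> 0" by simp
  from LIMSEQ_D[OF this assms] show ?thesis by auto
qed

text \<open>\<open>S\<close> may be infinite and invisible to any cap; cutting it off at
  \<open>L\<close> costs at most the mass of the coordinate tail.\<close>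

lemma approximable_coordinate: "approximable {x \<in> X. x i \<in> S}"
proof (rule approximable_limit)
  have c: "{x \<in> X. x i \<in> S} \<in> sets \<mu>" for S
    using sets_borel_X_coordinates[of "{i}" "\<lambda>_. S"] by (simp add: sets_eq)
  show "{x \<in> X. x i \<in> S} \<in> events" by (rule c)
  fix e :: real assume "e > 0"
  from coordinate_tail[OF this, of i] obtain N where N: "\<And>L. L \<ge> N \<Longrightarrow> measure \<mu> {x \<in> X. x i \<ge> L} < e" by blast
  \<comment> \<open>Large enough both for the tail bound and for coordinate \<open>i\<close> to lie
    inside the truncated window.\<close>
  define L where "L = max N (Suc i)"
  \<comment> \<open>Strictly below \<open>L\<close>, because the capped value \<open>L\<close> also
    stands for all larger letters.\<close>
  let ?D = "{x \<in> X. x i \<in> S \<and> x i < L}"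
  have "min (x i) L = min (y i) L \<Longrightarrow> x i \<in> S \<and> x i < L \<longleftrightarrow> y i \<in> S \<and> y i < L" for x y :: "nat \<Rightarrow> nat"
    by (auto simp: min_def split: if_splits)
  moreover have "i < L" by (simp add: L_def)
  ultimately have "x i \<in> S \<and> x i < L \<longleftrightarrow> y i \<in> S \<and> y i < L"
    if "truncation L x = truncation L y" for x y
    using that unfolding truncation_eq_iff by metis
  hence "truncation_set L ?D" unfolding truncation_set_def by blast
  moreover have "measure \<mu> (({x \<in> X. x i \<in> S} - ?D) \<union> (?D - {x \<in> X. x i \<in> S})) \<le> measure \<mu> {x \<in> X. x i \<ge> L}"
    using c[of "{L..}"] by (intro finite_measure_mono) auto
  moreover have "measure \<mu> {x \<in> X. x i \<ge> L} < e" by (rule N) (simp add: L_def)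
  ultimately show "\<exists>A. approximable A \<and> measure \<mu> (({x \<in> X. x i \<in> S} - A) \<union> (A - {x \<in> X. x i \<in> S})) < e"
    using truncation_set_approximable by (intro exI[of _ ?D]) auto
qed

lemma all_approximable:
  assumes "B \<in> sets \<mu>" shows "approximable B"
proof -
  obtain A where A: "A \<in> sets (borel :: (nat \<Rightarrow> nat) measure)" "B = A \<inter> X"
    using assms by (auto simp: sets_eq sets_restrict_space)
  have "A \<in> sigma_sets UNIV {{f. f i \<in> S} | i S. True}"
    using A(1) by (simp add: sets_borel_sequences sets_PiM_single)
  hence "approximable (A \<inter> X)"
  proof (induction A rule: sigma_sets.induct)
    case (Basic a)
    then obtain i S where "a \<inter> X = {x \<in> X. x i \<in> S}" by auto
    thus ?case using approximable_coordinate by simp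
  next
    case Empty
    show ?case by (simp, rule truncation_set_approximable[of 0]) (auto simp: truncation_set_def)
  next
    case (Compl a)
    have "(UNIV - a) \<inter> X = X - (a \<inter> X)" by auto
    thus ?case using approximable_Compl[OF Compl.IH] by simp
  next
    case (Union a)
    have "(\<Union>i. a i) \<inter> X = (\<Union>i. a i \<inter> X)" by auto
    thus ?case using approximable_UN[of "\<lambda>i. a i \<inter> X"] Union.IH by simp
  qed
  thus ?thesis using A by simp
qed

end

section \<open>Entropy under small modifications\<close>

text \<open>\<open>ln s \<le> s - 1\<close> at \<open>s = 1 / sqrt t\<close>. The bound is crude
  but, unlike \<open>- t ln t\<close>, monotone in \<open>t\<close>, so an upper estimate of a
  probability can be inserted.\<close>

lemma minus_mult_ln_le:
  fixes t :: real assumes "0 \<le> t" shows "t * - ln t \<le> 2 * sqrt t"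
proof (cases "t = 0")
  case False
  hence t: "t > 0" using assms by simp
  have "ln (1 / sqrt t) \<le> 1 / sqrt t - 1" using t by (intro ln_le_minus_one) simp
  hence "- ln t \<le> 2 * (1 / sqrt t - 1)" using t by (simp add: ln_div ln_sqrt)
  hence "t * - ln t \<le> t * (2 * (1 / sqrt t))" using t by (intro mult_left_mono) auto
  also have "\<dots> = 2 * (t / sqrt t)" by simp
  also have "\<dots> = 2 * sqrt t" using t by (simp only: real_div_sqrt less_imp_le)
  finally show ?thesis .
qed simp

context prob_space
begin

text \<open>Adjoining to \<open>g\<close> the value of \<open>f\<close> where the two differ recovers \<open>f\<close>, and that extra variable is
  constant off a set of measure \<open>q\<close>.\<close>

lemma ent_pair_close:
  assumes f: "simple_function M f" and g: "simple_function M g"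
    and q: "measure M {x \<in> space M. f x \<noteq> g x} \<le> q"
  shows "ent M (\<lambda>x. (f x, g x)) \<le> ent M g + (q + real (card (f ` space M)) * (2 * sqrt q))"
proof -
  define d where "d x = (if f x = g x then None else Some (f x))" for x
  have d: "simple_function M d"
    by (rule simple_function_determined[OF simple_function_Pair[OF f g]]) (simp add: d_def)
  have "ent M (\<lambda>x. (f x, g x)) \<le> ent M (\<lambda>x. (d x, g x))"
    by (rule ent_mono[OF simple_function_Pair[OF d g]]) (auto simp: d_def split: if_splits)
  also have "\<dots> \<le> ent M d + ent M g" by (rule ent_pair_le[OF d g])
  also have "ent M d \<le> q + real (card (f ` space M)) * (2 * sqrt q)"
  proof -
    let ?p = "level_prob M d"
    \<comment> \<open>\<open>None\<close> has probability at least \<open>1 - q\<close>, where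
      \<open>- p ln p \<le> 1 - p \<le> q\<close>; every other value has probability at most
      \<open>q\<close>.\<close>
    let ?b = "\<lambda>u. case u of None \<Rightarrow> q | Some _ \<Rightarrow> 2 * sqrt q"
    have q0: "q \<ge> 0" using q measure_nonneg order_trans by blast
    have fin: "finite (f ` space M)" using f by (simp add: simple_functionD)
    have ne: "{x \<in> space M. f x \<noteq> g x} \<in> events"
      using simple_function_level_sets[OF simple_function_Pair[OF f g], of "{(a,b). a \<noteq> b}"] by simp
    have "?p u * - ln (?p u) \<le> ?b u" for u
    proof (cases u)
      case None
      have "?p None = 1 - measure M {x \<in> space M. f x \<noteq> g x}"
      proof -
        have "{x \<in> space M. d x = None} = space M - {x \<in> space M. f x \<noteq> g x}" by (auto simp: d_def)
        thus ?thesis unfolding level_prob_def using prob_compl[OF ne] by simp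
      qed
      hence p: "1 - ?p None \<le> q" using q by simp
      show ?thesis
      proof (cases "?p None = 0")
        case True thus ?thesis using None q0 by simp
      next
        case False
        hence p0: "?p None > 0" using level_prob_nonneg[of d None] by simp
        have "ln (1 / ?p None) \<le> 1 / ?p None - 1" using p0 by (intro ln_le_minus_one) simp
        hence "?p None * - ln (?p None) \<le> ?p None * (1 / ?p None - 1)"
          using p0 by (intro mult_left_mono) (auto simp: ln_div)
        also have "\<dots> = 1 - ?p None" using p0 by (simp add: field_simps)
        finally show ?thesis using p None by simp
      qed
    next
      case (Some v)
      have "?p u \<le> measure M {x \<in> space M. f x \<noteq> g x}"
        unfolding level_prob_def using ne by (intro finite_measure_mono) (auto simp: Some d_def split: if_splits)
      hence "sqrt (?p u) \<le> sqrt q" using q by (intro real_sqrt_le_mono) linarith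
      moreover have "?b u = 2 * sqrt q" by (simp add: Some)
      ultimately show ?thesis using minus_mult_ln_le[OF level_prob_nonneg[of d u]] by linarith
    qed
    hence "ent M d \<le> (\<Sum>u\<in>d ` space M. ?b u)" unfolding ent_def by (rule sum_mono)
    also have "\<dots> \<le> (\<Sum>u\<in>insert None (Some ` f ` space M). ?b u)"
      using fin q0 by (intro sum_mono2) (auto simp: d_def split: option.splits)
    also have "\<dots> = q + real (card (f ` space M)) * (2 * sqrt q)"
      using fin by (subst sum.insert) (auto simp: sum.reindex)
    finally show ?thesis .
  qed
  finally show ?thesis by simp
qed

end

context shift_measure
begin

text \<open>Approximating each level set of \<open>f\<close> by a truncation set yields a function
  \<open>g\<close> of some truncation that differs from \<open>f\<close> only on a set of measure at
  most \<open>q\<close>. Hence \<open>f\<close> has little entropy left once the truncation is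
  known.\<close>

lemma ent_truncation_close:
  assumes f: "simple_function \<mu> f" and e: "e > 0"
  shows "\<exists>L. ent \<mu> (\<lambda>x. (f x, truncation L x)) \<le> ent \<mu> (truncation L) + e"
proof -
  let ?V = "f ` space \<mu>"
  define k where "k = card ?V"
  have fin: "finite ?V" using f by (simp add: simple_functionD)
  have k: "k > 0" using fin not_empty by (simp add: k_def card_gt_0_iff)
  have "((\<lambda>q. q + real k * (2 * sqrt q)) \<longlongrightarrow> 0 + real k * (2 * sqrt 0)) (at_right 0)"
    by (intro tendsto_intros)
  hence "((\<lambda>q. q + real k * (2 * sqrt q)) \<longlongrightarrow> 0) (at_right 0)" by simp
  hence "eventually (\<lambda>q. q + real k * (2 * sqrt q) < e) (at_right 0)"
    using e order_tendstoD(2) by blast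
  then obtain b where b: "b > 0" "\<And>q. 0 < q \<Longrightarrow> q < b \<Longrightarrow> q + real k * (2 * sqrt q) < e"
    unfolding eventually_at_right_field by blast
  define q where "q = b / 2"
  have q: "q > 0" "q + real k * (2 * sqrt q) < e" using b by (auto simp: q_def)
  have "\<exists>L D. truncation_set L D \<and>
      measure \<mu> (({x \<in> space \<mu>. f x = v} - D) \<union> (D - {x \<in> space \<mu>. f x = v})) < q / k" for v
  proof -
    have "approximable {x \<in> space \<mu>. f x = v}"
      using all_approximable[OF simple_function_level_sets[OF f, of "{v}"]] by simp
    moreover have "q / k > 0" using q k by simp
    ultimately show ?thesis unfolding approximable_def by blast
  qed
  hence "\<forall>v. \<exists>L D. truncation_set L D \<and>
      measure \<mu> (({x \<in> space \<mu>. f x = v} - D) \<union> (D - {x \<in> space \<mu>. f x = v})) < q / k"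
    by (rule allI)
  from choice[OF this] obtain L where "\<forall>v. \<exists>D. truncation_set (L v) D \<and>
      measure \<mu> (({x \<in> space \<mu>. f x = v} - D) \<union> (D - {x \<in> space \<mu>. f x = v})) < q / k" ..
  from choice[OF this] obtain D where LD: "\<And>v. truncation_set (L v) (D v)"
      "\<And>v. measure \<mu> (({x \<in> space \<mu>. f x = v} - D v) \<union> (D v - {x \<in> space \<mu>. f x = v})) < q / k"
    by blast
  define N where "N = Max (L ` ?V)"
  have DN: "truncation_set N (D v)" if "v \<in> ?V" for v
    by (rule truncation_set_mono[OF LD(1)]) (simp add: N_def fin that)
  have DN': "x \<in> D v \<longleftrightarrow> y \<in> D v" if "v \<in> ?V" "x \<in> space \<mu>" "y \<in> space \<mu>" "truncation N x = truncation N y" for v x y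
  proof -
    have "\<forall>x\<in>X. \<forall>y\<in>X. truncation N x = truncation N y \<longrightarrow> (x \<in> D v) = (y \<in> D v)"
      using DN[OF that(1)] unfolding truncation_set_def by (rule conjunct2)
    from this[rule_format, of x y] show ?thesis using that(2-4) by (simp only: space_eq)
  qed
  \<comment> \<open>Approximants may overlap or leave gaps, where the choice is arbitrary. It still
    depends only on which approximants contain \<open>x\<close>, hence only on the
    truncation.\<close>
  define g where "g x = (SOME v. v \<in> ?V \<and> x \<in> D v)" for x
  have g_det: "g x = g y" if "x \<in> space \<mu>" "y \<in> space \<mu>" "truncation N x = truncation N y" for x y
  proof -
    have "(\<lambda>v. v \<in> ?V \<and> x \<in> D v) = (\<lambda>v. v \<in> ?V \<and> y \<in> D v)"
      using DN'[OF _ that] by (intro ext conj_cong refl)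
    thus ?thesis by (simp only: g_def)
  qed
  have g: "simple_function \<mu> g"
    by (rule simple_function_determined[OF simple_function_truncation[of N] g_det])
  let ?S = "\<lambda>v. ({x \<in> space \<mu>. f x = v} - D v) \<union> (D v - {x \<in> space \<mu>. f x = v})"
  have S: "?S v \<in> sets \<mu>" for v
  proof -
    have "{x \<in> space \<mu>. f x = v} \<in> sets \<mu>" using simple_function_level_sets[OF f, of "{v}"] by simp
    thus ?thesis using truncation_set_sets[OF LD(1)[of v]] by (intro sets.Un sets.Diff)
  qed
  have "measure \<mu> {x \<in> space \<mu>. f x \<noteq> g x} \<le> measure \<mu> (\<Union>v\<in>?V. ?S v)"
  proof (rule finite_measure_mono)
    show "(\<Union>v\<in>?V. ?S v) \<in> events" by (rule sets.finite_UN[OF fin S])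
    show "{x \<in> space \<mu>. f x \<noteq> g x} \<subseteq> (\<Union>v\<in>?V. ?S v)"
    proof
      fix x assume x: "x \<in> {x \<in> space \<mu>. f x \<noteq> g x}"
      show "x \<in> (\<Union>v\<in>?V. ?S v)"
      proof (rule ccontr)
        assume "x \<notin> (\<Union>v\<in>?V. ?S v)"
        hence D: "x \<in> D v \<longleftrightarrow> f x = v" if "v \<in> ?V" for v using that x by blast
        have fx: "f x \<in> ?V" using x by blast
        have "g x = f x" unfolding g_def
        proof (rule some_equality)
          show "f x \<in> ?V \<and> x \<in> D (f x)" using D[OF fx] fx by simp
          fix v assume "v \<in> ?V \<and> x \<in> D v"
          thus "v = f x" using D[of v] by simp
        qed
        thus False using x by simp
      qed
    qed
  qed
  also have "\<dots> \<le> (\<Sum>v\<in>?V. measure \<mu> (?S v))"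
    by (rule finite_measure_subadditive_finite[OF fin]) (use S in blast)
  also have "\<dots> \<le> (\<Sum>v\<in>?V. q / k)" using LD(2) by (intro sum_mono) (simp only: less_imp_le)
  also have "\<dots> = q" using k by (simp add: k_def)
  finally have "measure \<mu> {x \<in> space \<mu>. f x \<noteq> g x} \<le> q" .
  from ent_pair_close[OF f g this] have fg: "ent \<mu> (\<lambda>x. (f x, g x)) \<le> ent \<mu> g + e"
    using q(2) unfolding k_def by linarith
  note tr = simple_function_truncation[of N]
  \<comment> \<open>The truncation determines \<open>g\<close>, so by strong subadditivity
    conditioning on it leaves no more entropy than conditioning on \<open>g\<close>.\<close>
  have "ent \<mu> (\<lambda>x. (f x, truncation N x)) \<le> ent \<mu> (\<lambda>x. (f x, truncation N x, g x))"
    by (rule ent_mono[OF simple_function_Pair[OF f simple_function_Pair[OF tr g]]]) simp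
  also have "\<dots> \<le> ent \<mu> (\<lambda>x. (f x, g x)) + ent \<mu> (\<lambda>x. (truncation N x, g x)) - ent \<mu> g"
    using ent_strong_subadditive[OF f tr g] by simp
  also have "ent \<mu> (\<lambda>x. (truncation N x, g x)) \<le> ent \<mu> (truncation N)"
  proof (rule ent_mono[OF tr])
    fix x y assume "x \<in> space \<mu>" "y \<in> space \<mu>" "truncation N x = truncation N y"
    thus "(truncation N x, g x) = (truncation N y, g y)" using g_det[of x y] by simp
  qed
  finally show ?thesis using fg by (intro exI[of _ N]) simp
qed

end

section \<open>Acceptable potentials and pressure\<close>

lemma continuous_on_X_I:
  fixes f :: "(nat \<Rightarrow> nat) \<Rightarrow> real"
  assumes "\<And>x e. x \<in> X \<Longrightarrow> e > 0 \<Longrightarrow> \<exists>m. \<forall>y\<in>X. (\<forall>i<m. y i = x i) \<longrightarrow> \<bar>f y - f x\<bar> < e"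
  shows "continuous_on X f"
  unfolding continuous_on_topological
proof (intro ballI allI impI)
  fix x B assume x: "x \<in> X" and B: "open B" "f x \<in> B"
  then obtain e where e: "e > 0" "\<And>z. \<bar>z - f x\<bar> < e \<Longrightarrow> z \<in> B"
    by (auto simp: open_dist dist_real_def)
  obtain m where m: "\<forall>y\<in>X. (\<forall>i<m. y i = x i) \<longrightarrow> \<bar>f y - f x\<bar> < e" using assms[OF x e(1)] by blast
  define A where "A = (\<Inter>i\<in>{..<m}. (\<lambda>y :: nat \<Rightarrow> nat. y i) -` {x i})"
  have "open ((\<lambda>y :: nat \<Rightarrow> nat. y i) -` {x i})" for i
    by (intro open_vimage continuous_on_product_coordinates) (rule discrete_topology_class.open_discrete)
  hence "open A" unfolding A_def by (intro open_INT) auto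
  moreover have "x \<in> A" by (simp add: A_def)
  moreover have "\<forall>y\<in>X. y \<in> A \<longrightarrow> f y \<in> B"
  proof (intro ballI impI)
    fix y assume "y \<in> X" "y \<in> A"
    hence "\<bar>f y - f x\<bar> < e" using m unfolding A_def by simp
    thus "f y \<in> B" by (rule e(2))
  qed
  ultimately show "\<exists>A. open A \<and> x \<in> A \<and> (\<forall>y\<in>X. y \<in> A \<longrightarrow> f y \<in> B)" by (intro exI conjI)
qed

lemma shift_dist_agree:
  assumes "\<And>i. i < m \<Longrightarrow> x i = y i" shows "shift_dist x y < exp (- real m)"
proof (cases "x = y")
  case False
  then obtain k where "x k \<noteq> y k" by blast
  hence "x (LEAST k. x k \<noteq> y k) \<noteq> y (LEAST k. x k \<noteq> y k)" by (rule LeastI)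
  hence "m \<le> (LEAST k. x k \<noteq> y k)" using assms by (meson not_le)
  thus ?thesis using False by (simp add: shift_dist_def)
qed (simp add: shift_dist_def)

lemma birkhoff_sum_add:
  "birkhoff_sum \<phi> (m + n) x = birkhoff_sum \<phi> m x + birkhoff_sum \<phi> n ((shift ^^ m) x)"
proof -
  have "(\<Sum>k<m + n. \<phi> ((shift ^^ k) x)) = (\<Sum>k<m. \<phi> ((shift ^^ k) x)) + (\<Sum>k\<in>{m..<m+n}. \<phi> ((shift ^^ k) x))"
    by (subst sum.union_disjoint[symmetric]) (auto intro!: sum.cong)
  also have "(\<Sum>k\<in>{m..<m+n}. \<phi> ((shift ^^ k) x)) = (\<Sum>k<n. \<phi> ((shift ^^ (k + m)) x))"
    using sum.shift_bounds_nat_ivl[of "\<lambda>k. \<phi> ((shift ^^ k) x)" 0 m n] by (simp add: lessThan_atLeast0 add.commute)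
  finally show ?thesis by (simp only: birkhoff_sum_def funpow_add comp_apply)
qed

lemma in_cylinder_iff:
  "x \<in> cylinder A w \<longleftrightarrow> x \<in> full_shift A \<and> (\<forall>k<length w. x k = w ! k)"
  by (simp add: cylinder_def)

definition prefix_word :: "nat \<Rightarrow> (nat \<Rightarrow> 'a) \<Rightarrow> 'a list" where
  "prefix_word n x = map x [0..<n]"

lemma length_prefix_word [simp]: "length (prefix_word n x) = n"
  by (simp add: prefix_word_def)

lemma nth_prefix_word [simp]: "i < n \<Longrightarrow> prefix_word n x ! i = x i"
  by (simp add: prefix_word_def)

lemma prefix_word_eq_iff: "prefix_word n x = prefix_word n y \<longleftrightarrow> (\<forall>i<n. x i = y i)"
  by (auto simp: prefix_word_def)

lemma prefix_word_in_words: "x \<in> full_shift A \<Longrightarrow> prefix_word n x \<in> words A n"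
  by (auto simp: words_def prefix_word_def full_shift_def)

lemma in_cylinder_prefix_word: "x \<in> full_shift A \<Longrightarrow> x \<in> cylinder A (prefix_word n x)"
  by (simp add: in_cylinder_iff)

lemma words_1: "words A 1 = (\<lambda>p. [p]) ` A"
  by (auto simp: words_def One_nat_def length_Suc_conv)

definition periodic_word :: "'a list \<Rightarrow> nat \<Rightarrow> 'a" where
  "periodic_word w k = w ! (k mod length w)"

lemma periodic_word_in_cylinder:
  assumes "w \<in> words A n" "n \<ge> 1" shows "periodic_word w \<in> cylinder A w"
  using assms by (auto simp: words_def in_cylinder_iff full_shift_def periodic_word_def subset_iff)

lemma periodic_points_periodic:
  assumes "x \<in> periodic_points n" shows "x (i + n) = x i"
proof -
  have "(shift ^^ n) x = x" using assms by (simp add: periodic_points_def)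
  hence "(shift ^^ n) x i = x i" by simp
  thus ?thesis by (simp add: add.commute)
qed

lemma periodic_points_mod:
  assumes "x \<in> periodic_points n" shows "x (i mod n) = x i"
proof -
  have "x (j + q * n) = x j" for j q
  proof (induction q)
    case (Suc q)
    have "x (j + Suc q * n) = x ((j + q * n) + n)" by (simp add: algebra_simps)
    thus ?case using periodic_points_periodic[OF assms] Suc by simp
  qed simp
  from this[of "i mod n" "i div n"] show ?thesis by simp
qed

lemma periodic_points_subset: "periodic_points n \<subseteq> X"
  by (auto simp: periodic_points_def)

lemma periodic_word_in_periodic_points:
  assumes "w \<in> words pos_nats n" "n \<ge> 1" shows "periodic_word w \<in> periodic_points n"
  using periodic_word_in_cylinder[OF assms] assms
  by (auto simp: periodic_points_def in_cylinder_iff shift_funpow periodic_word_def words_def)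

lemma inj_on_prefix_word_periodic:
  "n \<ge> 1 \<Longrightarrow> inj_on (prefix_word n) (periodic_points n)"
proof (rule inj_onI)
  fix x y assume n: "n \<ge> 1" and xy: "x \<in> periodic_points n" "y \<in> periodic_points n" "prefix_word n x = prefix_word n y"
  show "x = y"
  proof
    fix i
    have "x (i mod n) = y (i mod n)" using xy(3) n by (auto simp: prefix_word_eq_iff)
    thus "x i = y i" using periodic_points_mod xy by metis
  qed
qed

locale acceptable_potential =
  fixes \<phi> :: "(nat \<Rightarrow> nat) \<Rightarrow> real"
  assumes acceptable: "acceptable pos_nats \<phi>"
    and finite_pressure: "pressure pos_nats \<phi> < \<infinity>"
begin

abbreviation S :: "nat \<Rightarrow> (nat \<Rightarrow> nat) \<Rightarrow> real" where "S \<equiv> birkhoff_sum \<phi>"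

lemma uniformly_continuous:
  assumes "e > 0"
  shows "\<exists>m. \<forall>x\<in>X. \<forall>y\<in>X. (\<forall>i<m. x i = y i) \<longrightarrow> \<bar>\<phi> x - \<phi> y\<bar> < e"
proof -
  obtain d where d: "d > 0" "\<And>x y. x \<in> X \<Longrightarrow> y \<in> X \<Longrightarrow> shift_dist x y < d \<Longrightarrow> \<bar>\<phi> x - \<phi> y\<bar> < e"
    using acceptable assms unfolding acceptable_def by blast
  obtain m where m: "real m > - ln d" using reals_Archimedean2 by blast
  hence "exp (- real m) < exp (ln d)" by (subst exp_less_cancel_iff) linarith
  hence "exp (- real m) < d" using d(1) by simp
  hence "shift_dist x y < d" if "\<forall>i<m. x i = y i" for x y :: "nat \<Rightarrow> nat"
    using shift_dist_agree[of m x y] that by auto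
  thus ?thesis using d(2) by (intro exI[of _ m]) blast
qed

lemma oscillation: "\<exists>C\<ge>0. \<forall>x\<in>X. \<forall>y\<in>X. x 0 = y 0 \<longrightarrow> \<bar>\<phi> x - \<phi> y\<bar> \<le> C"
proof -
  let ?o = "\<lambda>p. (SUP x\<in>cylinder pos_nats [p]. ereal (\<phi> x)) - (INF x\<in>cylinder pos_nats [p]. ereal (\<phi> x))"
  have "(SUP p\<in>pos_nats. ?o p) < \<infinity>" using acceptable unfolding acceptable_def by blast
  then obtain C where C: "(SUP p\<in>pos_nats. ?o p) \<le> ereal C"
    using ereal_dense2 less_imp_le by blast
  have "\<phi> x - \<phi> y \<le> C" if "x \<in> X" "y \<in> X" "x 0 = y 0" for x y
  proof -
    have cyl: "x \<in> cylinder pos_nats [x 0]" "y \<in> cylinder pos_nats [x 0]" using that by (auto simp: in_cylinder_iff)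
    have "ereal (\<phi> x) - ereal (\<phi> y) \<le> ?o (x 0)"
      by (intro ereal_minus_mono SUP_upper INF_lower cyl)
    also have "\<dots> \<le> (SUP p\<in>pos_nats. ?o p)" by (rule SUP_upper) (rule full_shiftD[OF that(1)])
    also note C
    finally show ?thesis by simp
  qed
  thus ?thesis by (intro exI[of _ "max C 0"]) (fastforce simp: abs_le_iff)
qed

text \<open>At time \<open>k\<close> the two points still agree on \<open>n - k\<close> coordinates.
  Uniform continuity makes each term smaller than \<open>e\<close> except at the last
  \<open>m\<close> times, which are bounded by the oscillation constant and collected in
  \<open>K\<close>.\<close>

lemma distortion:
  assumes "e > 0"
  shows "\<exists>K\<ge>0. \<forall>n. \<forall>x\<in>X. \<forall>y\<in>X. (\<forall>i<n. x i = y i) \<longrightarrow> \<bar>S n x - S n y\<bar> \<le> e * real n + K"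
proof -
  obtain m where m: "\<And>x y. x \<in> X \<Longrightarrow> y \<in> X \<Longrightarrow> (\<forall>i<m. x i = y i) \<Longrightarrow> \<bar>\<phi> x - \<phi> y\<bar> < e"
    using uniformly_continuous[OF assms] by blast
  obtain C where C: "C \<ge> 0" "\<And>x y. x \<in> X \<Longrightarrow> y \<in> X \<Longrightarrow> x 0 = y 0 \<Longrightarrow> \<bar>\<phi> x - \<phi> y\<bar> \<le> C"
    using oscillation by blast
  have "\<bar>S n x - S n y\<bar> \<le> e * real n + C * real m"
    if xy: "x \<in> X" "y \<in> X" "\<forall>i<n. x i = y i" for n x y
  proof -
    have "\<bar>S n x - S n y\<bar> \<le> (\<Sum>k<n. \<bar>\<phi> ((shift ^^ k) x) - \<phi> ((shift ^^ k) y)\<bar>)"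
      unfolding birkhoff_sum_def sum_subtractf[symmetric] by (rule sum_abs)
    also have "\<dots> \<le> (\<Sum>k<n. e + (if k \<in> {n - m..<n} then C else 0))"
    proof (rule sum_mono)
      fix k assume k: "k \<in> {..<n}"
      show "\<bar>\<phi> ((shift ^^ k) x) - \<phi> ((shift ^^ k) y)\<bar> \<le> e + (if k \<in> {n - m..<n} then C else 0)"
      proof (cases "k \<in> {n - m..<n}")
        case True
        have "(shift ^^ k) x 0 = (shift ^^ k) y 0" using xy(3) k by simp
        from C(2)[OF shift_funpow_in[OF xy(1)] shift_funpow_in[OF xy(2)] this] show ?thesis
          using True assms by (simp del: shift_funpow_apply)
      next
        case False
        have "\<forall>i<m. (shift ^^ k) x i = (shift ^^ k) y i" using xy(3) k False by auto
        from m[OF shift_funpow_in[OF xy(1)] shift_funpow_in[OF xy(2)] this] show ?thesis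
          using False by (auto simp del: shift_funpow_apply)
      qed
    qed
    also have "\<dots> = e * real n + C * real (card ({..<n} \<inter> {n - m..<n}))"
    proof -
      have "(\<Sum>k<n. if k \<in> {n - m..<n} then C else 0) = (\<Sum>k\<in>{..<n} \<inter> {n - m..<n}. C)"
        by (rule sum.inter_restrict[symmetric]) simp
      thus ?thesis by (simp only: sum.distrib) (simp add: mult.commute)
    qed
    also have "\<dots> \<le> e * real n + C * real m"
    proof -
      have "card ({..<n} \<inter> {n - m..<n}) \<le> card {n - m..<n}" by (intro card_mono) auto
      hence "card ({..<n} \<inter> {n - m..<n}) \<le> m" by simp
      thus ?thesis using C(1) by (intro add_left_mono mult_left_mono) auto
    qed
    finally show ?thesis .
  qed
  thus ?thesis using C(1) by (intro exI[of _ "C * real m"]) auto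
qed

lemma continuous: "continuous_on X \<phi>"
proof (rule continuous_on_X_I)
  fix x and e :: real assume "x \<in> X" "e > 0"
  thus "\<exists>m. \<forall>y\<in>X. (\<forall>i<m. y i = x i) \<longrightarrow> \<bar>\<phi> y - \<phi> x\<bar> < e"
    using uniformly_continuous[of e] by metis
qed

lemma measurable: "\<phi> \<in> borel_measurable borel_X"
  by (rule borel_measurable_continuous_on_restrict[OF continuous])

section \<open>Word sums and the pressure\<close>

definition wsup :: "nat \<Rightarrow> nat list \<Rightarrow> ennreal" where
  "wsup n w = (SUP x\<in>cylinder pos_nats w. ennreal (exp (S n x)))"

definition wsum :: "nat \<Rightarrow> ennreal" where
  "wsum n = (\<Sum>\<^sub>\<infinity>w\<in>words pos_nats n. wsup n w)"

lemma wsup_upper: "x \<in> cylinder pos_nats w \<Longrightarrow> ennreal (exp (S n x)) \<le> wsup n w"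
  unfolding wsup_def by (rule SUP_upper)

lemma finite_sum_le_wsum: "finite F \<Longrightarrow> F \<subseteq> words pos_nats n \<Longrightarrow> (\<Sum>w\<in>F. wsup n w) \<le> wsum n"
  unfolding wsum_def by (subst nonneg_infsum_complete) (auto intro!: SUP_upper)

lemma wsum_least:
  "(\<And>F. finite F \<Longrightarrow> F \<subseteq> words pos_nats n \<Longrightarrow> (\<Sum>w\<in>F. wsup n w) \<le> B) \<Longrightarrow> wsum n \<le> B"
  unfolding wsum_def by (subst nonneg_infsum_complete) (auto intro!: SUP_least)

lemma wsup_add_le: 
  assumes "length w = m + n"
  shows "wsup (m + n) w \<le> wsup m (take m w) * wsup n (drop m w)"
  unfolding wsup_def[of "m+n"]
proof (rule SUP_least)
  fix x assume x: "x \<in> cylinder pos_nats w"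
  have "ennreal (exp (S (m + n) x)) = ennreal (exp (S m x)) * ennreal (exp (S n ((shift ^^ m) x)))"
    by (simp add: birkhoff_sum_add exp_add ennreal_mult)
  also have "\<dots> \<le> wsup m (take m w) * wsup n (drop m w)"
    using x assms by (intro mult_mono wsup_upper) (auto simp: in_cylinder_iff shift_funpow_in)
  finally show "ennreal (exp (S (m + n) x)) \<le> wsup m (take m w) * wsup n (drop m w)" .
qed

text \<open>Cutting words at position \<open>m\<close> is injective, so the sum embeds in the
  product of the two sums. Values in \<open>ennreal\<close> postpone the question of
  convergence.\<close>

lemma wsum_add_le: "wsum (m + n) \<le> wsum m * wsum n"
proof (rule wsum_least)
  fix F assume F: "finite F" "F \<subseteq> words pos_nats (m + n)"
  have len: "length w = m + n" if "w \<in> F" for w using F that by (auto simp: words_def)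
  have "(\<Sum>w\<in>F. wsup (m + n) w) \<le> (\<Sum>w\<in>F. wsup m (take m w) * wsup n (drop m w))"
    using len by (intro sum_mono wsup_add_le)
  also have "\<dots> = (\<Sum>(u, v)\<in>(\<lambda>w. (take m w, drop m w)) ` F. wsup m u * wsup n v)"
  proof -
    have "inj_on (\<lambda>w. (take m w, drop m w)) F"
      by (rule inj_onI) (metis append_take_drop_id prod.inject)
    thus ?thesis by (simp add: sum.reindex)
  qed
  also have "\<dots> \<le> (\<Sum>(u, v)\<in>take m ` F \<times> drop m ` F. wsup m u * wsup n v)"
    using F(1) by (intro sum_mono2) auto
  also have "\<dots> = (\<Sum>u\<in>take m ` F. wsup m u) * (\<Sum>v\<in>drop m ` F. wsup n v)"
    by (simp add: sum_product sum.cartesian_product)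
  also have "\<dots> \<le> wsum m * wsum n"
    using F len by (intro mult_mono finite_sum_le_wsum) (auto simp: words_def dest!: in_set_takeD in_set_dropD)
  finally show "(\<Sum>w\<in>F. wsup (m + n) w) \<le> wsum m * wsum n" .
qed

lemma ones_in_X: "(\<lambda>_. 1) \<in> X" by (simp add: full_shift_def)

lemma S_ones: "S n (\<lambda>_. 1) = real n * \<phi> (\<lambda>_. 1)"
  by (simp add: birkhoff_sum_def shift_funpow)

lemma wsum_ge_ones: "wsum n \<ge> ennreal (exp (real n * \<phi> (\<lambda>_. 1)))"
proof -
  have "ennreal (exp (S n (\<lambda>_. 1))) \<le> wsup n (prefix_word n (\<lambda>_. 1))"
    by (intro wsup_upper in_cylinder_prefix_word ones_in_X)
  also have "\<dots> \<le> wsum n"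
    using finite_sum_le_wsum[of "{prefix_word n (\<lambda>_. 1)}" n] prefix_word_in_words[OF ones_in_X] by simp
  finally show ?thesis by (simp add: S_ones)
qed

text \<open>Appending \<open>n\<close> ones to a letter changes the weight by a bounded factor: the
  tail of ones has a fixed Birkhoff sum and altering \<open>x\<close> beyond its first letter costs
  at most \<open>C\<close>. Thus an infinite sum over letters would make all word sums, and so the
  pressure, infinite.\<close>

lemma wsum_1_le: "\<exists>c. wsum 1 \<le> ennreal c * wsum (Suc n)"
proof -
  obtain C where C: "C \<ge> 0" "\<And>x y. x \<in> X \<Longrightarrow> y \<in> X \<Longrightarrow> x 0 = y 0 \<Longrightarrow> \<bar>\<phi> x - \<phi> y\<bar> \<le> C"
    using oscillation by blast
  define c where "c = exp (C - real n * \<phi> (\<lambda>_. 1))"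
  define ext where "ext w = (hd w # replicate n 1 :: nat list)" for w
  define pt where "pt w = (\<lambda>i :: nat. if i = 0 then hd w else 1 :: nat)" for w
  have le: "wsup 1 w \<le> ennreal c * wsup (Suc n) (ext w)" if w: "w \<in> words pos_nats 1" for w
    unfolding wsup_def[of 1]
  proof (rule SUP_least)
    fix x assume x: "x \<in> cylinder pos_nats w"
    obtain p where p: "w = [p]" "p \<ge> 1" using w by (auto simp: words_1)
    have ptX: "pt w \<in> X" using p by (simp add: pt_def full_shift_def)
    have cyl: "pt w \<in> cylinder pos_nats (ext w)"
      using ptX by (auto simp: in_cylinder_iff ext_def pt_def nth_Cons split: nat.splits)
    have "(shift ^^ 1) (pt w) = (\<lambda>_. 1)" by (auto simp: shift_funpow pt_def)
    hence "S (Suc n) (pt w) = \<phi> (pt w) + real n * \<phi> (\<lambda>_. 1)"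
    proof -
      have "S (Suc n) (pt w) = S 1 (pt w) + S n (\<lambda>_. 1)"
        using birkhoff_sum_add[of \<phi> 1 n "pt w"] \<open>(shift ^^ 1) (pt w) = (\<lambda>_. 1)\<close>
        by (simp only: plus_1_eq_Suc)
      thus ?thesis unfolding S_ones by (simp add: birkhoff_sum_def One_nat_def)
    qed
    moreover have "\<bar>\<phi> x - \<phi> (pt w)\<bar> \<le> C"
      using x ptX p by (intro C(2)) (auto simp: in_cylinder_iff pt_def)
    ultimately have "S 1 x \<le> (C - real n * \<phi> (\<lambda>_. 1)) + S (Suc n) (pt w)" by (simp add: birkhoff_sum_def)
    hence "exp (S 1 x) \<le> c * exp (S (Suc n) (pt w))" unfolding c_def exp_add[symmetric] by simp
    hence "ennreal (exp (S 1 x)) \<le> ennreal c * ennreal (exp (S (Suc n) (pt w)))"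
      by (subst ennreal_mult[symmetric]) (auto simp: c_def intro: ennreal_leI)
    also have "\<dots> \<le> ennreal c * wsup (Suc n) (ext w)" by (intro mult_left_mono wsup_upper cyl) simp
    finally show "ennreal (exp (S 1 x)) \<le> ennreal c * wsup (Suc n) (ext w)" .
  qed
  have "wsum 1 \<le> ennreal c * wsum (Suc n)"
  proof (rule wsum_least)
    fix F assume F: "finite F" "F \<subseteq> words pos_nats 1"
    have inj: "inj_on ext F" 
    proof (rule inj_onI)
      fix v w assume "v \<in> F" "w \<in> F" "ext v = ext w"
      moreover obtain p q where "v = [p]" "w = [q]"
        using subsetD[OF F(2) \<open>v \<in> F\<close>] subsetD[OF F(2) \<open>w \<in> F\<close>] by (auto simp: words_1)
      ultimately show "v = w" by (simp add: ext_def)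
    qed
    have "(\<Sum>w\<in>F. wsup 1 w) \<le> (\<Sum>w\<in>F. ennreal c * wsup (Suc n) (ext w))" using le F by (intro sum_mono) auto
    also have "\<dots> = ennreal c * (\<Sum>w\<in>ext ` F. wsup (Suc n) w)"
      by (simp add: sum.reindex[OF inj] sum_distrib_left)
    also have "\<dots> \<le> ennreal c * wsum (Suc n)"
    proof (intro mult_left_mono finite_sum_le_wsum)
      show "ext ` F \<subseteq> words pos_nats (Suc n)"
      proof (rule image_subsetI)
        fix w assume "w \<in> F"
        then obtain p where "w = [p]" "p \<ge> 1" using F by (auto simp: words_1)
        thus "ext w \<in> words pos_nats (Suc n)" by (auto simp: ext_def words_def)
      qed
    qed (use F in auto)
    finally show "(\<Sum>w\<in>F. wsup 1 w) \<le> ennreal c * wsum (Suc n)" .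
  qed
  thus ?thesis by blast
qed

lemma pressure_eq: "pressure pos_nats \<phi> = lim (\<lambda>n. elog (wsum n) / ereal (real n))"
  by (simp add: pressure_def wsum_def wsup_def)

lemma wsum_1_finite: "wsum 1 < \<infinity>"
proof (rule ccontr)
  assume "\<not> wsum 1 < \<infinity>"
  hence inf: "wsum 1 = \<infinity>" by (simp add: less_top[symmetric])
  have "wsum (Suc n) = \<infinity>" for n
  proof -
    obtain c where "wsum 1 \<le> ennreal c * wsum (Suc n)" using wsum_1_le by blast
    hence "ennreal c * wsum (Suc n) = \<infinity>" using inf by (simp add: top_unique)
    thus ?thesis by (simp add: ennreal_mult_eq_top_iff)
  qed
  hence "elog (wsum (Suc n)) / ereal (real (Suc n)) = \<infinity>" for n by (simp add: elog_def)
  hence "(\<lambda>n. elog (wsum (Suc n)) / ereal (real (Suc n))) \<longlonglongrightarrow> \<infinity>" by simp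
  hence "(\<lambda>n. elog (wsum n) / ereal (real n)) \<longlonglongrightarrow> \<infinity>" by (rule LIMSEQ_imp_Suc)
  hence "pressure pos_nats \<phi> = \<infinity>" unfolding pressure_eq by (rule limI)
  thus False using finite_pressure by simp
qed

lemma wsum_0: "wsum 0 = 1"
proof -
  have "words pos_nats 0 = {[]}" by (auto simp: words_def)
  moreover have "wsup 0 [] = 1"
    using ones_in_X by (simp add: wsup_def birkhoff_sum_def cylinder_def image_constant_conv) (use ones_in_X in blast)
  ultimately show ?thesis by (simp add: wsum_def)
qed

lemma wsum_finite: "wsum n < \<infinity>"
proof (induction n)
  case (Suc n)
  have "wsum (1 + n) \<le> wsum 1 * wsum n" by (rule wsum_add_le)
  also have "\<dots> < \<infinity>" using Suc wsum_1_finite by (simp add: ennreal_mult_less_top)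
  finally show ?case by (simp only: plus_1_eq_Suc)
qed (simp add: wsum_0)

definition rwsum :: "nat \<Rightarrow> real" where "rwsum n = enn2real (wsum n)"

lemma ennreal_rwsum: "ennreal (rwsum n) = wsum n"
  using wsum_finite[of n] by (simp add: rwsum_def)

lemma rwsum_ge: "rwsum n \<ge> exp (real n * \<phi> (\<lambda>_. 1))"
proof -
  have "ennreal (exp (real n * \<phi> (\<lambda>_. 1))) \<le> ennreal (rwsum n)"
    unfolding ennreal_rwsum by (rule wsum_ge_ones)
  thus ?thesis by (subst (asm) ennreal_le_iff) (simp_all add: rwsum_def)
qed

lemma rwsum_pos: "rwsum n > 0"
  using rwsum_ge[of n] exp_gt_zero less_le_trans by blast

lemma rwsum_add_le: "rwsum (m + n) \<le> rwsum m * rwsum n"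
proof -
  have "ennreal (rwsum (m + n)) \<le> ennreal (rwsum m * rwsum n)"
    using wsum_add_le[of m n] rwsum_pos[of m] rwsum_pos[of n] by (simp add: ennreal_mult ennreal_rwsum)
  thus ?thesis using rwsum_pos[of m] rwsum_pos[of n] by (subst (asm) ennreal_le_iff) simp_all
qed

definition P :: real where "P = real_of_ereal (pressure pos_nats \<phi>)"

text \<open>Fekete's lemma for \<open>ln (rwsum n)\<close>, with the constant sequence of ones
  providing the linear lower bound. The \<open>lim\<close> in the definition of the pressure is
  thereby a genuine and finite limit.\<close>

lemma rwsum_limit_ex: "\<exists>l. pressure pos_nats \<phi> = ereal l \<and> (\<lambda>n. ln (rwsum n) / real n) \<longlonglongrightarrow> l
    \<and> (\<forall>n\<ge>1. l \<le> ln (rwsum n) / real n)"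
proof -
  obtain l where l: "(\<lambda>n. ln (rwsum n) / real n) \<longlonglongrightarrow> l"
      "\<And>n. n \<ge> 1 \<Longrightarrow> l \<le> ln (rwsum n) / real n"
  proof (rule fekete[of "\<lambda>n. ln (rwsum n)"])
    fix m n
    have "ln (rwsum (m + n)) \<le> ln (rwsum m * rwsum n)"
      using rwsum_add_le rwsum_pos by (subst ln_le_cancel_iff) auto
    thus "ln (rwsum (m + n)) \<le> ln (rwsum m) + ln (rwsum n)"
      using rwsum_pos[of m] rwsum_pos[of n] by (simp add: ln_mult)
    show "ln (rwsum n) \<ge> \<phi> (\<lambda>_. 1) * real n"
      using rwsum_ge[of n] rwsum_pos[of n] by (simp add: ln_ge_iff mult.commute)
  qed blast
  have "elog (wsum n) / ereal (real n) = ereal (ln (rwsum n) / real n)" if "n > 0" for n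
    using rwsum_pos[of n] wsum_finite[of n] that ennreal_rwsum[of n]
    by (auto simp: elog_def rwsum_def[symmetric]) 
  hence "eventually (\<lambda>n. ereal (ln (rwsum n) / real n) = elog (wsum n) / ereal (real n)) sequentially"
    by (intro eventually_sequentiallyI[of 1]) auto
  hence "(\<lambda>n. elog (wsum n) / ereal (real n)) \<longlonglongrightarrow> ereal l"
    using l(1) by (elim Lim_transform_eventually[rotated]) auto
  hence "pressure pos_nats \<phi> = ereal l" unfolding pressure_eq by (rule limI)
  thus ?thesis using l by blast
qed

lemma pressure_eq_P: "pressure pos_nats \<phi> = ereal P"
  and rwsum_limit: "(\<lambda>n. ln (rwsum n) / real n) \<longlonglongrightarrow> P"
  and P_le_ln_rwsum: "n \<ge> 1 \<Longrightarrow> P \<le> ln (rwsum n) / real n"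
  using rwsum_limit_ex by (auto simp: P_def)

lemma rwsum_ge_exp_P:
  assumes "n \<ge> 1" shows "rwsum n \<ge> exp (real n * P)"
proof -
  have "real n * P \<le> ln (rwsum n)" using P_le_ln_rwsum[OF assms] assms by (simp add: field_simps)
  thus ?thesis using rwsum_pos[of n] by (simp add: ln_ge_iff)
qed

text \<open>Points with distinct prefixes lie in distinct cylinders. This serves periodic points as
  well as points sampled from the atoms of a partition.\<close>

lemma separated_sum_le:
  assumes "finite F" "F \<subseteq> X" "inj_on (prefix_word n) F"
  shows "(\<Sum>x\<in>F. exp (S n x)) \<le> rwsum n"
proof -
  have "ennreal (\<Sum>x\<in>F. exp (S n x)) = (\<Sum>x\<in>F. ennreal (exp (S n x)))" by (simp add: sum_ennreal)
  also have "\<dots> \<le> (\<Sum>x\<in>F. wsup n (prefix_word n x))"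
    using assms by (intro sum_mono wsup_upper in_cylinder_prefix_word) auto
  also have "\<dots> = (\<Sum>w\<in>prefix_word n ` F. wsup n w)" by (simp add: sum.reindex[OF assms(3)])
  also have "\<dots> \<le> wsum n"
    using assms prefix_word_in_words by (intro finite_sum_le_wsum) auto
  finally have "ennreal (\<Sum>x\<in>F. exp (S n x)) \<le> ennreal (rwsum n)" by (simp add: ennreal_rwsum)
  thus ?thesis using rwsum_pos[of n] by (subst (asm) ennreal_le_iff) auto
qed

text \<open>The supremum of \<open>exp \<phi>\<close> over a one-letter cylinder. These weights are
  summable and their products dominate \<open>exp (S n x)\<close>, so letters can be estimated as if
  they were independent.\<close>

definition letter_weight :: "nat \<Rightarrow> real" where
  "letter_weight p = enn2real (wsup 1 [p])"

lemma sum_letter_weight_le: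
  assumes "finite F" "F \<subseteq> pos_nats" shows "(\<Sum>p\<in>F. letter_weight p) \<le> rwsum 1"
proof -
  have inj: "inj_on (\<lambda>p. [p]) F" by (simp add: inj_on_def)
  have "(\<Sum>w\<in>(\<lambda>p. [p]) ` F. wsup 1 w) \<le> wsum 1"
    using assms by (intro finite_sum_le_wsum) (auto simp: words_def One_nat_def)
  hence le: "(\<Sum>p\<in>F. wsup 1 [p]) \<le> wsum 1" by (simp add: sum.reindex[OF inj])
  hence "(\<Sum>p\<in>F. wsup 1 [p]) < \<infinity>" using wsum_1_finite by simp
  hence "(\<Sum>p\<in>F. letter_weight p) = enn2real (\<Sum>p\<in>F. wsup 1 [p])"
    unfolding letter_weight_def using assms(1) by (subst enn2real_sum) auto
  also have "\<dots> \<le> rwsum 1" unfolding rwsum_def using le wsum_1_finite by (intro enn2real_mono) auto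
  finally show ?thesis .
qed

lemma letter_weight_nonneg: "letter_weight p \<ge> 0"
  by (simp add: letter_weight_def)

lemma exp_le_letter_weight:
  assumes "x \<in> X" shows "exp (\<phi> x) \<le> letter_weight (x 0)"
proof -
  have "(\<Sum>w\<in>{[x 0]}. wsup 1 w) \<le> wsum 1"
    using full_shiftD[OF assms, of 0] by (intro finite_sum_le_wsum) (auto simp: words_def One_nat_def)
  hence fin: "wsup 1 [x 0] < \<infinity>" using wsum_1_finite by simp
  have "ennreal (exp (S 1 x)) \<le> wsup 1 [x 0]" using assms by (intro wsup_upper) (simp add: in_cylinder_iff)
  also have "\<dots> = ennreal (letter_weight (x 0))" using fin by (simp add: letter_weight_def)
  finally show ?thesis
    by (subst (asm) ennreal_le_iff) (simp_all add: letter_weight_nonneg birkhoff_sum_def One_nat_def)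
qed

lemma exp_S_le_prod:
  assumes "x \<in> X" shows "exp (S n x) \<le> (\<Prod>k<n. letter_weight (x k))"
  unfolding birkhoff_sum_def exp_sum[OF finite_lessThan]
  using exp_le_letter_weight[OF shift_funpow_in[OF assms]] by (intro prod_mono) auto

lemma bounded_above: "\<exists>B. \<forall>x\<in>X. \<phi> x \<le> B"
proof (intro exI ballI)
  fix x assume x: "x \<in> X"
  have "exp (\<phi> x) \<le> letter_weight (x 0)" by (rule exp_le_letter_weight[OF x])
  also have "\<dots> \<le> rwsum 1" using sum_letter_weight_le[of "{x 0}"] full_shiftD[OF x, of 0] by simp
  finally show "\<phi> x \<le> ln (rwsum 1)" using rwsum_pos[of 1] by (simp add: ln_ge_iff)
qed

section \<open>Sums over periodic points\<close>

lemma summable_periodic: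
  assumes "n \<ge> 1" shows "(\<lambda>x. exp (S n x)) summable_on periodic_points n"
proof (rule nonneg_bdd_above_summable_on)
  show "bdd_above (sum (\<lambda>x. exp (S n x)) ` {F. F \<subseteq> periodic_points n \<and> finite F})"
  proof (rule bdd_aboveI2)
    fix F assume "F \<in> {F. F \<subseteq> periodic_points n \<and> finite F}"
    thus "(\<Sum>x\<in>F. exp (S n x)) \<le> rwsum n"
      using periodic_points_subset inj_on_subset[OF inj_on_prefix_word_periodic[OF assms]]
      by (intro separated_sum_le) auto
  qed
qed simp

text \<open>Each cylinder contains the periodic repetition of its word, whose weight is within the
  distortion of the supremum. This keeps the normalizing denominator from falling exponentially
  below \<open>exp (n P)\<close>.\<close>

lemma partition_sum_ge:
  assumes "e > 0"
  shows "\<exists>K. \<forall>n\<ge>1. exp (- (e * real n + K)) * rwsum n \<le> partition_sum \<phi> n"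
proof -
  obtain K where K: "\<And>n x y. x \<in> X \<Longrightarrow> y \<in> X \<Longrightarrow> (\<forall>i<n. x i = y i) \<Longrightarrow> \<bar>S n x - S n y\<bar> \<le> e * real n + K"
    using distortion[OF assms] by blast
  have "exp (- (e * real n + K)) * rwsum n \<le> partition_sum \<phi> n" if n: "n \<ge> 1" for n
  proof -
    let ?c = "exp (e * real n + K)"
    have Z0: "partition_sum \<phi> n \<ge> 0" unfolding partition_sum_def by (rule infsum_nonneg) simp
    have "wsum n \<le> ennreal (?c * partition_sum \<phi> n)"
    proof (rule wsum_least)
      fix F assume F: "finite F" "F \<subseteq> words pos_nats n"
      have "wsup n w \<le> ennreal (?c * exp (S n (periodic_word w)))" if w: "w \<in> F" for w
        unfolding wsup_def
      proof (rule SUP_least)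
        fix x assume x: "x \<in> cylinder pos_nats w"
        have pw: "periodic_word w \<in> cylinder pos_nats w" using periodic_word_in_cylinder F w n by auto
        have "length w = n" using F w by (auto simp: words_def)
        hence "\<bar>S n x - S n (periodic_word w)\<bar> \<le> e * real n + K"
          using x pw by (intro K) (auto simp: in_cylinder_iff)
        hence "exp (S n x) \<le> ?c * exp (S n (periodic_word w))" unfolding exp_add[symmetric] by simp
        thus "ennreal (exp (S n x)) \<le> ennreal (?c * exp (S n (periodic_word w)))" by (rule ennreal_leI)
      qed
      hence "(\<Sum>w\<in>F. wsup n w) \<le> (\<Sum>w\<in>F. ennreal (?c * exp (S n (periodic_word w))))" by (rule sum_mono)
      also have "\<dots> = ennreal (?c * (\<Sum>w\<in>F. exp (S n (periodic_word w))))" by (simp add: sum_ennreal sum_distrib_left)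
      also have "\<dots> \<le> ennreal (?c * partition_sum \<phi> n)"
      proof (intro ennreal_leI mult_left_mono)
        have inj: "inj_on periodic_word F"
        proof (rule inj_onI)
          fix v w assume vw: "v \<in> F" "w \<in> F" "periodic_word v = periodic_word w"
          have "length v = n" "length w = n" using F vw by (auto simp: words_def)
          thus "v = w" using fun_cong[OF vw(3)] by (intro nth_equalityI) (auto simp: periodic_word_def, metis mod_less)
        qed
        have "(\<Sum>w\<in>F. exp (S n (periodic_word w))) = (\<Sum>x\<in>periodic_word ` F. exp (S n x))"
          by (simp add: sum.reindex[OF inj])
        also have "\<dots> \<le> partition_sum \<phi> n" unfolding partition_sum_def
          using F periodic_word_in_periodic_points[OF _ n]
          by (intro finite_sum_le_infsum summable_periodic n) auto
        finally show "(\<Sum>w\<in>F. exp (S n (periodic_word w))) \<le> partition_sum \<phi> n" .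
      qed simp
      finally show "(\<Sum>w\<in>F. wsup n w) \<le> ennreal (?c * partition_sum \<phi> n)" .
    qed
    hence "ennreal (rwsum n) \<le> ennreal (?c * partition_sum \<phi> n)" by (simp add: ennreal_rwsum)
    hence "rwsum n \<le> ?c * partition_sum \<phi> n" using Z0 by (subst (asm) ennreal_le_iff) auto
    thus ?thesis by (simp only: exp_minus) (simp add: field_simps)
  qed
  thus ?thesis by blast
qed

lemma partition_sum_pos: "n \<ge> 1 \<Longrightarrow> partition_sum \<phi> n > 0"
  using partition_sum_ge[of 1] rwsum_pos[of n] by (metis exp_gt_zero less_le_trans mult_pos_pos zero_less_one)

end

section \<open>The variational inequality\<close>

text \<open>Otherwise \<open>I - p * f\<close> is positive on \<open>E\<close> with integral zero,
  which makes \<open>E\<close> null; then \<open>p = I = 0\<close> and the strict inequality reads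
  \<open>0 < 0\<close>. Null but nonempty \<open>E\<close> are thus included.\<close>

lemma real_integral_average_attained:
  fixes f :: "'a \<Rightarrow> real"
  assumes "finite_measure M" and f: "integrable M f" and E: "E \<in> sets M" "E \<noteq> {}"
  shows "\<exists>x\<in>E. (\<integral>x. indicator E x * f x \<partial>M) \<le> measure M E * f x"
proof (rule ccontr)
  interpret finite_measure M by fact
  assume "\<not> ?thesis"
  hence less: "measure M E * f x < (\<integral>x. indicator E x * f x \<partial>M)" if "x \<in> E" for x using that by (simp add: not_le)
  define I where "I = (\<integral>x. indicator E x * f x \<partial>M)"
  define p where "p = measure M E"
  have int: "integrable M (\<lambda>x. indicator E x * f x)"
    using integrable_mult_indicator[OF E(1) f] by simp
  have intE: "integrable M (\<lambda>x. indicator E x :: real)" using E by (simp add: integrable_indicator_iff emeasure_eq_measure)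
  have "(\<integral>x. indicator E x * (I - p * f x) \<partial>M) = I * p - p * I"
  proof -
    have "(\<integral>x. indicator E x * (I - p * f x) \<partial>M) = (\<integral>x. I * indicator E x - p * (indicator E x * f x) \<partial>M)"
      by (intro Bochner_Integration.integral_cong) (auto simp: algebra_simps)
    also have "\<dots> = I * (\<integral>x. indicator E x \<partial>M) - p * I"
      using int intE by (subst Bochner_Integration.integral_diff) (auto simp: I_def)
    also have "(\<integral>x. indicator E x \<partial>M) = p"
      using E sets.sets_into_space[OF E(1)] by (simp add: p_def Int_absorb2)
    finally show ?thesis .
  qed
  hence zero: "(\<integral>x. indicator E x * (I - p * f x) \<partial>M) = 0" by simp
  have "integrable M (\<lambda>x. I * indicator E x - p * (indicator E x * f x))" using int intE by auto
  hence "integrable M (\<lambda>x. indicator E x * (I - p * f x))" by (simp add: algebra_simps)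
  moreover have "0 \<le> indicator E x * (I - p * f x)" for x
    using less[of x] by (cases "x \<in> E") (auto simp: I_def p_def)
  ultimately have "AE x in M. indicator E x * (I - p * f x) = 0"
    using zero by (subst (asm) integral_nonneg_eq_0_iff_AE) auto
  moreover have "indicator E x * (I - p * f x) \<noteq> 0" if "x \<in> E" for x
    using less[OF that] that by (simp add: I_def p_def)
  ultimately have ae: "AE x in M. x \<notin> E" by (elim eventually_mono) blast
  moreover have "{x \<in> space M. \<not> x \<notin> E} = E" using sets.sets_into_space[OF E(1)] by auto
  ultimately have "emeasure M E = 0" using AE_iff_measurable[OF E(1), of "\<lambda>x. x \<notin> E"] by simp
  hence "p = 0" by (simp add: p_def measure_def)
  moreover have "I = 0"
    unfolding I_def using ae by (intro integral_eq_zero_AE) (auto simp: indicator_def)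
  ultimately show False using less E(2) by (auto simp: I_def p_def)
qed

lemma ext_integral_eq:
  assumes "integrable M f" shows "ext_integral M f = ereal (\<integral>x. f x \<partial>M)"
proof -
  have "(\<integral>\<^sup>+x. ennreal (f x) \<partial>M) \<noteq> \<infinity>" "(\<integral>\<^sup>+x. ennreal (- f x) \<partial>M) \<noteq> \<infinity>"
    using assms by (auto simp: real_integrable_def)
  thus ?thesis unfolding ext_integral_def real_lebesgue_integral_def[OF assms]
    by (cases "\<integral>\<^sup>+x. ennreal (f x) \<partial>M" rule: ennreal_cases; cases "\<integral>\<^sup>+x. ennreal (- f x) \<partial>M" rule: ennreal_cases)
       auto
qed

lemma invariant_measures_locales:
  assumes "\<nu> \<in> invariant_measures"
  shows "shift_measure \<nu>" "measure_preserving_map \<nu> shift"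
proof -
  have \<nu>: "prob_space \<nu>" "sets \<nu> = sets borel_X" "distr \<nu> borel_X shift = \<nu>"
    using assms by (auto simp: invariant_measures_def prob_measures_def)
  show "shift_measure \<nu>" using \<nu> by (simp add: shift_measure_def shift_measure_axioms_def)
  have "distr \<nu> \<nu> shift = distr \<nu> borel_X shift" by (rule distr_cong) (simp_all add: \<nu>(2))
  hence "distr \<nu> \<nu> shift = \<nu>" using \<nu>(3) by simp
  moreover have "shift \<in> measurable \<nu> \<nu>"
    using shift_measurable measurable_cong_sets[OF \<nu>(2) \<nu>(2)] by blast
  ultimately show "measure_preserving_map \<nu> shift"
    using \<nu>(1) by (simp add: measure_preserving_map_def measure_preserving_map_axioms_def)
qed

text \<open>A finite-valued function of one coordinate, so that its itineraries of length
  \<open>n\<close> depend on the first \<open>n\<close> letters only and compare directly with word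
  sums.\<close>

definition capped_letter :: "nat \<Rightarrow> (nat \<Rightarrow> nat) \<Rightarrow> nat" where
  "capped_letter L x = min (x 0) L"

lemma (in shift_measure) simple_function_capped_letter: "simple_function \<mu> (capped_letter L)"
proof (rule simple_function_determined[OF simple_function_truncation[of "Suc L"]])
  fix x y assume "truncation (Suc L) x = truncation (Suc L) y"
  hence "min (x 0) (Suc L) = min (y 0) (Suc L)" by (simp add: truncation_eq_iff)
  thus "capped_letter L x = capped_letter L y" unfolding capped_letter_def by linarith
qed

lemma itinerary_capped_letter_eq_iff:
  "itinerary shift (capped_letter L) n x = itinerary shift (capped_letter L) n y \<longleftrightarrow>
    (\<forall>i<n. min (x i) L = min (y i) L)"
  by (simp add: itinerary_eq_iff capped_letter_def)

context acceptable_potential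
begin

lemma integrable_of_ext_integral:
  assumes "\<nu> \<in> prob_measures" "ext_integral \<nu> \<phi> > -\<infinity>"
  shows "integrable \<nu> \<phi>"
proof -
  have \<nu>: "prob_space \<nu>" "sets \<nu> = sets borel_X" using assms by (auto simp: prob_measures_def)
  interpret prob_space \<nu> by fact
  have sp: "space \<nu> = X" using sets_eq_imp_space_eq[OF \<nu>(2)] by simp
  have m: "\<phi> \<in> borel_measurable \<nu>" using measurable measurable_cong_sets[OF \<nu>(2) refl] by blast
  obtain B where B: "\<And>x. x \<in> X \<Longrightarrow> \<phi> x \<le> B" using bounded_above by blast
  have "(\<integral>\<^sup>+x. ennreal (\<phi> x) \<partial>\<nu>) \<le> (\<integral>\<^sup>+x. ennreal B \<partial>\<nu>)"
    using B by (intro nn_integral_mono ennreal_leI) (simp add: sp)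
  also have "\<dots> < \<infinity>" by (simp add: emeasure_space_1)
  finally have pos: "(\<integral>\<^sup>+x. ennreal (\<phi> x) \<partial>\<nu>) \<noteq> \<infinity>" by simp
  moreover have "(\<integral>\<^sup>+x. ennreal (- \<phi> x) \<partial>\<nu>) \<noteq> \<infinity>"
  proof
    assume "(\<integral>\<^sup>+x. ennreal (- \<phi> x) \<partial>\<nu>) = \<infinity>"
    hence "ext_integral \<nu> \<phi> = -\<infinity>" using pos unfolding ext_integral_def
      by (cases "\<integral>\<^sup>+x. ennreal (\<phi> x) \<partial>\<nu>" rule: ennreal_cases) auto
    thus False using assms by simp
  qed
  ultimately show ?thesis using m by (simp add: real_integrable_def)
qed

text \<open>Gibbs' inequality with one sample point per atom, chosen where \<open>S n\<close> is at
  least its average over the atom. Points of different atoms have different prefixes, so their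
  weights add up to at most \<open>rwsum n\<close>.\<close>

lemma ent_capped_itinerary_le:
  assumes inv: "\<nu> \<in> invariant_measures" and int: "integrable \<nu> \<phi>"
  shows "ent \<nu> (itinerary shift (capped_letter L) n) + real n * (\<integral>x. \<phi> x \<partial>\<nu>) \<le> ln (rwsum n)"
proof -
  interpret shift_measure \<nu> by (rule invariant_measures_locales[OF inv])
  interpret I: measure_preserving_map \<nu> shift by (rule invariant_measures_locales[OF inv])
  define f where "f = itinerary shift (capped_letter L) n"
  have f: "simple_function \<nu> f" unfolding f_def
    by (rule I.simple_function_itinerary[OF simple_function_capped_letter])
  let ?V = "f ` space \<nu>"
  have fin: "finite ?V" using f by (rule simple_functionD)
  define E where "E v = {x \<in> space \<nu>. f x = v}" for v
  have E: "E v \<in> sets \<nu>" for v using simple_function_level_sets[OF f, of "{v}"] by (simp add: E_def)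
  have intk: "integrable \<nu> (\<lambda>x. \<phi> ((shift ^^ k) x))" "(\<integral>x. \<phi> ((shift ^^ k) x) \<partial>\<nu>) = (\<integral>x. \<phi> x \<partial>\<nu>)" for k
  proof -
    have m: "\<phi> \<in> borel_measurable \<nu>" using int by auto
    show "integrable \<nu> (\<lambda>x. \<phi> ((shift ^^ k) x))"
      using integrable_distr[OF I.T_funpow_measurable[of k], of \<phi>] int by (simp only: I.T_funpow_preserves)
    show "(\<integral>x. \<phi> ((shift ^^ k) x) \<partial>\<nu>) = (\<integral>x. \<phi> x \<partial>\<nu>)"
      using integral_distr[OF I.T_funpow_measurable[of k] m] by (simp only: I.T_funpow_preserves)
  qed
  have intS: "integrable \<nu> (S n)" unfolding birkhoff_sum_def[abs_def] using intk(1) by auto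
  have "(\<integral>x. S n x \<partial>\<nu>) = real n * (\<integral>x. \<phi> x \<partial>\<nu>)"
    unfolding birkhoff_sum_def by (subst Bochner_Integration.integral_sum) (auto simp: intk simp del: shift_funpow_apply)
  moreover have "(\<integral>x. S n x \<partial>\<nu>) = (\<Sum>v\<in>?V. (\<integral>x. indicator (E v) x * S n x \<partial>\<nu>))"
  proof -
    have "(\<integral>x. S n x \<partial>\<nu>) = (\<integral>x. (\<Sum>v\<in>?V. indicator (E v) x * S n x) \<partial>\<nu>)"
    proof (intro Bochner_Integration.integral_cong refl)
      fix x assume x: "x \<in> space \<nu>"
      have "(\<Sum>v\<in>?V. indicator (E v) x * S n x) = (\<Sum>v\<in>?V. if v = f x then S n x else 0)"
        using x by (intro sum.cong) (auto simp: E_def indicator_def)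
      thus "S n x = (\<Sum>v\<in>?V. indicator (E v) x * S n x)" using x fin by simp
    qed
    also have "\<dots> = (\<Sum>v\<in>?V. (\<integral>x. indicator (E v) x * S n x \<partial>\<nu>))"
      using integrable_mult_indicator[OF E intS] by (intro Bochner_Integration.integral_sum) simp
    finally show ?thesis .
  qed
  moreover have "\<exists>x\<in>E v. (\<integral>x. indicator (E v) x * S n x \<partial>\<nu>) \<le> level_prob \<nu> f v * S n x" if "v \<in> ?V" for v
  proof -
    have "E v \<noteq> {}" using that by (auto simp: E_def)
    from real_integral_average_attained[OF finite_measure_axioms intS E this]
    show ?thesis by (simp add: level_prob_def E_def)
  qed
  then obtain y where y: "\<And>v. v \<in> ?V \<Longrightarrow> y v \<in> E v"
    "\<And>v. v \<in> ?V \<Longrightarrow> (\<integral>x. indicator (E v) x * S n x \<partial>\<nu>) \<le> level_prob \<nu> f v * S n (y v)"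
    by metis
  have le: "(\<Sum>v\<in>?V. (\<integral>x. indicator (E v) x * S n x \<partial>\<nu>)) \<le> (\<Sum>v\<in>?V. level_prob \<nu> f v * S n (y v))"
    by (intro sum_mono y(2))
  have fy: "f (y v) = v" "y v \<in> X" if "v \<in> ?V" for v using y(1)[OF that] by (auto simp: E_def space_eq)
  ultimately have "real n * (\<integral>x. \<phi> x \<partial>\<nu>) \<le> (\<Sum>v\<in>?V. level_prob \<nu> f v * ln (exp (S n (y v))))"
    unfolding ln_exp using le by simp
  moreover have "ent \<nu> f + (\<Sum>v\<in>?V. level_prob \<nu> f v * ln (exp (S n (y v)))) \<le> ln (\<Sum>v\<in>?V. exp (S n (y v)))"
    by (rule ent_gibbs[OF f]) simp
  moreover have "(\<Sum>v\<in>?V. exp (S n (y v))) \<le> rwsum n"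
  proof -
    have inj: "inj_on y ?V" by (rule inj_onI) (metis fy(1))
    have "(\<Sum>v\<in>?V. exp (S n (y v))) = (\<Sum>x\<in>y ` ?V. exp (S n x))" by (simp add: sum.reindex[OF inj])
    also have "\<dots> \<le> rwsum n"
    proof (rule separated_sum_le)
      show "inj_on (prefix_word n) (y ` ?V)"
      proof (rule inj_onI)
        fix a b assume ab: "a \<in> y ` ?V" "b \<in> y ` ?V" "prefix_word n a = prefix_word n b"
        then obtain v w where vw: "v \<in> ?V" "w \<in> ?V" "a = y v" "b = y w" by blast
        have "f a = f b" using ab(3) by (simp add: f_def itinerary_capped_letter_eq_iff prefix_word_eq_iff)
        thus "a = b" using vw fy(1) by metis
      qed
    qed (use fin fy in auto)
    finally show ?thesis .
  qed
  moreover have "ln (\<Sum>v\<in>?V. exp (S n (y v))) \<le> ln (rwsum n)"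
    using calculation(3) rwsum_pos[of n] fin not_empty by (subst ln_le_cancel_iff) (auto intro!: sum_pos)
  ultimately show ?thesis unfolding f_def by linarith
qed

text \<open>An arbitrary partition is replaced by a truncation at a cost of \<open>e\<close> per
  time step, and the truncations by capped letters over a window longer by \<open>L\<close>, which
  does not affect the rate.\<close>

lemma variational_inequality:
  assumes "\<nu> \<in> invariant_measures_for \<phi>"
  shows "measure_entropy \<nu> shift + ext_integral \<nu> \<phi> \<le> ereal P"
proof -
  have inv: "\<nu> \<in> invariant_measures" "ext_integral \<nu> \<phi> > -\<infinity>" "\<nu> \<in> prob_measures"
    using assms by (auto simp: invariant_measures_for_def invariant_measures_def)
  have int: "integrable \<nu> \<phi>" by (rule integrable_of_ext_integral[OF inv(3,2)])
  interpret shift_measure \<nu> by (rule invariant_measures_locales[OF inv(1)])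
  interpret I: measure_preserving_map \<nu> shift by (rule invariant_measures_locales[OF inv(1)])
  define J where "J = (\<integral>x. \<phi> x \<partial>\<nu>)"
  have "measure_entropy \<nu> shift \<le> ereal (P - J)"
  proof (rule I.measure_entropy_le)
    fix f :: "(nat \<Rightarrow> nat) \<Rightarrow> (nat \<Rightarrow> nat) set" and l
    assume f: "simple_function \<nu> f" and l: "(\<lambda>n. ent \<nu> (itinerary shift f n) / real n) \<longlonglongrightarrow> l"
    have "l \<le> P - J + e" if e: "e > 0" for e
    proof -
      obtain L where L: "ent \<nu> (\<lambda>x. (f x, truncation L x)) \<le> ent \<nu> (truncation L) + e"
        using ent_truncation_close[OF f e] by blast
      have bound: "ent \<nu> (itinerary shift f n) / real n \<le>
          (ln (rwsum (n + L)) / real (n + L) - J) * (real (n + L) / real n) + e" if n: "n \<ge> 1" for n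
      proof -
        have "ent \<nu> (itinerary shift f n) \<le> ent \<nu> (itinerary shift (truncation L) n) + real n * e"
          by (rule I.ent_itinerary_compare[OF f simple_function_truncation L])
        \<comment> \<open>A truncation at time \<open>k < n\<close> reads coordinates up to
          \<open>k + L - 1\<close>, all within a window of length \<open>n + L\<close>.\<close>
        also have "ent \<nu> (itinerary shift (truncation L) n) \<le> ent \<nu> (itinerary shift (capped_letter L) (n + L))"
        proof (rule ent_mono[OF I.simple_function_itinerary[OF simple_function_capped_letter]])
          fix x y assume "itinerary shift (capped_letter L) (n + L) x = itinerary shift (capped_letter L) (n + L) y"
          thus "itinerary shift (truncation L) n x = itinerary shift (truncation L) n y"
            unfolding itinerary_capped_letter_eq_iff by (simp add: itinerary_eq_iff truncation_eq_iff)
        qed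
        also have "\<dots> \<le> ln (rwsum (n + L)) - real (n + L) * J"
          using ent_capped_itinerary_le[OF inv(1) int, of L "n + L"] by (simp add: J_def)
        also have "\<dots> = (ln (rwsum (n + L)) / real (n + L) - J) * real (n + L)"
          using n by (simp add: field_simps)
        finally have "ent \<nu> (itinerary shift f n) / real n
            \<le> ((ln (rwsum (n + L)) / real (n + L) - J) * real (n + L) + real n * e) / real n"
          by (intro divide_right_mono) auto
        also have "\<dots> = (ln (rwsum (n + L)) / real (n + L) - J) * (real (n + L) / real n) + e"
          using n by (simp only: add_divide_distrib times_divide_eq_right) simp
        finally show ?thesis .
      qed
      have "(\<lambda>n. ln (rwsum (n + L)) / real (n + L)) \<longlonglongrightarrow> P"
        by (rule LIMSEQ_ignore_initial_segment[OF rwsum_limit])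
      moreover have "(\<lambda>n. real (n + L) / real n) \<longlonglongrightarrow> 1"
      proof -
        have "(\<lambda>n. 1 + real L / real n) \<longlonglongrightarrow> 1 + 0"
          by (intro tendsto_add tendsto_const lim_const_over_n)
        moreover have "eventually (\<lambda>n. 1 + real L / real n = real (n + L) / real n) sequentially"
          by (intro eventually_sequentiallyI[of 1]) (auto simp: field_simps)
        ultimately show ?thesis by (simp add: Lim_transform_eventually)
      qed
      ultimately have "(\<lambda>n. (ln (rwsum (n + L)) / real (n + L) - J) * (real (n + L) / real n) + e)
          \<longlonglongrightarrow> (P - J) * 1 + e"
        by (intro tendsto_intros)
      from LIMSEQ_le[OF l this] bound show ?thesis by auto
    qed
    hence "l \<le> P - J" by (rule field_le_epsilon)
    thus "ereal l \<le> ereal (P - J)" by simp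
  qed
  hence "measure_entropy \<nu> shift + ext_integral \<nu> \<phi> \<le> ereal (P - J) + ereal J"
    unfolding ext_integral_eq[OF int] J_def by (intro add_mono) auto
  thus ?thesis by simp
qed

lemma free_energy_nonpos: "free_energy \<phi> \<nu> \<le> 0"
proof (cases "\<nu> \<in> invariant_measures_for \<phi>")
  case True
  thus ?thesis using variational_inequality[OF True]
    by (simp add: free_energy_def pressure_eq_P ereal_minus_le_iff)
qed (simp add: free_energy_def)

lemma rate_function_nonneg: "\<mu> \<in> topspace weak_star \<Longrightarrow> rate_function \<phi> \<mu> \<ge> 0"
proof -
  assume "\<mu> \<in> topspace weak_star"
  hence "(INF G\<in>{G. openin weak_star G \<and> \<mu> \<in> G}. SUP \<nu>\<in>G. free_energy \<phi> \<nu>)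
      \<le> (SUP \<nu>\<in>topspace weak_star. free_energy \<phi> \<nu>)" by (intro INF_lower) auto
  also have "\<dots> \<le> 0" by (rule SUP_least) (rule free_energy_nonpos)
  finally show ?thesis unfolding rate_function_def by simp
qed

text \<open>Since the rate function is an infimum over neighbourhoods, being nonzero at one point
  already yields a uniform gap \<open>c\<close> around it.\<close>

lemma rate_function_pos_nbhd:
  assumes "\<mu> \<in> topspace weak_star" "rate_function \<phi> \<mu> \<noteq> 0"
  shows "\<exists>G c. openin weak_star G \<and> \<mu> \<in> G \<and> c > 0 \<and> (\<forall>\<nu>\<in>G. free_energy \<phi> \<nu> \<le> ereal (- c))"
proof -
  have "(INF G\<in>{G. openin weak_star G \<and> \<mu> \<in> G}. SUP \<nu>\<in>G. free_energy \<phi> \<nu>) < 0"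
    using rate_function_nonneg[OF assms(1)] assms(2) unfolding rate_function_def by (simp add: order_less_le)
  then obtain G where G: "openin weak_star G" "\<mu> \<in> G" "(SUP \<nu>\<in>G. free_energy \<phi> \<nu>) < 0"
    unfolding INF_less_iff by auto
  obtain r where r: "(SUP \<nu>\<in>G. free_energy \<phi> \<nu>) < ereal r" "ereal r < 0"
    using ereal_dense2[OF G(3)] by blast
  have "free_energy \<phi> \<nu> \<le> ereal (- (- r))" if "\<nu> \<in> G" for \<nu>
    using SUP_upper[OF that, of "free_energy \<phi>"] r(1) by simp
  moreover have "- r > 0" using r(2) by simp
  ultimately show ?thesis using G by blast
qed

end

section \<open>Cylinder neighbourhoods in the weak* topology\<close>

definition cylinder_prob :: "(nat \<Rightarrow> nat) measure \<Rightarrow> nat list \<Rightarrow> real" where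
  "cylinder_prob \<mu> w = measure \<mu> (cylinder pos_nats w)"

lemma topspace_weak_star: "topspace weak_star = prob_measures"
proof -
  let ?\<S> = "{{\<mu> \<in> prob_measures. (\<integral>x. f x \<partial>\<mu>) \<in> U} | f (U :: real set).
       continuous_on X f \<and> bounded (f ` X) \<and> open U}"
  have "prob_measures \<in> ?\<S>"
    by (rule CollectI, rule exI[of _ "\<lambda>_. 0"], rule exI[of _ UNIV]) (auto simp: bounded_iff)
  moreover have "\<Union>?\<S> \<subseteq> prob_measures" by blast
  ultimately have "\<Union>?\<S> = prob_measures" by blast
  thus ?thesis unfolding weak_star_def by simp
qed

lemma prob_measures_shift_measure: "\<mu> \<in> prob_measures \<Longrightarrow> shift_measure \<mu>"
  by (simp add: prob_measures_def shift_measure_def shift_measure_axioms_def)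

lemma open_contains_agreeing:
  fixes A :: "(nat \<Rightarrow> nat) set"
  assumes "open A" "x \<in> A"
  shows "\<exists>m. \<forall>y. (\<forall>i<m. y i = x i) \<longrightarrow> y \<in> A"
proof -
  have "openin (product_topology (\<lambda>i. euclidean) UNIV) A"
    using assms(1) by (simp add: euclidean_product_topology)
  from product_topology_open_contains_basis[OF this assms(2)]
  obtain U where U: "x \<in> (\<Pi>\<^sub>E i\<in>UNIV. U i)" "finite {i. U i \<noteq> UNIV}" "(\<Pi>\<^sub>E i\<in>UNIV. U i) \<subseteq> A"
    by auto
  obtain m where m: "\<forall>i\<in>{i. U i \<noteq> UNIV}. i < m" using U(2) finite_nat_set_iff_bounded by blast
  have "y \<in> A" if y: "\<forall>i<m. y i = x i" for y
  proof -
    have "y i \<in> U i" for i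
    proof (cases "U i = UNIV")
      case False
      hence "y i = x i" using m y by blast
      thus ?thesis using U(1) by (auto simp: PiE_iff)
    qed simp
    thus ?thesis using U(3) by (auto simp: PiE_iff)
  qed
  thus ?thesis by blast
qed

definition small_oscillation :: "((nat \<Rightarrow> nat) \<Rightarrow> real) \<Rightarrow> real \<Rightarrow> nat list \<Rightarrow> bool" where
  "small_oscillation f h w \<longleftrightarrow> (\<forall>y\<in>cylinder pos_nats w. \<forall>z\<in>cylinder pos_nats w. \<bar>f y - f z\<bar> \<le> h)"

lemma small_oscillation_prefix_mono:
  assumes "small_oscillation f h (prefix_word m x)" "m \<le> n"
  shows "small_oscillation f h (prefix_word n x)"
proof -
  have "cylinder pos_nats (prefix_word n x) \<subseteq> cylinder pos_nats (prefix_word m x)"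
    using assms(2) by (auto simp: in_cylinder_iff)
  thus ?thesis using assms(1) unfolding small_oscillation_def by blast
qed

lemma small_oscillation_prefix_ex:
  assumes "continuous_on X f" "h > 0" "x \<in> X"
  shows "\<exists>m. small_oscillation f h (prefix_word m x)"
proof -
  have op: "open (ball (f x) (h / 2))" and fx: "f x \<in> ball (f x) (h / 2)" using assms by auto
  from assms(1)[unfolded continuous_on_topological, rule_format, OF assms(3) op fx]
  obtain A where A: "open A" "x \<in> A" "\<And>y. y \<in> X \<Longrightarrow> y \<in> A \<Longrightarrow> f y \<in> ball (f x) (h / 2)" by blast
  obtain m where m: "\<And>y. (\<forall>i<m. y i = x i) \<Longrightarrow> y \<in> A" using open_contains_agreeing[OF A(1,2)] by blast
  have close: "\<bar>f x - f y\<bar> < h / 2" if "y \<in> cylinder pos_nats (prefix_word m x)" for y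
    using A(3)[of y] m[of y] that by (auto simp: in_cylinder_iff dist_real_def)
  have "\<bar>f y - f z\<bar> \<le> h" if "y \<in> cylinder pos_nats (prefix_word m x)" "z \<in> cylinder pos_nats (prefix_word m x)" for y z
    using close[OF that(1)] close[OF that(2)] by linarith
  thus ?thesis unfolding small_oscillation_def by blast
qed

definition bounded_words :: "nat \<Rightarrow> nat \<Rightarrow> nat list set" where
  "bounded_words m N = {w. set w \<subseteq> {1..N} \<and> length w = m}"

lemma finite_bounded_words: "finite (bounded_words m N)"
  unfolding bounded_words_def by (rule finite_lists_length_eq) simp

lemma disjoint_cylinders:
  "length v = length w \<Longrightarrow> x \<in> cylinder A v \<Longrightarrow> x \<in> cylinder A w \<Longrightarrow> v = w"
  by (auto simp: in_cylinder_iff intro: nth_equalityI)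

context shift_measure
begin

lemma cylinder_events: "cylinder pos_nats w \<in> events"
  using cylinder_sets sets_eq by simp

text \<open>Two passages to the limit: every point has some prefix on whose cylinder
  \<open>f\<close> is nearly constant, so the mass tends to 1 with the length \<open>m\<close>;
  bounding the letters by \<open>N\<close> then makes the family finite.\<close>

lemma small_oscillation_cover:
  assumes f: "continuous_on X f" and h: "h > 0"
  shows "\<exists>m N. measure \<mu> (\<Union>w\<in>{w\<in>bounded_words m N. small_oscillation f h w}. cylinder pos_nats w) > 1 - h"
proof -
  define C where "C m N = (\<Union>w\<in>{w\<in>bounded_words m N. small_oscillation f h w}. cylinder pos_nats w)" for m N
  define A where "A m = (\<Union>N. C m N)" for m
  have C_iff: "x \<in> C m N \<longleftrightarrow> x \<in> X \<and> (\<forall>i<m. x i \<le> N) \<and> small_oscillation f h (prefix_word m x)" for x m N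
  proof
    assume "x \<in> C m N"
    then obtain w where w: "w \<in> bounded_words m N" "small_oscillation f h w" "x \<in> cylinder pos_nats w"
      by (auto simp: C_def)
    hence eq: "w = prefix_word m x"
      by (intro disjoint_cylinders[OF _ w(3) in_cylinder_prefix_word]) (auto simp: bounded_words_def in_cylinder_iff)
    thus "x \<in> X \<and> (\<forall>i<m. x i \<le> N) \<and> small_oscillation f h (prefix_word m x)"
    proof (intro conjI allI impI)
      show "x \<in> X" using w(3) by (simp add: in_cylinder_iff)
      show "small_oscillation f h (prefix_word m x)" using w(2) eq by simp
      fix i assume "i < m"
      hence "x i \<in> set w" unfolding eq prefix_word_def by simp
      thus "x i \<le> N" using w(1) by (auto simp: bounded_words_def)
    qed
  next
    assume x: "x \<in> X \<and> (\<forall>i<m. x i \<le> N) \<and> small_oscillation f h (prefix_word m x)"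
    hence "prefix_word m x \<in> bounded_words m N"
      using full_shiftD[of x pos_nats] by (auto simp: bounded_words_def prefix_word_def)
    thus "x \<in> C m N" using x in_cylinder_prefix_word[of x pos_nats m] by (auto simp: C_def)
  qed
  have C: "C m N \<in> events" for m N
    unfolding C_def using finite_bounded_words cylinder_events by (intro sets.finite_UN) auto
  have A: "A m \<in> events" for m unfolding A_def using C by auto
  have "(\<lambda>m. measure \<mu> (A m)) \<longlonglongrightarrow> measure \<mu> (\<Union>m. A m)"
  proof (rule finite_Lim_measure_incseq)
    show "incseq A"
    proof (rule incseq_SucI, rule subsetI)
      fix m x assume "x \<in> A m"
      then obtain N where N: "x \<in> C m N" by (auto simp: A_def)
      hence "x \<in> C (Suc m) (max N (x m))"
        using small_oscillation_prefix_mono[of f h m x "Suc m"] by (auto simp: C_iff less_Suc_eq intro: le_max_iff_disj[THEN iffD2])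
      thus "x \<in> A (Suc m)" by (auto simp: A_def)
    qed
  qed (use A in auto)
  moreover have "(\<Union>m. A m) = space \<mu>"
  proof (intro equalityI subsetI)
    fix x assume "x \<in> (\<Union>m. A m)" thus "x \<in> space \<mu>" by (auto simp: A_def C_iff space_eq)
  next
    fix x assume "x \<in> space \<mu>"
    hence x: "x \<in> X" by (simp add: space_eq)
    obtain m where m: "small_oscillation f h (prefix_word m x)" using small_oscillation_prefix_ex[OF f h x] by blast
    have "x \<in> C m (Max (x ` {..<m}))" using x m by (auto simp: C_iff)
    thus "x \<in> (\<Union>m. A m)" by (auto simp: A_def)
  qed
  ultimately have "(\<lambda>m. measure \<mu> (A m)) \<longlonglongrightarrow> 1" by (simp add: prob_space)
  hence "eventually (\<lambda>m. measure \<mu> (A m) > 1 - h) sequentially" using h by (intro order_tendstoD(1)) auto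
  then obtain m where m: "measure \<mu> (A m) > 1 - h" by (auto simp: eventually_sequentially)
  have "(\<lambda>N. measure \<mu> (C m N)) \<longlonglongrightarrow> measure \<mu> (\<Union>N. C m N)"
  proof (rule finite_Lim_measure_incseq)
    show "range (C m) \<subseteq> events" using C by auto
    show "incseq (C m)" by (rule incseq_SucI) (auto simp: C_iff le_SucI)
  qed
  hence "(\<lambda>N. measure \<mu> (C m N)) \<longlonglongrightarrow> measure \<mu> (A m)" by (simp add: A_def)
  from order_tendstoD(1)[OF this m] obtain N where "measure \<mu> (C m N) > 1 - h"
    by (auto simp: eventually_sequentially)
  thus ?thesis unfolding C_def by blast
qed

lemma integral_cylinder_approx:
  assumes f: "continuous_on X f" and B: "\<And>x. x \<in> X \<Longrightarrow> \<bar>f x\<bar> \<le> B"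
    and W: "finite W" "W \<subseteq> words pos_nats m" "\<And>w. w \<in> W \<Longrightarrow> small_oscillation f h w"
    and p: "\<And>w. w \<in> W \<Longrightarrow> p w \<in> cylinder pos_nats w" and h: "h \<ge> 0"
  shows "\<bar>(\<integral>x. f x \<partial>\<mu>) - (\<Sum>w\<in>W. f (p w) * cylinder_prob \<mu> w)\<bar>
    \<le> h + B * (1 - (\<Sum>w\<in>W. cylinder_prob \<mu> w))"
proof -
  define g where "g x = (\<Sum>w\<in>W. f (p w) * indicator (cylinder pos_nats w) x)" for x
  define c where "c x = (\<Sum>w\<in>W. indicator (cylinder pos_nats w) x :: real)" for x
  have ind: "integrable \<mu> (\<lambda>x. indicator (cylinder pos_nats w) x :: real)"
    "(\<integral>x. indicator (cylinder pos_nats w) x \<partial>\<mu>) = cylinder_prob \<mu> w" for w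
    using cylinder_events[of w] sets.sets_into_space[OF cylinder_events[of w]]
    by (simp_all add: integrable_indicator_iff emeasure_eq_measure cylinder_prob_def Int_absorb2)
  have "f \<in> borel_measurable borel_X" by (rule borel_measurable_continuous_on_restrict[OF f])
  hence fm: "f \<in> borel_measurable \<mu>" using measurable_cong_sets[OF sets_eq refl] by blast
  have fi: "integrable \<mu> f"
    by (rule integrable_const_bound[of _ B]) (use B fm in \<open>auto simp: space_eq\<close>)
  have gi: "integrable \<mu> g" "(\<integral>x. g x \<partial>\<mu>) = (\<Sum>w\<in>W. f (p w) * cylinder_prob \<mu> w)"
    unfolding g_def[abs_def] using ind by (auto simp: Bochner_Integration.integral_sum)
  have ci: "integrable \<mu> c" "(\<integral>x. c x \<partial>\<mu>) = (\<Sum>w\<in>W. cylinder_prob \<mu> w)"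
    unfolding c_def[abs_def] using ind by (auto simp: Bochner_Integration.integral_sum)
  have "\<bar>f x - g x\<bar> \<le> h + B * (1 - c x)" if x: "x \<in> X" for x
  proof (cases "\<exists>w\<in>W. x \<in> cylinder pos_nats w")
    case True
    then obtain w where w: "w \<in> W" "x \<in> cylinder pos_nats w" by blast
    have ind_eq: "indicator (cylinder pos_nats v) x = (if v = w then 1 else 0 :: real)" if "v \<in> W" for v
    proof -
      have "length v = length w" using W(2) that w(1) by (auto simp: words_def)
      hence "x \<in> cylinder pos_nats v \<longleftrightarrow> v = w" using w(2) disjoint_cylinders by blast
      thus ?thesis by (simp add: indicator_def)
    qed
    have "g x = (\<Sum>v\<in>W. if v = w then f (p v) else 0)" "c x = (\<Sum>v\<in>W. if v = w then 1 else 0)"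
      unfolding g_def c_def using ind_eq by (auto intro!: sum.cong)
    hence "g x = f (p w)" "c x = 1" using W(1) w(1) by simp_all
    thus ?thesis using W(3)[OF w(1)] w(2) p[OF w(1)] by (simp add: small_oscillation_def)
  next
    case False
    hence "g x = 0" "c x = 0" by (auto simp: g_def c_def)
    thus ?thesis using B[OF x] h by simp
  qed
  hence "(\<integral>x. \<bar>f x - g x\<bar> \<partial>\<mu>) \<le> (\<integral>x. h + B * (1 - c x) \<partial>\<mu>)"
    using fi gi ci by (intro integral_mono) (auto simp: space_eq)
  also have "\<dots> = h + B * (1 - (\<Sum>w\<in>W. cylinder_prob \<mu> w))"
    using ci by (simp add: prob_space)
  finally have "(\<integral>x. \<bar>f x - g x\<bar> \<partial>\<mu>) \<le> h + B * (1 - (\<Sum>w\<in>W. cylinder_prob \<mu> w))" .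
  moreover have "\<bar>(\<integral>x. f x \<partial>\<mu>) - (\<integral>x. g x \<partial>\<mu>)\<bar> \<le> (\<integral>x. \<bar>f x - g x\<bar> \<partial>\<mu>)"
    using integral_abs_bound[of \<mu> "\<lambda>x. f x - g x"] fi gi by simp
  ultimately show ?thesis using gi(2) by simp
qed

end

lemma words_nonempty_cylinder: "w \<in> words pos_nats m \<Longrightarrow> cylinder pos_nats w \<noteq> {}"
proof -
  assume w: "w \<in> words pos_nats m"
  have "(\<lambda>k. if k < length w then w ! k else 1) \<in> cylinder pos_nats w"
    using w by (auto simp: in_cylinder_iff full_shift_def words_def subset_iff)
  thus ?thesis by blast
qed

text \<open>The cylinders that nearly exhaust \<open>\<mu>\<close> and on which \<open>f\<close> is nearly constant control the integral
  of \<open>f\<close>: a measure close to \<open>\<mu>\<close> on them has little mass left elsewhere.\<close>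

lemma integral_cylinder_continuity:
  fixes f :: "(nat \<Rightarrow> nat) \<Rightarrow> real"
  assumes f: "continuous_on X f" "bounded (f ` X)" and \<mu>: "\<mu> \<in> prob_measures" and e: "e > 0"
  shows "\<exists>W d. finite W \<and> W \<subseteq> lists pos_nats \<and> d > 0 \<and>
    (\<forall>\<nu>\<in>prob_measures. (\<forall>w\<in>W. \<bar>cylinder_prob \<nu> w - cylinder_prob \<mu> w\<bar> < d) \<longrightarrow>
      \<bar>(\<integral>x. f x \<partial>\<nu>) - (\<integral>x. f x \<partial>\<mu>)\<bar> < e)"
proof -
  interpret shift_measure \<mu> by (rule prob_measures_shift_measure[OF \<mu>])
  obtain B where B: "B > 0" "\<And>x. x \<in> X \<Longrightarrow> \<bar>f x\<bar> \<le> B"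
  proof -
    obtain b where "b > 0" "\<forall>y\<in>f ` X. norm y \<le> b" using f(2) unfolding bounded_pos by blast
    thus ?thesis by (intro that[of b]) auto
  qed
  \<comment> \<open>The errors are \<open>h + 2 B h\<close> for \<open>\<nu>\<close>,
    \<open>h + B h\<close> for \<open>\<mu>\<close> and \<open>B h\<close> between the two sums, in
    total \<open>h (2 + 4 B)\<close>; the fifth \<open>B\<close> makes this strictly less than
    \<open>e\<close>.\<close>
  define h where "h = e / (2 + 5 * B)"
  have h: "h > 0" "h * (2 + 4 * B) < e"
  proof -
    show h0: "h > 0" using e B by (simp add: h_def)
    have "h * (2 + 4 * B) < h * (2 + 5 * B)" using h0 B by (intro mult_strict_left_mono) auto
    also have "\<dots> = e" using B by (simp add: h_def)
    finally show "h * (2 + 4 * B) < e" .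
  qed
  obtain m N where mN: "measure \<mu> (\<Union>w\<in>{w\<in>bounded_words m N. small_oscillation f h w}. cylinder pos_nats w) > 1 - h"
    using small_oscillation_cover[OF f(1) h(1)] by blast
  define W where "W = {w\<in>bounded_words m N. small_oscillation f h w}"
  have W: "finite W" "W \<subseteq> words pos_nats m" "\<And>w. w \<in> W \<Longrightarrow> small_oscillation f h w"
  proof -
    show "finite W" unfolding W_def using finite_bounded_words[of m N] by simp
  qed (auto simp: W_def bounded_words_def words_def)
  have mass: "(\<Sum>w\<in>W. cylinder_prob \<mu> w) > 1 - h"
  proof -
    have "disjoint_family_on (cylinder pos_nats) W"
      unfolding disjoint_family_on_def
    proof (intro ballI impI)
      fix v w assume vw: "v \<in> W" "w \<in> W" "v \<noteq> w"
      have "length v = length w" using vw W(2) by (auto simp: words_def)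
      thus "cylinder pos_nats v \<inter> cylinder pos_nats w = {}" using disjoint_cylinders vw(3) by blast
    qed
    hence "measure \<mu> (\<Union>w\<in>W. cylinder pos_nats w) = (\<Sum>w\<in>W. cylinder_prob \<mu> w)"
      unfolding cylinder_prob_def using W(1) cylinder_events
      by (intro finite_measure_finite_Union) auto
    thus ?thesis using mN by (simp add: W_def)
  qed
  have "\<exists>x. x \<in> cylinder pos_nats w" if "w \<in> W" for w using words_nonempty_cylinder W(2) that by blast
  then obtain p where p: "\<And>w. w \<in> W \<Longrightarrow> p w \<in> cylinder pos_nats w" by metis
  \<comment> \<open>The total discrepancy over \<open>W\<close> stays below \<open>h\<close>; the
    added 1 covers an empty \<open>W\<close>.\<close>
  define d where "d = h / (real (card W) + 1)"
  have d: "d > 0" "real (card W) * d \<le> h"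
  proof -
    have c: "real (card W) + 1 > 0" by simp
    show "d > 0" using h(1) c by (simp add: d_def)
    hence "real (card W) * d \<le> (real (card W) + 1) * d" by simp
    also have "\<dots> = h" using c by (simp add: d_def)
    finally show "real (card W) * d \<le> h" .
  qed
  have "\<bar>(\<integral>x. f x \<partial>\<nu>) - (\<integral>x. f x \<partial>\<mu>)\<bar> < e"
    if \<nu>: "\<nu> \<in> prob_measures" and close: "\<forall>w\<in>W. \<bar>cylinder_prob \<nu> w - cylinder_prob \<mu> w\<bar> < d" for \<nu>
  proof -
    interpret N: shift_measure \<nu> by (rule prob_measures_shift_measure[OF \<nu>])
    have diff: "(\<Sum>w\<in>W. \<bar>cylinder_prob \<nu> w - cylinder_prob \<mu> w\<bar>) \<le> h"
    proof -
      have "(\<Sum>w\<in>W. \<bar>cylinder_prob \<nu> w - cylinder_prob \<mu> w\<bar>) \<le> (\<Sum>w\<in>W. d)"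
        using close by (intro sum_mono) (simp add: less_imp_le)
      thus ?thesis using d(2) by simp
    qed
    have "\<bar>(\<Sum>w\<in>W. cylinder_prob \<nu> w) - (\<Sum>w\<in>W. cylinder_prob \<mu> w)\<bar>
        \<le> (\<Sum>w\<in>W. \<bar>cylinder_prob \<nu> w - cylinder_prob \<mu> w\<bar>)"
      unfolding sum_subtractf[symmetric] by (rule sum_abs)
    hence mass': "1 - (\<Sum>w\<in>W. cylinder_prob \<nu> w) \<le> 2 * h" using mass diff by linarith
    have wsum: "\<bar>(\<Sum>w\<in>W. f (p w) * cylinder_prob \<nu> w) - (\<Sum>w\<in>W. f (p w) * cylinder_prob \<mu> w)\<bar> \<le> B * h"
    proof -
      have "\<bar>(\<Sum>w\<in>W. f (p w) * cylinder_prob \<nu> w) - (\<Sum>w\<in>W. f (p w) * cylinder_prob \<mu> w)\<bar>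
          \<le> (\<Sum>w\<in>W. \<bar>f (p w) * (cylinder_prob \<nu> w - cylinder_prob \<mu> w)\<bar>)"
        unfolding sum_subtractf[symmetric] right_diff_distrib[symmetric] by (rule sum_abs)
      also have "\<dots> \<le> (\<Sum>w\<in>W. B * \<bar>cylinder_prob \<nu> w - cylinder_prob \<mu> w\<bar>)"
        unfolding abs_mult using p B(2) by (intro sum_mono mult_right_mono) (auto simp: in_cylinder_iff)
      also have "\<dots> \<le> B * h" using diff B(1) by (simp add: sum_distrib_left[symmetric])
      finally show ?thesis .
    qed
    have "\<bar>(\<integral>x. f x \<partial>\<nu>) - (\<Sum>w\<in>W. f (p w) * cylinder_prob \<nu> w)\<bar> \<le> h + B * (1 - (\<Sum>w\<in>W. cylinder_prob \<nu> w))"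
      using N.integral_cylinder_approx[OF f(1) B(2) W p] h(1) by simp
    moreover have "\<bar>(\<integral>x. f x \<partial>\<mu>) - (\<Sum>w\<in>W. f (p w) * cylinder_prob \<mu> w)\<bar> \<le> h + B * (1 - (\<Sum>w\<in>W. cylinder_prob \<mu> w))"
      using integral_cylinder_approx[OF f(1) B(2) W p] h(1) by simp
    moreover have "B * (1 - (\<Sum>w\<in>W. cylinder_prob \<nu> w)) \<le> B * (2 * h)" "B * (1 - (\<Sum>w\<in>W. cylinder_prob \<mu> w)) \<le> B * h"
      using mass mass' B(1) by (auto intro!: mult_left_mono)
    moreover have "(h + B * (2 * h)) + (h + B * h) + B * h = h * (2 + 4 * B)" by (simp add: algebra_simps)
    ultimately show ?thesis using wsum h(2) by linarith
  qed
  moreover have "W \<subseteq> lists pos_nats" using W(2) by (auto simp: words_def)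
  ultimately show ?thesis using W(1) d(1) by blast
qed

text \<open>Reduces weak* neighbourhoods to conditions on finitely many numbers. The induction
  follows the generation of open sets; \<open>integral_cylinder_continuity\<close> is the subbasic
  case.\<close>

lemma weak_star_cylinder_nbhd:
  assumes "openin weak_star G" "\<mu> \<in> G"
  shows "\<exists>W d. finite W \<and> W \<subseteq> lists pos_nats \<and> d > 0 \<and>
    (\<forall>\<nu>\<in>prob_measures. (\<forall>w\<in>W. \<bar>cylinder_prob \<nu> w - cylinder_prob \<mu> w\<bar> < d) \<longrightarrow> \<nu> \<in> G)"
proof -
  have "generate_topology_on {{\<mu> \<in> prob_measures. (\<integral>x. f x \<partial>\<mu>) \<in> U} | f (U :: real set).
       continuous_on X f \<and> bounded (f ` X) \<and> open U} G"
    using assms(1) unfolding weak_star_def by (rule openin_topology_generated_by)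
  thus ?thesis using assms(2)
  proof (induction rule: generate_topology_on.induct)
    case (Int a b)
    obtain W d where W: "finite W" "W \<subseteq> lists pos_nats" "d > 0"
      "\<And>\<nu>. \<nu> \<in> prob_measures \<Longrightarrow> (\<forall>w\<in>W. \<bar>cylinder_prob \<nu> w - cylinder_prob \<mu> w\<bar> < d) \<Longrightarrow> \<nu> \<in> a"
      using Int.IH(1) Int.prems by blast
    obtain W' d' where W': "finite W'" "W' \<subseteq> lists pos_nats" "d' > 0"
      "\<And>\<nu>. \<nu> \<in> prob_measures \<Longrightarrow> (\<forall>w\<in>W'. \<bar>cylinder_prob \<nu> w - cylinder_prob \<mu> w\<bar> < d') \<Longrightarrow> \<nu> \<in> b"
      using Int.IH(2) Int.prems by blast
    show ?case
      by (rule exI[of _ "W \<union> W'"], rule exI[of _ "min d d'"]) (use W W' in auto)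
  next
    case (UN K)
    then obtain k where k: "k \<in> K" "\<mu> \<in> k" by blast
    from UN.IH[OF this] show ?case using k(1) by (meson UnionI)
  next
    case (Basis s)
    then obtain f U where s: "s = {\<mu> \<in> prob_measures. (\<integral>x. f x \<partial>\<mu>) \<in> U}" "continuous_on X f" "bounded (f ` X)" "open (U :: real set)"
      by blast
    hence \<mu>: "\<mu> \<in> prob_measures" "(\<integral>x. f x \<partial>\<mu>) \<in> U" using Basis by auto
    obtain e where e: "e > 0" "\<And>t. \<bar>t - (\<integral>x. f x \<partial>\<mu>)\<bar> < e \<Longrightarrow> t \<in> U"
      using s(4) \<mu>(2) by (auto simp: open_dist dist_real_def)
    from integral_cylinder_continuity[OF s(2,3) \<mu>(1) e(1)] show ?case
      using e(2) unfolding s(1) by (elim exE) (intro exI, blast)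
  qed simp
qed

section \<open>Measures with prescribed cylinder probabilities\<close>

lemma ex_pmf_sums:
  fixes q :: "nat \<Rightarrow> real"
  assumes "\<And>i. q i \<ge> 0" "q sums 1"
  shows "\<exists>p. \<forall>i. pmf p i = q i"
proof -
  have "(\<integral>\<^sup>+i. ennreal (q i) \<partial>count_space UNIV) = (\<Sum>i. ennreal (q i))" by (rule nn_integral_count_space_nat)
  also have "\<dots> = 1" using assms sums_ennreal[of q 1] by (intro sums_unique[symmetric]) simp
  finally show ?thesis using pmf_embed_pmf[of q] assms by (intro exI[of _ "embed_pmf q"]) auto
qed

text \<open>\<open>\<omega>\<close> prescribes a choice at every finite word, and the path follows
  these choices from the root. \<open>Suc\<close> turns choices counted from 0 into letters counted
  from 1.\<close>

primrec tree_path :: "(nat list \<Rightarrow> nat) \<Rightarrow> nat \<Rightarrow> nat list" where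
  "tree_path \<omega> 0 = []"
| "tree_path \<omega> (Suc n) = tree_path \<omega> n @ [Suc (\<omega> (tree_path \<omega> n))]"

lemma tree_path_eq_take_iff:
  assumes "n \<le> length w"
  shows "tree_path \<omega> n = take n w \<longleftrightarrow> (\<forall>k<n. Suc (\<omega> (take k w)) = w ! k)"
  using assms
proof (induction n)
  case (Suc n)
  thus ?case by (auto simp: take_Suc_conv_app_nth less_Suc_eq)
qed simp

lemma length_tree_path: "length (tree_path \<omega> n) = n"
  by (induction n) auto

lemma tree_path_nth:
  assumes "k < n" shows "tree_path \<omega> n ! k = Suc (\<omega> (tree_path \<omega> k))"
  using assms by (induction n) (auto simp: nth_append length_tree_path less_Suc_eq)

text \<open>The measure is the law of a random path in the tree of words that leaves each word by an
  independent choice of the next letter.\<close>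

lemma consistent_weights_measure:
  fixes g :: "nat list \<Rightarrow> real"
  assumes g0: "g [] = 1" and nonneg: "\<And>w. g w \<ge> 0"
    and add: "\<And>w. (\<lambda>q. g (w @ [Suc q])) sums g w"
  shows "\<exists>\<mu>\<in>prob_measures. \<forall>w\<in>lists pos_nats. cylinder_prob \<mu> w = g w"
proof -
  have "\<exists>p. \<forall>q. g w * pmf p q = g (w @ [Suc q])" for w
  \<comment> \<open>Below a word of weight zero all extensions have weight zero, and any law of the
    next letter serves.\<close>
  proof (cases "g w = 0")
    case True
    have "g (w @ [Suc q]) = 0" for q
    proof -
      have "(\<Sum>i\<in>{q}. g (w @ [Suc i])) \<le> g w"
        using sum_le_suminf[OF sums_summable[OF add[of w]], of "{q}"] nonneg sums_unique[OF add[of w]] by simp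
      thus ?thesis using True nonneg[of "w @ [Suc q]"] by simp
    qed
    thus ?thesis using True by auto
  next
    case False
    have "(\<lambda>q. g (w @ [Suc q]) / g w) sums (g w / g w)" by (rule sums_divide[OF add])
    hence "(\<lambda>q. g (w @ [Suc q]) / g w) sums 1" using False by simp
    moreover have "g (w @ [Suc q]) / g w \<ge> 0" for q using nonneg by simp
    ultimately obtain p where "\<forall>q. pmf p q = g (w @ [Suc q]) / g w" 
      using ex_pmf_sums[of "\<lambda>q. g (w @ [Suc q]) / g w"] by blast
    thus ?thesis using False by (intro exI[of _ p]) simp
  qed
  then obtain K where K: "\<And>w q. g w * pmf (K w) q = g (w @ [Suc q])" by metis
  interpret product_prob_space "\<lambda>w. measure_pmf (K w)" UNIV ..
  let ?\<Omega> = "PiM UNIV (\<lambda>w. measure_pmf (K w))"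
  define point where "point \<omega> k = Suc (\<omega> (tree_path \<omega> k))" for \<omega> k
  have comp: "(\<lambda>\<omega>. \<omega> w) \<in> measurable ?\<Omega> (count_space UNIV)" for w
    using measurable_component_singleton[of w UNIV "\<lambda>w. measure_pmf (K w)"] by simp
  have path: "(\<lambda>\<omega>. tree_path \<omega> k) \<in> measurable ?\<Omega> (count_space UNIV)" for k
  proof (induction k)
    case (Suc k)
    have "(\<lambda>\<omega>. w @ [Suc (\<omega> w)]) \<in> measurable ?\<Omega> (count_space UNIV)" for w
      by (rule measurable_compose[OF comp[of w]]) simp
    from measurable_compose_countable[OF this Suc] show ?case by simp
  qed simp
  have "(\<lambda>\<omega>. Suc (\<omega> w)) \<in> measurable ?\<Omega> (count_space UNIV)" for w
    by (rule measurable_compose[OF comp[of w]]) simp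
  from measurable_compose_countable[OF this path]
  have coord: "(\<lambda>\<omega>. point \<omega> k) \<in> measurable ?\<Omega> (count_space UNIV)" for k by (simp add: point_def)
  have point: "point \<in> measurable ?\<Omega> borel_X"
    by (rule measurable_into_borel_X[OF coord]) (simp add: full_shift_def point_def One_nat_def)
  define \<mu> where "\<mu> = distr ?\<Omega> borel_X point"
  have "cylinder_prob \<mu> w = g w" if w: "w \<in> lists pos_nats" for w
  proof -
    define n where "n = length w"
    have pos: "w ! k \<ge> 1" if "k < n" for k using w that by (auto simp: n_def lists_eq_set subset_iff)
    \<comment> \<open>Following \<open>w\<close> prescribes the choices exactly at the proper
      prefixes of \<open>w\<close>. These are distinct independent coordinates, told apart by their
      lengths.\<close>
    have ev: "point -` cylinder pos_nats w \<inter> space ?\<Omega>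
        = {\<omega>\<in>space ?\<Omega>. \<forall>u\<in>(\<lambda>k. take k w) ` {..<n}. \<omega> u \<in> {w ! length u - 1}}"
    proof -
      have "point \<omega> \<in> cylinder pos_nats w \<longleftrightarrow> (\<forall>k<n. \<omega> (take k w) = w ! k - 1)" for \<omega>
      proof -
        have "point \<omega> \<in> X" by (simp add: full_shift_def point_def One_nat_def)
        hence "point \<omega> \<in> cylinder pos_nats w \<longleftrightarrow> (\<forall>k<n. tree_path \<omega> n ! k = w ! k)"
          by (auto simp: in_cylinder_iff n_def[symmetric] tree_path_nth point_def)
        also have "\<dots> \<longleftrightarrow> tree_path \<omega> n = take n w"
          by (auto simp: n_def length_tree_path intro!: nth_equalityI)
        also have "\<dots> \<longleftrightarrow> (\<forall>k<n. Suc (\<omega> (take k w)) = w ! k)"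
          by (rule tree_path_eq_take_iff) (simp add: n_def)
        also have "\<dots> \<longleftrightarrow> (\<forall>k<n. \<omega> (take k w) = w ! k - 1)"
          using pos by fastforce
        finally show ?thesis .
      qed
      thus ?thesis by (auto simp: n_def min_def)
    qed
    have "emeasure \<mu> (cylinder pos_nats w) = emeasure ?\<Omega> (point -` cylinder pos_nats w \<inter> space ?\<Omega>)"
      unfolding \<mu>_def by (rule emeasure_distr[OF point cylinder_sets])
    also have "\<dots> = (\<Prod>u\<in>(\<lambda>k. take k w) ` {..<n}. emeasure (measure_pmf (K u)) {w ! length u - 1})"
      unfolding ev by (rule emeasure_PiM_Collect) auto
    also have "\<dots> = (\<Prod>k<n. ennreal (pmf (K (take k w)) (w ! k - 1)))"
    proof (subst prod.reindex)
      show "inj_on (\<lambda>k. take k w) {..<n}"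
        by (rule inj_onI) (metis length_take lessThan_iff min.absorb2 min.commute n_def less_imp_le)
    qed (auto intro!: prod.cong simp: emeasure_pmf_single n_def min_def)
    also have "\<dots> = ennreal (\<Prod>k<n. pmf (K (take k w)) (w ! k - 1))" by (rule prod_ennreal) simp
    finally have e: "cylinder_prob \<mu> w = (\<Prod>k<n. pmf (K (take k w)) (w ! k - 1))"
      by (simp add: cylinder_prob_def measure_def prod_nonneg)
    \<comment> \<open>The transition probabilities telescope along the prefixes of
      \<open>w\<close>.\<close>
    have "j \<le> n \<Longrightarrow> (\<Prod>k<j. pmf (K (take k w)) (w ! k - 1)) = g (take j w)" for j
    proof (induction j)
      case (Suc j)
      have "Suc (w ! j - 1) = w ! j" using pos[of j] Suc.prems by simp
      hence "take (Suc j) w = take j w @ [Suc (w ! j - 1)]"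
        using Suc.prems by (simp add: take_Suc_conv_app_nth n_def)
      thus ?case using Suc K[of "take j w" "w ! j - 1"] by simp
    qed (simp add: g0)
    from this[of n] show ?thesis using e by (simp add: n_def)
  qed
  moreover have "\<mu> \<in> prob_measures"
    unfolding \<mu>_def prob_measures_def using P.prob_space_distr[OF point] by simp
  ultimately show ?thesis by blast
qed

section \<open>Block measures\<close>

lemma lessThan_nonempty: "n \<ge> 1 \<Longrightarrow> {..<n :: nat} \<noteq> {}"
  by (metis atLeast0LessThan atLeastLessThan_empty_iff not_one_le_zero not_gr_zero)

text \<open>\<open>measure_of\<close> keeps the given set function only if that is a measure;
  recognizing it as the law of a uniformly chosen orbit point settles this.\<close>

lemma empirical_measure_eq_distr:
  assumes "n \<ge> 1" "x \<in> X"
  shows "empirical_measure n x = distr (measure_pmf (pmf_of_set {..<n})) borel_X (\<lambda>k. (shift ^^ k) x)"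
proof -
  let ?N = "distr (measure_pmf (pmf_of_set {..<n})) borel_X (\<lambda>k. (shift ^^ k) x)"
  have m: "(\<lambda>k. (shift ^^ k) x) \<in> measurable (measure_pmf (pmf_of_set {..<n})) borel_X"
    using shift_funpow_in[OF assms(2)] by auto
  have ne: "{..<n} \<noteq> {}" by (rule lessThan_nonempty[OF assms(1)])
  have "(\<Sum>k<n. emeasure (return borel_X ((shift ^^ k) x)) B) / of_nat n = emeasure ?N B"
    if B: "B \<in> sets borel_X" for B
  proof -
    have "emeasure ?N B = (\<integral>\<^sup>+k. indicator B ((shift ^^ k) x) \<partial>measure_pmf (pmf_of_set {..<n}))"
      using nn_integral_distr[OF m, of "indicator B"] nn_integral_indicator[of B ?N] B by simp
    also have "\<dots> = (\<Sum>k<n. indicator B ((shift ^^ k) x)) / of_nat n"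
      using ne by (subst nn_integral_pmf_of_set) (auto simp: ennreal_of_nat_eq_real_of_nat)
    finally show ?thesis using B by (simp del: shift_funpow_apply)
  qed
  moreover have "sigma_sets (space borel_X) (sets borel_X) = sets borel_X" by (rule sets.sigma_sets_eq)
  ultimately have "empirical_measure n x = measure_of (space borel_X) (sets borel_X) (emeasure ?N)"
    unfolding empirical_measure_def by (intro measure_of_eq sets.space_closed) auto
  also have "\<dots> = ?N" using measure_of_of_measure[of ?N] by simp
  finally show ?thesis .
qed

lemma empirical_measure_in_prob_measures:
  assumes "n \<ge> 1" "x \<in> X" shows "empirical_measure n x \<in> prob_measures"
proof -
  have m: "(\<lambda>k. (shift ^^ k) x) \<in> measurable (measure_pmf (pmf_of_set {..<n})) borel_X"
    using shift_funpow_in[OF assms(2)] by auto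
  show ?thesis unfolding empirical_measure_eq_distr[OF assms] prob_measures_def
    using measure_pmf.prob_space_distr[OF m] by simp
qed

lemma measure_empirical_measure:
  assumes "n \<ge> 1" "x \<in> X" "B \<in> sets borel_X"
  shows "measure (empirical_measure n x) B = (\<Sum>k<n. indicator B ((shift ^^ k) x)) / real n"
proof -
  have m: "(\<lambda>k. (shift ^^ k) x) \<in> measurable (measure_pmf (pmf_of_set {..<n})) borel_X"
    using shift_funpow_in[OF assms(2)] by auto
  have ne: "{..<n} \<noteq> {}" by (rule lessThan_nonempty[OF assms(1)])
  have "measure (empirical_measure n x) B = measure (measure_pmf (pmf_of_set {..<n})) ((\<lambda>k. (shift ^^ k) x) -` B)"
    unfolding empirical_measure_eq_distr[OF assms(1,2)] using measure_distr[OF m assms(3)] by simp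
  also have "\<dots> = real (card ({..<n} \<inter> (\<lambda>k. (shift ^^ k) x) -` B)) / real n"
    using ne by (subst measure_pmf_of_set) auto
  also have "real (card ({..<n} \<inter> (\<lambda>k. (shift ^^ k) x) -` B)) = (\<Sum>k<n. indicator B ((shift ^^ k) x))"
    by (simp add: indicator_def sum.If_cases Int_def vimage_def del: shift_funpow_apply)
  finally show ?thesis .
qed

text \<open>Concatenating independent blocks drawn from a finite set of periodic points and randomizing
  the phase gives an invariant measure whose entropy per symbol is that of a block divided by the
  block length. Since only the law \<open>p\<close> matters, \<open>clamp\<close> redirects the null set of blocks outside \<open>F\<close>
  into \<open>F\<close>, so that every sample path is a genuine concatenation.\<close>

locale block_process =
  fixes n :: nat and F :: "(nat \<Rightarrow> nat) set" and p :: "(nat \<Rightarrow> nat) pmf"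
  assumes n: "n \<ge> 1" and F: "finite F" "F \<subseteq> periodic_points n" and set_p: "set_pmf p = F"
begin

definition clamp :: "(nat \<Rightarrow> nat) \<Rightarrow> nat \<Rightarrow> nat" where
  "clamp x = (if x \<in> F then x else (SOME x. x \<in> F))"

definition concatenation :: "(nat \<Rightarrow> nat \<Rightarrow> nat) \<Rightarrow> nat \<Rightarrow> nat" where
  "concatenation z k = clamp (z (k div n)) (k mod n)"

abbreviation Q :: "(nat \<Rightarrow> nat \<Rightarrow> nat) measure" where "Q \<equiv> PiM UNIV (\<lambda>_. measure_pmf p)"

abbreviation U :: "nat measure" where "U \<equiv> measure_pmf (pmf_of_set {..<n})"

text \<open>Reducing modulo \<open>n\<close> makes the phase smaller than \<open>n\<close> for every
  \<open>\<omega>\<close>, not just for almost every one, just as \<open>clamp\<close> does for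
  blocks.\<close>

definition point :: "nat \<times> (nat \<Rightarrow> nat \<Rightarrow> nat) \<Rightarrow> nat \<Rightarrow> nat" where
  "point \<omega> = (shift ^^ (fst \<omega> mod n)) (concatenation (snd \<omega>))"

definition block_measure :: "(nat \<Rightarrow> nat) measure" where
  "block_measure = distr (U \<Otimes>\<^sub>M Q) borel_X point"

sublocale Q: product_prob_space "\<lambda>_ :: nat. measure_pmf p" UNIV ..

sublocale UQ: pair_prob_space U Q ..

lemma clamp_in: "clamp x \<in> F"
  using set_pmf_not_empty[of p] someI_ex[of "\<lambda>x. x \<in> F"] by (auto simp: clamp_def set_p)

lemma clamp_id: "x \<in> F \<Longrightarrow> clamp x = x"
  by (simp add: clamp_def)

lemma clamp_in_X: "clamp x \<in> X"
  using clamp_in F(2) periodic_points_subset by blast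

lemma concatenation_in_X: "concatenation z \<in> X"
  using full_shiftD[OF clamp_in_X] by (simp add: full_shift_def concatenation_def)

lemma concatenation_first: "k < n \<Longrightarrow> concatenation z k = clamp (z 0) k"
  by (simp add: concatenation_def)

lemma shift_concatenation: "(shift ^^ n) (concatenation z) = concatenation (\<lambda>i. z (Suc i))"
proof
  fix k
  have "(n + k) div n = Suc (k div n)" using n by simp
  thus "(shift ^^ n) (concatenation z) k = concatenation (\<lambda>i. z (Suc i)) k" by (simp add: concatenation_def)
qed

lemma space_Q: "space Q = UNIV" by (simp add: space_PiM)

lemma coordinate_Q: "(\<lambda>z. g (z i)) \<in> measurable Q (count_space UNIV)"
  by (rule measurable_compose[OF measurable_component_singleton]) auto

lemma concatenation_coordinate: "(\<lambda>z. concatenation z k) \<in> measurable Q (count_space UNIV)"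
  unfolding concatenation_def by (rule coordinate_Q[of "\<lambda>x. clamp x (k mod n)"])

lemma concatenation_measurable: "concatenation \<in> measurable Q borel_X"
  by (rule measurable_into_borel_X[OF concatenation_coordinate concatenation_in_X])

lemma point_measurable: "point \<in> measurable (U \<Otimes>\<^sub>M Q) borel_X"
proof (rule measurable_into_borel_X)
  fix k
  have "(\<lambda>\<omega>. concatenation (snd \<omega>) (j mod n + k)) \<in> measurable (U \<Otimes>\<^sub>M Q) (count_space UNIV)" for j
    by (rule measurable_compose[OF measurable_snd concatenation_coordinate])
  moreover have "fst \<in> measurable (U \<Otimes>\<^sub>M Q) (count_space UNIV)"
    using measurable_fst[of U Q] by (simp add: measurable_cong_sets[OF refl sets_measure_pmf_count_space])
  ultimately show "(\<lambda>\<omega>. point \<omega> k) \<in> measurable (U \<Otimes>\<^sub>M Q) (count_space UNIV)"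
    using measurable_compose_countable[of "\<lambda>j \<omega>. concatenation (snd \<omega>) (j mod n + k)" "U \<Otimes>\<^sub>M Q" "count_space UNIV" fst]
    by (simp add: point_def)
next
  fix \<omega> show "point \<omega> \<in> X" unfolding point_def by (rule shift_funpow_in[OF concatenation_in_X])
qed

lemma point_in_X: "point \<omega> \<in> X"
  unfolding point_def by (rule shift_funpow_in[OF concatenation_in_X])

lemma block_measure_prob: "block_measure \<in> prob_measures"
  unfolding block_measure_def prob_measures_def using UQ.prob_space_distr[OF point_measurable] by simp

lemma emeasure_block_measure:
  assumes A: "A \<in> sets borel_X"
  shows "emeasure block_measure A = (\<Sum>j<n. emeasure Q {z. (shift ^^ j) (concatenation z) \<in> A}) / of_nat n"
proof -
  have ne: "{..<n} \<noteq> {}" by (rule lessThan_nonempty[OF n])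
  have s: "point -` A \<inter> space (U \<Otimes>\<^sub>M Q) \<in> sets (U \<Otimes>\<^sub>M Q)" by (rule measurable_sets[OF point_measurable A])
  have "emeasure block_measure A = emeasure (U \<Otimes>\<^sub>M Q) (point -` A \<inter> space (U \<Otimes>\<^sub>M Q))"
    unfolding block_measure_def by (rule emeasure_distr[OF point_measurable A])
  also have "\<dots> = (\<integral>\<^sup>+j. emeasure Q (Pair j -` (point -` A \<inter> space (U \<Otimes>\<^sub>M Q))) \<partial>U)"
    by (rule Q.emeasure_pair_measure_alt[OF s])
  also have "\<dots> = (\<Sum>j<n. emeasure Q (Pair j -` (point -` A \<inter> space (U \<Otimes>\<^sub>M Q)))) / of_nat n"
    using ne by (subst nn_integral_pmf_of_set) (auto simp: ennreal_of_nat_eq_real_of_nat)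
  also have "(\<Sum>j<n. emeasure Q (Pair j -` (point -` A \<inter> space (U \<Otimes>\<^sub>M Q))))
      = (\<Sum>j<n. emeasure Q {z. (shift ^^ j) (concatenation z) \<in> A})"
  proof (rule sum.cong[OF refl])
    fix j assume "j \<in> {..<n}"
    hence "Pair j -` (point -` A \<inter> space (U \<Otimes>\<^sub>M Q)) = {z. (shift ^^ j) (concatenation z) \<in> A}"
      by (auto simp: point_def space_pair_measure space_Q simp del: shift_funpow_apply)
    thus "emeasure Q (Pair j -` (point -` A \<inter> space (U \<Otimes>\<^sub>M Q))) = emeasure Q {z. (shift ^^ j) (concatenation z) \<in> A}"
      by simp
  qed
  finally show ?thesis .
qed

lemma Q_stationary: "distr Q Q (\<lambda>z i. z (Suc i)) = Q"
  using distr_PiM_reindex[of UNIV "\<lambda>_. measure_pmf p" Suc UNIV] 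
  by (simp add: measure_pmf.prob_space_axioms restrict_UNIV)

text \<open>The shift raises the phase by one. Phase \<open>n\<close> is phase 0 of the process with
  its first block dropped, which has the same law.\<close>

lemma block_measure_invariant: "block_measure \<in> invariant_measures"
proof -
  have "distr block_measure borel_X shift = block_measure"
  proof (rule measure_eqI)
    show "sets (distr block_measure borel_X shift) = sets block_measure" by (simp add: block_measure_def)
    fix A assume "A \<in> sets (distr block_measure borel_X shift)"
    hence A: "A \<in> sets borel_X" by simp
    have sm: "shift \<in> measurable block_measure borel_X"
      using shift_measurable by (simp add: block_measure_def)
    define a where "a j = emeasure Q {z. (shift ^^ j) (concatenation z) \<in> A}" for j
    have pre: "shift -` A \<inter> X \<in> sets borel_X" using measurable_sets[OF shift_measurable A] by simp
    have "emeasure (distr block_measure borel_X shift) A = emeasure block_measure (shift -` A \<inter> X)"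
      using emeasure_distr[OF sm A] by (simp add: block_measure_def)
    also have "\<dots> = (\<Sum>j<n. a (Suc j)) / of_nat n"
      unfolding emeasure_block_measure[OF pre] a_def
      using shift_funpow_in[OF concatenation_in_X] by (simp del: shift_funpow_apply)
    also have "(\<Sum>j<n. a (Suc j)) = (\<Sum>j<n. a j)"
    proof -
      have "a n = a 0"
      proof -
        let ?B = "{z. concatenation z \<in> A}"
        have B: "?B \<in> sets Q" using measurable_sets[OF concatenation_measurable A] by (simp add: space_Q vimage_def)
        have th: "(\<lambda>z i. z (Suc i)) \<in> measurable Q Q"
          by (rule measurable_PiM_single') (auto simp: space_PiM)
        have "a n = emeasure Q ((\<lambda>z i. z (Suc i)) -` ?B \<inter> space Q)"
          unfolding a_def shift_concatenation by (simp add: vimage_def space_Q)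
        also have "\<dots> = emeasure (distr Q Q (\<lambda>z i. z (Suc i))) ?B" by (rule emeasure_distr[OF th B, symmetric])
        also have "\<dots> = a 0" unfolding Q_stationary a_def by simp
        finally show ?thesis .
      qed
      moreover obtain m where "n = Suc m" using n by (cases n) auto
      ultimately show ?thesis using sum.lessThan_Suc_shift[of a m] by (simp add: add.commute)
    qed
    also have "(\<Sum>j<n. a j) / of_nat n = emeasure block_measure A"
      unfolding emeasure_block_measure[OF A] a_def ..
    finally show "emeasure (distr block_measure borel_X shift) A = emeasure block_measure A" .
  qed
  thus ?thesis using block_measure_prob by (simp add: invariant_measures_def)
qed

lemma integrable_Q:
  fixes h :: "(nat \<Rightarrow> nat) \<Rightarrow> real"
  assumes "h \<in> borel_measurable borel_X" "\<And>z j. j < n \<Longrightarrow> \<bar>h ((shift ^^ j) (concatenation z))\<bar> \<le> B" "j < n"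
  shows "integrable Q (\<lambda>z. h ((shift ^^ j) (concatenation z)))"
proof (rule Q.integrable_const_bound[of _ B])
  show "AE z in Q. norm (h ((shift ^^ j) (concatenation z))) \<le> B" using assms(2,3) by auto
  show "(\<lambda>z. h ((shift ^^ j) (concatenation z))) \<in> borel_measurable Q"
    using measurable_compose[OF measurable_compose[OF concatenation_measurable shift_funpow_measurable] assms(1)]
    by simp
qed

lemma integral_block_measure:
  fixes h :: "(nat \<Rightarrow> nat) \<Rightarrow> real"
  assumes h: "h \<in> borel_measurable borel_X" "\<And>z j. j < n \<Longrightarrow> \<bar>h ((shift ^^ j) (concatenation z))\<bar> \<le> B"
  shows "integrable block_measure h"
    and "(\<integral>x. h x \<partial>block_measure) = (\<Sum>j<n. \<integral>z. h ((shift ^^ j) (concatenation z)) \<partial>Q) / real n"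
proof -
  have ne: "{..<n} \<noteq> {}" by (rule lessThan_nonempty[OF n])
  have hp: "(\<lambda>\<omega>. h (point \<omega>)) \<in> borel_measurable (U \<Otimes>\<^sub>M Q)" by (rule measurable_compose[OF point_measurable h(1)])
  have int: "integrable (U \<Otimes>\<^sub>M Q) (\<lambda>\<omega>. h (point \<omega>))"
    by (rule UQ.integrable_const_bound[OF _ hp, of B]) (use h(2) n in \<open>auto simp: point_def simp del: shift_funpow_apply\<close>)
  show "integrable block_measure h"
    unfolding block_measure_def using integrable_distr_eq[OF point_measurable h(1)] int by simp
  have "(\<integral>x. h x \<partial>block_measure) = (\<integral>\<omega>. h (point \<omega>) \<partial>(U \<Otimes>\<^sub>M Q))"
    unfolding block_measure_def by (rule integral_distr[OF point_measurable h(1)])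
  also have "\<dots> = (\<integral>j. \<integral>z. h (point (j, z)) \<partial>Q \<partial>U)" by (rule UQ.integral_fst'[OF int, symmetric])
  also have "\<dots> = (\<Sum>j<n. \<integral>z. h (point (j, z)) \<partial>Q) / real n"
    using ne by (subst integral_pmf_of_set) auto
  also have "(\<Sum>j<n. \<integral>z. h (point (j, z)) \<partial>Q) = (\<Sum>j<n. \<integral>z. h ((shift ^^ j) (concatenation z)) \<partial>Q)"
    by (intro sum.cong) (auto simp: point_def simp del: shift_funpow_apply)
  finally show "(\<integral>x. h x \<partial>block_measure) = (\<Sum>j<n. \<integral>z. h ((shift ^^ j) (concatenation z)) \<partial>Q) / real n" .
qed

lemma integral_first_block:
  fixes h :: "(nat \<Rightarrow> nat) \<Rightarrow> real"
  shows "integrable Q (\<lambda>z. h (clamp (z i)))" and "(\<integral>z. h (clamp (z i)) \<partial>Q) = (\<Sum>x\<in>F. pmf p x * h x)"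
proof -
  have m: "(\<lambda>z. z i) \<in> measurable Q (measure_pmf p)" by (rule measurable_component_singleton) simp
  have d: "distr Q (measure_pmf p) (\<lambda>z. z i) = measure_pmf p" by (rule Q.PiM_component) simp
  have "integrable (measure_pmf p) (\<lambda>x. h (clamp x))"
    by (rule integrable_measure_pmf_finite) (simp add: set_p F)
  hence "integrable (distr Q (measure_pmf p) (\<lambda>z. z i)) (\<lambda>x. h (clamp x))" by (simp only: d)
  thus "integrable Q (\<lambda>z. h (clamp (z i)))" using integrable_distr[OF m] by blast
  have "(\<integral>z. h (clamp (z i)) \<partial>Q) = (\<integral>x. h (clamp x) \<partial>distr Q (measure_pmf p) (\<lambda>z. z i))"
    by (rule integral_distr[OF m, symmetric]) simp
  also have "\<dots> = (\<integral>x. h (clamp x) \<partial>measure_pmf p)" by (simp only: d)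
  also have "\<dots> = (\<Sum>x\<in>F. h (clamp x) * pmf p x)"
    by (rule integral_measure_pmf_real[OF F(1)]) (simp add: set_p)
  also have "\<dots> = (\<Sum>x\<in>F. pmf p x * h x)" by (intro sum.cong) (auto simp: clamp_id)
  finally show "(\<integral>z. h (clamp (z i)) \<partial>Q) = (\<Sum>x\<in>F. pmf p x * h x)" .
qed

text \<open>A window of length \<open>length w\<close> starting at phase \<open>j\<close> lies
  inside the first block unless it crosses the block's end, which happens for at most
  \<open>length w\<close> of the \<open>n\<close> phases. Inside the block, the concatenation and
  the periodic orbit coincide.\<close>

lemma cylinder_prob_block_measure:
  "\<bar>cylinder_prob block_measure w - (\<Sum>x\<in>F. pmf p x * cylinder_prob (empirical_measure n x) w)\<bar>
    \<le> real (length w) / real n"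
proof -
  let ?h = "indicator (cylinder pos_nats w) :: (nat \<Rightarrow> nat) \<Rightarrow> real"
  have h: "?h \<in> borel_measurable borel_X" using cylinder_sets by simp
  interpret B: shift_measure block_measure by (rule prob_measures_shift_measure[OF block_measure_prob])
  have "cylinder_prob block_measure w = (\<integral>x. ?h x \<partial>block_measure)"
    using B.cylinder_events[of w] sets.sets_into_space[OF B.cylinder_events[of w]] by (simp add: cylinder_prob_def Int_absorb2)
  also have "\<dots> = (\<Sum>j<n. \<integral>z. ?h ((shift ^^ j) (concatenation z)) \<partial>Q) / real n"
    by (rule integral_block_measure(2)[OF h, of 1]) (simp add: indicator_def)
  finally have 1: "cylinder_prob block_measure w = (\<Sum>j<n. \<integral>z. ?h ((shift ^^ j) (concatenation z)) \<partial>Q) / real n" .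
  have "(\<Sum>x\<in>F. pmf p x * cylinder_prob (empirical_measure n x) w)
      = (\<Sum>x\<in>F. \<Sum>j<n. pmf p x * ?h ((shift ^^ j) x)) / real n"
    unfolding cylinder_prob_def using F(2) periodic_points_subset
    by (subst sum_divide_distrib, intro sum.cong)
       (auto simp: measure_empirical_measure[OF n _ cylinder_sets] sum_distrib_left subset_iff simp del: shift_funpow_apply)
  also have "(\<Sum>x\<in>F. \<Sum>j<n. pmf p x * ?h ((shift ^^ j) x)) = (\<Sum>j<n. \<integral>z. ?h ((shift ^^ j) (clamp (z 0))) \<partial>Q)"
    by (subst sum.swap) (simp only: integral_first_block(2)[of "\<lambda>x. ?h ((shift ^^ _) x)"])
  finally have 2: "(\<Sum>x\<in>F. pmf p x * cylinder_prob (empirical_measure n x) w)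
      = (\<Sum>j<n. \<integral>z. ?h ((shift ^^ j) (clamp (z 0))) \<partial>Q) / real n" .
  have "\<bar>(\<integral>z. ?h ((shift ^^ j) (concatenation z)) \<partial>Q) - (\<integral>z. ?h ((shift ^^ j) (clamp (z 0))) \<partial>Q)\<bar>
      \<le> (if j + length w \<le> n then 0 else 1)" if j: "j < n" for j
  proof (cases "j + length w \<le> n")
    case True
    have "?h ((shift ^^ j) (concatenation z)) = ?h ((shift ^^ j) (clamp (z 0)))" for z
    proof -
      have "(shift ^^ j) (concatenation z) \<in> X" "(shift ^^ j) (clamp (z 0)) \<in> X"
        using shift_funpow_in[OF concatenation_in_X] shift_funpow_in[OF clamp_in_X] by blast+
      thus ?thesis using True concatenation_first[of _ z] by (auto simp: indicator_def in_cylinder_iff)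
    qed
    thus ?thesis using True by simp
  next
    case False
    have i1: "integrable Q (\<lambda>z. ?h ((shift ^^ j) (concatenation z)))"
      by (rule integrable_Q[OF h _ j, of 1]) (simp add: indicator_def)
    have i2: "integrable Q (\<lambda>z. ?h ((shift ^^ j) (clamp (z 0))))" by (rule integral_first_block(1))
    have "0 \<le> (\<integral>z. ?h ((shift ^^ j) (concatenation z)) \<partial>Q)" "(\<integral>z. ?h ((shift ^^ j) (concatenation z)) \<partial>Q) \<le> 1"
      "0 \<le> (\<integral>z. ?h ((shift ^^ j) (clamp (z 0))) \<partial>Q)" "(\<integral>z. ?h ((shift ^^ j) (clamp (z 0))) \<partial>Q) \<le> 1"
      using i1 i2 by (auto intro!: integral_nonneg_AE Q.integral_le_const simp: indicator_def)
    thus ?thesis using False by (simp only: if_False)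
  qed
  hence "(\<Sum>j<n. \<bar>(\<integral>z. ?h ((shift ^^ j) (concatenation z)) \<partial>Q) - (\<integral>z. ?h ((shift ^^ j) (clamp (z 0))) \<partial>Q)\<bar>)
      \<le> (\<Sum>j<n. if j + length w \<le> n then 0 else 1)" by (intro sum_mono) auto
  also have "\<dots> = real (card {j. j < n \<and> n < j + length w})"
    by (simp add: sum.If_cases Int_def not_le)
  also have "\<dots> \<le> real (length w)"
  proof -
    have "card {j. j < n \<and> n < j + length w} \<le> card {n - length w..<n}" by (intro card_mono) auto
    thus ?thesis by simp
  qed
  finally have "\<bar>(\<Sum>j<n. \<integral>z. ?h ((shift ^^ j) (concatenation z)) \<partial>Q) - (\<Sum>j<n. \<integral>z. ?h ((shift ^^ j) (clamp (z 0))) \<partial>Q)\<bar>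
      \<le> real (length w)"
    unfolding sum_subtractf[symmetric] by (rule order_trans[OF sum_abs])
  thus ?thesis unfolding 1 2 diff_divide_distrib[symmetric] abs_divide by (simp add: divide_right_mono)
qed

section \<open>Entropy of the block measure\<close>

definition block_entropy :: real where
  "block_entropy = (\<Sum>x\<in>F. pmf p x * - ln (pmf p x))"

lemma letters_bounded: "\<exists>L. \<forall>x\<in>F. \<forall>i. x i \<le> L"
proof -
  define L where "L = Max ((\<lambda>(x, i). x i) ` (F \<times> {..<n}))"
  have "x i \<le> L" if x: "x \<in> F" for x i
  proof -
    have "x (i mod n) \<le> L" unfolding L_def
      by (rule Max_ge) (use F(1) x n in \<open>auto intro!: image_eqI[of _ _ "(x, i mod n)"]\<close>)
    thus ?thesis using periodic_points_mod F(2) x by fastforce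
  qed
  thus ?thesis by blast
qed

text \<open>Block 0 is left out because the random phase may cut off its beginning.\<close>

abbreviation blocks :: "nat \<Rightarrow> nat \<times> (nat \<Rightarrow> nat \<Rightarrow> nat) \<Rightarrow> (nat \<Rightarrow> nat) list" where
  "blocks q \<omega> \<equiv> map (\<lambda>i. clamp (snd \<omega> (Suc i))) [0..<q]"

lemma level_prob_blocks:
  assumes "length v = q" "set v \<subseteq> F"
  shows "{\<omega> \<in> space (U \<Otimes>\<^sub>M Q). blocks q \<omega> = v} \<in> sets (U \<Otimes>\<^sub>M Q)"
    and "level_prob (U \<Otimes>\<^sub>M Q) (blocks q) v = (\<Prod>i<q. measure (measure_pmf p) {x. clamp x = v ! i})"
proof -
  define B where "B = {z \<in> space Q. \<forall>k\<in>Suc ` {..<q}. z k \<in> {x. clamp x = v ! (k - 1)}}"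
  have "{z \<in> space Q. z k \<in> A} \<in> sets Q" for k A
    using measurable_sets[OF measurable_component_singleton[of k UNIV "\<lambda>_. measure_pmf p"], of A] by (simp add: vimage_def Int_def conj_commute)
  note coord = this
  have B: "B \<in> sets Q" unfolding B_def by (rule sets.sets_Collect_finite_All) (simp_all only: coord finite_imageI finite_lessThan)
  have eq: "{\<omega> \<in> space (U \<Otimes>\<^sub>M Q). blocks q \<omega> = v} = UNIV \<times> B"
    using assms(1) by (auto simp: B_def space_pair_measure space_Q list_eq_iff_nth_eq)
  show "{\<omega> \<in> space (U \<Otimes>\<^sub>M Q). blocks q \<omega> = v} \<in> sets (U \<Otimes>\<^sub>M Q)" unfolding eq using B by auto
  have "emeasure (U \<Otimes>\<^sub>M Q) (UNIV \<times> B) = emeasure U UNIV * emeasure Q B"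
    using B by (intro Q.emeasure_pair_measure_Times) auto
  also have "\<dots> = emeasure Q B" using measure_pmf.emeasure_space_1[of "pmf_of_set {..<n}"] by simp
  also have "\<dots> = (\<Prod>k\<in>Suc ` {..<q}. emeasure (measure_pmf p) {x. clamp x = v ! (k - 1)})"
    unfolding B_def by (rule Q.emeasure_PiM_Collect) auto
  also have "\<dots> = (\<Prod>i<q. ennreal (measure (measure_pmf p) {x. clamp x = v ! i}))"
    by (subst prod.reindex) (auto simp: measure_pmf.emeasure_eq_measure)
  also have "\<dots> = ennreal (\<Prod>i<q. measure (measure_pmf p) {x. clamp x = v ! i})" by (rule prod_ennreal) simp
  finally show "level_prob (U \<Otimes>\<^sub>M Q) (blocks q) v = (\<Prod>i<q. measure (measure_pmf p) {x. clamp x = v ! i})"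
    unfolding level_prob_def eq by (simp add: measure_def prod_nonneg)
qed

lemma measure_clamp: "x \<in> F \<Longrightarrow> measure (measure_pmf p) {y. clamp y = x} = pmf p x"
proof -
  assume x: "x \<in> F"
  have "measure (measure_pmf p) {y. clamp y = x} = measure (measure_pmf p) {x}"
    by (rule measure_pmf.finite_measure_eq_AE) (use x in \<open>auto simp: AE_measure_pmf_iff set_p clamp_id\<close>)
  thus ?thesis by (simp add: measure_pmf_single)
qed

lemma simple_function_blocks: "simple_function (U \<Otimes>\<^sub>M Q) (blocks q)"
  unfolding simple_function_def
proof (intro conjI ballI)
  have sub: "blocks q ` space (U \<Otimes>\<^sub>M Q) \<subseteq> {v. set v \<subseteq> F \<and> length v = q}"
    using clamp_in by auto
  thus "finite (blocks q ` space (U \<Otimes>\<^sub>M Q))"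
    by (rule finite_subset) (rule finite_lists_length_eq[OF F(1)])
  fix v assume "v \<in> blocks q ` space (U \<Otimes>\<^sub>M Q)"
  hence "length v = q" "set v \<subseteq> F" using sub by auto
  from level_prob_blocks(1)[OF this]
  show "blocks q -` {v} \<inter> space (U \<Otimes>\<^sub>M Q) \<in> sets (U \<Otimes>\<^sub>M Q)" by (simp add: vimage_def Int_def conj_commute)
qed

text \<open>By independence \<open>- ln\<close> of the joint law is a sum of terms in single blocks,
  and each block has marginal law \<open>p\<close>.\<close>

lemma ent_blocks: "ent (U \<Otimes>\<^sub>M Q) (blocks q) = real q * block_entropy"
proof -
  let ?\<Omega> = "U \<Otimes>\<^sub>M Q"
  have sub: "blocks q ` space ?\<Omega> \<subseteq> {v. set v \<subseteq> F \<and> length v = q}" using clamp_in by auto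
  have lp: "- ln (level_prob ?\<Omega> (blocks q) v) = (\<Sum>i<q. - ln (pmf p (v ! i)))" if "v \<in> blocks q ` space ?\<Omega>" for v
  proof -
    have v: "length v = q" "set v \<subseteq> F" using that sub by auto
    hence mem: "v ! i \<in> F" if "i < q" for i using that by auto
    have "level_prob ?\<Omega> (blocks q) v = (\<Prod>i<q. pmf p (v ! i))"
      using level_prob_blocks(2)[OF v] measure_clamp[OF mem] by simp
    moreover have "pmf p (v ! i) \<noteq> 0" if "i < q" for i using mem[OF that] by (simp add: set_p[symmetric] set_pmf_iff)
    ultimately show ?thesis using ln_prod[of "{..<q}" "\<lambda>i. pmf p (v ! i)"] by (simp add: sum_negf)
  qed
  have "ent ?\<Omega> (blocks q) = (\<Sum>v\<in>blocks q ` space ?\<Omega>. level_prob ?\<Omega> (blocks q) v * (\<Sum>i<q. - ln (pmf p (v ! i))))"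
    unfolding ent_def using lp by (intro sum.cong) auto
  also have "\<dots> = (\<Sum>i<q. \<Sum>v\<in>blocks q ` space ?\<Omega>. level_prob ?\<Omega> (blocks q) v * - ln (pmf p (v ! i)))"
    unfolding sum_distrib_left by (rule sum.swap)
  also have "\<dots> = (\<Sum>i<q. block_entropy)"
  proof (rule sum.cong[OF refl])
    fix i assume "i \<in> {..<q}"
    hence i: "i < q" by simp
    let ?g = "\<lambda>\<omega>. blocks q \<omega> ! i"
    have lpi: "level_prob ?\<Omega> ?g u = pmf p u" if u: "u \<in> F" for u
    proof -
      have s: "{z \<in> space Q. z (Suc i) \<in> {x. clamp x = u}} \<in> sets Q"
        using measurable_sets[OF measurable_component_singleton[of "Suc i" UNIV "\<lambda>_. measure_pmf p"], of "{x. clamp x = u}"]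
        by (simp add: vimage_def Int_def conj_commute)
      have "{\<omega> \<in> space ?\<Omega>. ?g \<omega> = u} = UNIV \<times> {z \<in> space Q. z (Suc i) \<in> {x. clamp x = u}}"
        using i by (auto simp: space_pair_measure space_Q)
      hence "emeasure ?\<Omega> {\<omega> \<in> space ?\<Omega>. ?g \<omega> = u} = emeasure U UNIV * emeasure Q {z \<in> space Q. z (Suc i) \<in> {x. clamp x = u}}"
        using s by (simp only:) (intro Q.emeasure_pair_measure_Times, auto)
      also have "\<dots> = emeasure (measure_pmf p) {x. clamp x = u}"
        using measure_pmf.emeasure_space_1[of "pmf_of_set {..<n}"]
        by (subst Q.emeasure_PiM_Collect_single) auto
      finally show ?thesis using measure_clamp[OF u] by (simp add: level_prob_def measure_def)
    qed
    have "(\<Sum>v\<in>blocks q ` space ?\<Omega>. level_prob ?\<Omega> (blocks q) v * - ln (pmf p (v ! i)))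
        = (\<Sum>u\<in>?g ` space ?\<Omega>. level_prob ?\<Omega> ?g u * - ln (pmf p u))"
      by (rule UQ.sum_level_prob_comp[OF simple_function_blocks, symmetric, where h = "\<lambda>v. v ! i" and c = "\<lambda>u. - ln (pmf p u)"])
    also have "\<dots> = (\<Sum>u\<in>F. level_prob ?\<Omega> ?g u * - ln (pmf p u))"
      using i F(1) clamp_in by (intro sum.mono_neutral_left) (auto simp: UQ.level_prob_outside)
    also have "\<dots> = block_entropy" unfolding block_entropy_def using lpi by simp
    finally show "(\<Sum>v\<in>blocks q ` space ?\<Omega>. level_prob ?\<Omega> (blocks q) v * - ln (pmf p (v ! i))) = block_entropy" .
  qed
  finally show ?thesis by simp
qed


text \<open>With \<open>L\<close> above all letters in \<open>F\<close>, capping loses nothing. The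
  phase and \<open>Suc q * n\<close> symbols together determine the \<open>q\<close> blocks after
  the first; the phase has entropy at most \<open>ln n\<close>, which vanishes in the rate as
  \<open>q\<close> grows.\<close>

lemma block_entropy_le: "ereal (block_entropy / real n) \<le> measure_entropy block_measure shift"
proof -
  let ?\<Omega> = "U \<Otimes>\<^sub>M Q"
  interpret B: shift_measure block_measure by (rule prob_measures_shift_measure[OF block_measure_prob])
  interpret I: measure_preserving_map block_measure shift by (rule invariant_measures_locales[OF block_measure_invariant])
  obtain L where L: "\<And>x i. x \<in> F \<Longrightarrow> x i \<le> L" using letters_bounded by blast
  let ?f = "itinerary shift (capped_letter L)"
  note sf = B.simple_function_capped_letter[of L]
  obtain l where l: "(\<lambda>m. ent block_measure (?f m) / real m) \<longlonglongrightarrow> l"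
    using I.ent_rate_exists[OF sf] .
  define J where "J \<omega> = fst \<omega> mod n" for \<omega> :: "nat \<times> (nat \<Rightarrow> nat \<Rightarrow> nat)"
  have J: "simple_function ?\<Omega> J" "J ` space ?\<Omega> \<subseteq> {..<n}"
  proof -
    show sub: "J ` space ?\<Omega> \<subseteq> {..<n}" using n by (auto simp: J_def)
    have "fst \<in> measurable ?\<Omega> (count_space UNIV)"
      using measurable_fst[of U Q] by (simp add: measurable_cong_sets[OF refl sets_measure_pmf_count_space])
    hence "J \<in> measurable ?\<Omega> (count_space UNIV)"
      unfolding J_def by (rule measurable_compose) simp
    thus "simple_function ?\<Omega> J" unfolding simple_function_def
      using finite_subset[OF sub] measurable_sets[of J ?\<Omega> "count_space UNIV"] by auto
  qed
  have key: "real q * block_entropy \<le> ent block_measure (?f (Suc q * n)) + ln (real n)" for q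
  proof -
    let ?g = "\<lambda>\<omega>. ?f (Suc q * n) (point \<omega>)"
    have fs: "simple_function block_measure (?f (Suc q * n))" by (rule I.simple_function_itinerary[OF sf])
    have g: "simple_function ?\<Omega> ?g"
      unfolding simple_function_def
    proof (intro conjI ballI)
      show "finite (?g ` space ?\<Omega>)"
        by (rule finite_subset[OF _ simple_functionD(1)[OF fs]]) (use point_in_X in \<open>auto simp: B.space_eq\<close>)
      fix v
      have "?f (Suc q * n) -` {v} \<inter> X \<in> sets borel_X"
        using simple_functionD(2)[OF fs, of "{v}"] by (simp add: B.sets_eq B.space_eq)
      from measurable_sets[OF point_measurable this]
      show "?g -` {v} \<inter> space ?\<Omega> \<in> sets ?\<Omega>" using point_in_X by (simp add: vimage_def)
    qed
    have "real q * block_entropy = ent ?\<Omega> (blocks q)" by (simp add: ent_blocks)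
    also have "\<dots> \<le> ent ?\<Omega> (\<lambda>\<omega>. (?g \<omega>, J \<omega>))"
    proof (rule UQ.ent_mono[OF simple_function_Pair[OF g J(1)]])
      fix \<omega> \<omega>' assume "(?g \<omega>, J \<omega>) = (?g \<omega>', J \<omega>')"
      hence eq: "\<And>i. i < Suc q * n \<Longrightarrow> min (point \<omega> i) L = min (point \<omega>' i) L" and JJ: "J \<omega> = J \<omega>'"
        by (auto simp: itinerary_capped_letter_eq_iff)
      have le: "concatenation z i \<le> L" for z i using L[OF clamp_in] by (simp add: concatenation_def)
      \<comment> \<open>With a phase below \<open>n\<close> the observed window covers at least the
        positions from \<open>n\<close> up to \<open>Suc q * n - 1\<close>.\<close>
      have conc: "concatenation (snd \<omega>) i = concatenation (snd \<omega>') i" if i: "n \<le> i" "i < Suc q * n" for i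
      proof -
        have Jn: "J \<omega> < n" using n by (simp add: J_def)
        have "point \<omega> (i - J \<omega>) = concatenation (snd \<omega>) i" "point \<omega>' (i - J \<omega>) = concatenation (snd \<omega>') i"
          using i Jn JJ by (simp_all add: point_def J_def[symmetric])
        moreover have "i - J \<omega> < Suc q * n" using i by simp
        ultimately show ?thesis using eq[of "i - J \<omega>"] le[of "snd \<omega>" i] le[of "snd \<omega>'" i] by simp
      qed
      show "blocks q \<omega> = blocks q \<omega>'"
      proof (rule nth_equalityI)
        fix i assume "i < length (blocks q \<omega>)"
        hence i: "i < q" by simp
        have "clamp (snd \<omega> (Suc i)) = clamp (snd \<omega>' (Suc i))"
        proof (rule inj_onD[OF inj_on_prefix_word_periodic[OF n]])
          show "prefix_word n (clamp (snd \<omega> (Suc i))) = prefix_word n (clamp (snd \<omega>' (Suc i)))"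
            unfolding prefix_word_eq_iff
          proof (intro allI impI)
            fix k assume k: "k < n"
            have "Suc i * n + k < Suc (Suc i) * n" using k by simp
            also have "\<dots> \<le> Suc q * n" using i by (intro mult_right_mono) auto
            finally have "concatenation (snd \<omega>) (Suc i * n + k) = concatenation (snd \<omega>') (Suc i * n + k)"
              by (intro conc) auto
            moreover have "(Suc i * n + k) div n = Suc i" "(Suc i * n + k) mod n = k"
              using k n div_mult_self1[of n k "Suc i"] mod_mult_self1[of k "Suc i" n]
              by (simp_all only: add.commute[of k] div_less mod_less add_0_right not_one_le_zero)
            ultimately show "clamp (snd \<omega> (Suc i)) k = clamp (snd \<omega>' (Suc i)) k"
              by (simp only: concatenation_def)
          qed
        qed (use clamp_in F(2) in auto)
        thus "blocks q \<omega> ! i = blocks q \<omega>' ! i" using i by simp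
      qed simp
    qed
    also have "\<dots> \<le> ent ?\<Omega> ?g + ent ?\<Omega> J" by (rule UQ.ent_pair_le[OF g J(1)])
    also have "ent ?\<Omega> J \<le> ln (real n)" using UQ.ent_le_ln_card[OF J] by simp
    also have "ent ?\<Omega> ?g = ent block_measure (?f (Suc q * n))"
      using UQ.ent_distr[OF point_measurable, of "?f (Suc q * n)"] fs by (simp add: block_measure_def)
    finally show ?thesis by simp
  qed
  have "block_entropy / real n \<le> l"
  proof -
    have "strict_mono (\<lambda>q. Suc q * n)" using n by (auto simp: strict_mono_def)
    from LIMSEQ_subseq_LIMSEQ[OF l this]
    have l': "(\<lambda>q. ent block_measure (?f (Suc q * n)) / real (Suc q * n)) \<longlonglongrightarrow> l" by (simp add: comp_def)
    have "(\<lambda>q. (real q * block_entropy - ln (real n)) / real (Suc q * n))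
        = (\<lambda>q. (1 - 1 / real (Suc q)) * (block_entropy / real n) - (ln (real n) / real n) * (1 / real (Suc q)))"
    proof
      fix q
      have alg: "((a - 1) * E - M) / (a * N) = (1 - 1 / a) * (E / N) - (M / N) * (1 / a)"
        if "a > 0" "N > 0" for a N E M :: real
        using that by (simp add: diff_divide_distrib left_diff_distrib)
      show "(real q * block_entropy - ln (real n)) / real (Suc q * n)
          = (1 - 1 / real (Suc q)) * (block_entropy / real n) - (ln (real n) / real n) * (1 / real (Suc q))"
        using alg[of "real (Suc q)" "real n" block_entropy "ln (real n)"] n
        unfolding of_nat_mult by simp
    qed
    moreover have "(\<lambda>q. (1 - 1 / real (Suc q)) * (block_entropy / real n) - (ln (real n) / real n) * (1 / real (Suc q)))
        \<longlonglongrightarrow> (1 - 0) * (block_entropy / real n) - (ln (real n) / real n) * 0"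
      by (intro tendsto_intros LIMSEQ_inverse_real_of_nat[unfolded inverse_eq_divide])
    ultimately have "(\<lambda>q. (real q * block_entropy - ln (real n)) / real (Suc q * n)) \<longlonglongrightarrow> block_entropy / real n"
      by simp
    moreover have "(real q * block_entropy - ln (real n)) / real (Suc q * n) \<le> ent block_measure (?f (Suc q * n)) / real (Suc q * n)" for q
      using key[of q] by (intro divide_right_mono) auto
    ultimately show ?thesis using LIMSEQ_le[OF _ l'] by blast
  qed
  thus ?thesis using I.measure_entropy_ge[OF sf l] by (meson ereal_less_eq(3) order_trans)
qed

end

section \<open>Exponential bounds for periodic points\<close>

lemma ex_pmf_finite_support:
  fixes q :: "'a \<Rightarrow> real"
  assumes "finite F" "\<And>x. x \<in> F \<Longrightarrow> q x > 0" "(\<Sum>x\<in>F. q x) = 1"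
  shows "\<exists>p. set_pmf p = F \<and> (\<forall>x\<in>F. pmf p x = q x)"
proof -
  define r where "r x = (if x \<in> F then q x else 0)" for x
  have r: "\<And>x. r x \<ge> 0" using assms(2) by (auto simp: r_def less_imp_le)
  have "(\<integral>\<^sup>+x. ennreal (r x) \<partial>count_space UNIV) = (\<Sum>x\<in>F. ennreal (r x))"
    by (rule nn_integral_count_space'[OF assms(1)]) (auto simp: r_def)
  also have "\<dots> = ennreal (\<Sum>x\<in>F. r x)" using r by (simp add: sum_ennreal)
  also have "\<dots> = 1" using assms(3) by (simp add: r_def)
  finally have 1: "(\<integral>\<^sup>+x. ennreal (r x) \<partial>count_space UNIV) = 1" .
  have pm: "pmf (embed_pmf r) x = r x" for x by (rule pmf_embed_pmf[OF r 1])
  have "set_pmf (embed_pmf r) = F" using assms(2) by (force simp: set_pmf_eq pm r_def)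
  thus ?thesis using pm by (intro exI[of _ "embed_pmf r"]) (auto simp: r_def)
qed

lemma sum_indicator_eq_card: "finite A \<Longrightarrow> (\<Sum>k\<in>A. if Q k then 1 else 0 :: real) = real (card {k\<in>A. Q k})"
  by (simp add: sum.If_cases Int_def)

context acceptable_potential
begin

text \<open>Each letter contributes its value on a constant sequence plus the oscillation.
  Concatenations of finitely many periodic points use finitely many letters, so the potential is
  bounded along them.\<close>

lemma bounded_on_letters: "\<exists>B. \<forall>x\<in>X. x 0 \<le> L \<longrightarrow> \<bar>\<phi> x\<bar> \<le> B"
proof -
  obtain C where C: "C \<ge> 0" "\<And>x y. x \<in> X \<Longrightarrow> y \<in> X \<Longrightarrow> x 0 = y 0 \<Longrightarrow> \<bar>\<phi> x - \<phi> y\<bar> \<le> C"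
    using oscillation by blast
  have "\<bar>\<phi> x\<bar> \<le> C + (\<Sum>a\<le>L. \<bar>\<phi> (\<lambda>_. a)\<bar>)" if x: "x \<in> X" "x 0 \<le> L" for x
  proof -
    have "(\<lambda>_. x 0) \<in> X" using full_shiftD[OF x(1), of 0] by (simp add: full_shift_def)
    hence "\<bar>\<phi> x - \<phi> (\<lambda>_. x 0)\<bar> \<le> C" using C(2)[OF x(1)] by simp
    moreover have "\<bar>\<phi> (\<lambda>_. x 0)\<bar> \<le> (\<Sum>a\<le>L. \<bar>\<phi> (\<lambda>_. a)\<bar>)"
      by (rule member_le_sum[of "x 0" "{..L}" "\<lambda>a. \<bar>\<phi> (\<lambda>_. a)\<bar>"]) (use x in auto)
    ultimately show ?thesis by linarith
  qed
  thus ?thesis by blast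
qed

text \<open>For \<open>p\<close> proportional to \<open>exp (S n x)\<close> one has
  \<open>- ln (pmf p x) = ln T - S n x\<close>, so block entropy plus mean Birkhoff sum is exactly
  \<open>ln T\<close>, the equality case of Gibbs' inequality. A concatenation agrees with its first
  block on \<open>n\<close> coordinates, which costs at most \<open>D\<close>.\<close>

lemma block_measure_free_energy:
  assumes n: "n \<ge> 1" and F: "finite F" "F \<noteq> {}" "F \<subseteq> periodic_points n"
    and D: "\<And>x y. x \<in> X \<Longrightarrow> y \<in> X \<Longrightarrow> (\<forall>i<n. x i = y i) \<Longrightarrow> \<bar>S n x - S n y\<bar> \<le> D"
  shows "\<exists>\<nu>\<in>prob_measures. \<exists>q. (\<forall>x\<in>F. q x \<ge> 0) \<and> (\<Sum>x\<in>F. q x) = 1 \<and>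
    (\<forall>w. \<bar>cylinder_prob \<nu> w - (\<Sum>x\<in>F. q x * cylinder_prob (empirical_measure n x) w)\<bar> \<le> real (length w) / real n) \<and>
    ereal ((ln (\<Sum>x\<in>F. exp (S n x)) - D) / real n - P) \<le> free_energy \<phi> \<nu>"
proof -
  define T where "T = (\<Sum>x\<in>F. exp (S n x))"
  have T: "T > 0" unfolding T_def using F by (intro sum_pos) auto
  have "(\<Sum>x\<in>F. exp (S n x) / T) = 1" using T by (simp add: sum_divide_distrib[symmetric] T_def[symmetric])
  then obtain p where p: "set_pmf p = F" "\<And>x. x \<in> F \<Longrightarrow> pmf p x = exp (S n x) / T"
    using ex_pmf_finite_support[OF F(1), of "\<lambda>x. exp (S n x) / T"] T by auto
  interpret block_process n F p by standard (use n F p in auto)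
  have p1: "(\<Sum>x\<in>F. pmf p x) = 1" using sum_pmf_eq_1[OF F(1)] p(1) by simp
  have be: "block_entropy = ln T - (\<Sum>x\<in>F. pmf p x * S n x)"
  proof -
    have "block_entropy = (\<Sum>x\<in>F. pmf p x * ln T - pmf p x * S n x)"
      unfolding block_entropy_def
    proof (rule sum.cong[OF refl])
      fix x assume "x \<in> F"
      hence "- ln (pmf p x) = ln T - S n x" using p(2) T by (simp add: ln_div)
      thus "pmf p x * - ln (pmf p x) = pmf p x * ln T - pmf p x * S n x" by (simp only: right_diff_distrib)
    qed
    also have "\<dots> = (\<Sum>x\<in>F. pmf p x) * ln T - (\<Sum>x\<in>F. pmf p x * S n x)"
      by (simp add: sum_subtractf sum_distrib_right)
    finally show ?thesis by (simp add: p1)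
  qed
  obtain L where L: "\<And>x i. x \<in> F \<Longrightarrow> x i \<le> L" using letters_bounded by blast
  obtain B where B: "\<And>x. x \<in> X \<Longrightarrow> x 0 \<le> L \<Longrightarrow> \<bar>\<phi> x\<bar> \<le> B" using bounded_on_letters by blast
  have bnd: "\<bar>\<phi> ((shift ^^ j) (concatenation z))\<bar> \<le> B" for j z
    by (rule B[OF shift_funpow_in[OF concatenation_in_X]]) (simp add: concatenation_def L[OF clamp_in])
  have int: "integrable block_measure \<phi>" by (rule integral_block_measure(1)[OF measurable bnd])
  have intQ: "integrable Q (\<lambda>z. \<phi> ((shift ^^ j) (concatenation z)))" if "j < n" for j
    by (rule integrable_Q[OF measurable bnd that])
  have "(\<Sum>x\<in>F. pmf p x * S n x) - D \<le> (\<Sum>j<n. \<integral>z. \<phi> ((shift ^^ j) (concatenation z)) \<partial>Q)"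
  proof -
    have "(\<Sum>j<n. \<integral>z. \<phi> ((shift ^^ j) (concatenation z)) \<partial>Q) = (\<integral>z. S n (concatenation z) \<partial>Q)"
      unfolding birkhoff_sum_def using intQ by (intro Bochner_Integration.integral_sum[symmetric]) (simp del: shift_funpow_apply)
    moreover have "(\<integral>z. S n (clamp (z 0)) - D \<partial>Q) \<le> (\<integral>z. S n (concatenation z) \<partial>Q)"
    proof (rule integral_mono)
      show "integrable Q (\<lambda>z. S n (clamp (z 0)) - D)" using integral_first_block(1)[of "S n" 0] by simp
      show "integrable Q (\<lambda>z. S n (concatenation z))"
        unfolding birkhoff_sum_def using intQ by (intro Bochner_Integration.integrable_sum) simp
      fix z
      show "S n (clamp (z 0)) - D \<le> S n (concatenation z)"
        using D[OF concatenation_in_X[of z] clamp_in_X[of "z 0"]] concatenation_first[of _ z] by (simp add: abs_le_iff)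
    qed
    moreover have "(\<integral>z. S n (clamp (z 0)) - D \<partial>Q) = (\<Sum>x\<in>F. pmf p x * S n x) - D"
      using integral_first_block[of "S n" 0] by (simp add: Q.P.prob_space)
    ultimately show ?thesis by simp
  qed
  hence "((\<Sum>x\<in>F. pmf p x * S n x) - D) / real n \<le> (\<integral>x. \<phi> x \<partial>block_measure)"
    unfolding integral_block_measure(2)[OF measurable bnd] by (intro divide_right_mono) auto
  moreover have "ereal (block_entropy / real n) \<le> measure_entropy block_measure shift" by (rule block_entropy_le)
  moreover have "block_measure \<in> invariant_measures_for \<phi>"
    using block_measure_invariant by (simp add: invariant_measures_for_def ext_integral_eq[OF int])
  hence "free_energy \<phi> block_measure = measure_entropy block_measure shift + ereal (\<integral>x. \<phi> x \<partial>block_measure) - ereal P"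
    by (simp add: free_energy_def ext_integral_eq[OF int] pressure_eq_P)
  ultimately have "ereal (block_entropy / real n) + ereal (((\<Sum>x\<in>F. pmf p x * S n x) - D) / real n) - ereal P
      \<le> free_energy \<phi> block_measure"
    by (simp only:) (intro ereal_minus_mono add_mono, auto)
  moreover have "block_entropy / real n + ((\<Sum>x\<in>F. pmf p x * S n x) - D) / real n - P = (ln T - D) / real n - P"
    unfolding be by (simp add: add_divide_distrib[symmetric])
  ultimately have "ereal ((ln T - D) / real n - P) \<le> free_energy \<phi> block_measure" by simp
  thus ?thesis unfolding T_def[symmetric]
    using block_measure_prob cylinder_prob_block_measure p1 
    by (intro bexI[of _ block_measure] exI[of _ "pmf p"]) auto
qed

section \<open>Normalized weights of sets of periodic points\<close>

text \<open>The probability of \<open>A\<close> under the weighted periodic points. It is meaningful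
  for \<open>n \<ge> 1\<close>; with period 0 every point of \<open>X\<close> would count.\<close>

definition gibbs_weight :: "nat \<Rightarrow> (nat \<Rightarrow> nat) set \<Rightarrow> real" where
  "gibbs_weight n A = (\<Sum>\<^sub>\<infinity>x\<in>periodic_points n \<inter> A. exp (S n x)) / partition_sum \<phi> n"

lemma gibbs_weight_summable: "n \<ge> 1 \<Longrightarrow> (\<lambda>x. exp (S n x)) summable_on (periodic_points n \<inter> A)"
  by (rule summable_on_subset_banach[OF summable_periodic]) auto

lemma gibbs_weight_nonneg: "n \<ge> 1 \<Longrightarrow> gibbs_weight n A \<ge> 0"
  unfolding gibbs_weight_def using partition_sum_pos[of n]
  by (intro divide_nonneg_nonneg infsum_nonneg) (auto simp: less_imp_le)

lemma gibbs_weight_mono: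
  assumes "n \<ge> 1" "periodic_points n \<inter> A \<subseteq> B" shows "gibbs_weight n A \<le> gibbs_weight n B"
  unfolding gibbs_weight_def using partition_sum_pos[OF assms(1)] assms
  by (intro divide_right_mono infsum_mono2 gibbs_weight_summable) auto

lemma gibbs_weight_Un:
  assumes "n \<ge> 1" shows "gibbs_weight n (A \<union> B) \<le> gibbs_weight n A + gibbs_weight n B"
proof -
  have "(\<Sum>\<^sub>\<infinity>x\<in>periodic_points n \<inter> (A \<union> B). exp (S n x))
      = (\<Sum>\<^sub>\<infinity>x\<in>(periodic_points n \<inter> A) \<union> (periodic_points n \<inter> (B - A)). exp (S n x))"
    by (rule arg_cong[where f = "infsum _"]) auto
  also have "\<dots> = (\<Sum>\<^sub>\<infinity>x\<in>periodic_points n \<inter> A. exp (S n x)) + (\<Sum>\<^sub>\<infinity>x\<in>periodic_points n \<inter> (B - A). exp (S n x))"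
    by (rule infsum_Un_disjoint) (auto intro: gibbs_weight_summable[OF assms])
  finally have "gibbs_weight n (A \<union> B) = gibbs_weight n A + gibbs_weight n (B - A)"
    by (simp add: gibbs_weight_def add_divide_distrib)
  also have "gibbs_weight n (B - A) \<le> gibbs_weight n B" by (rule gibbs_weight_mono[OF assms]) auto
  finally show ?thesis by simp
qed

lemma gibbs_weight_finite_Union:
  assumes "n \<ge> 1" "finite I"
  shows "gibbs_weight n (\<Union>i\<in>I. A i) \<le> (\<Sum>i\<in>I. gibbs_weight n (A i))"
  using assms(2)
proof (induction I rule: finite_induct)
  case empty
  show ?case by (simp add: gibbs_weight_def)
next
  case (insert i I)
  thus ?case using gibbs_weight_Un[OF assms(1), of "A i" "\<Union>i\<in>I. A i"] by simp
qed

text \<open>Bounds on finite subsets pass to the infinite sum. Half of the rate \<open>c\<close> is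
  spent on the loss in the lower bound for the partition sum, and the other half drives the
  decay.\<close>

lemma gibbs_weight_exponential_decay:
  assumes c: "c > 0"
    and bound: "eventually (\<lambda>n. \<forall>F. finite F \<longrightarrow> F \<subseteq> periodic_points n \<inter> A n \<longrightarrow>
      (\<Sum>x\<in>F. exp (S n x)) \<le> exp (real n * (P - c) + K)) sequentially"
  shows "(\<lambda>n. gibbs_weight n (A n)) \<longlonglongrightarrow> 0"
proof -
  obtain K' where K': "\<And>n. n \<ge> 1 \<Longrightarrow> exp (- (c / 2 * real n + K')) * rwsum n \<le> partition_sum \<phi> n"
    using partition_sum_ge[of "c / 2"] c by auto
  have lim: "(\<lambda>n. exp (K + K') * exp (- (c / 2)) ^ n) \<longlonglongrightarrow> exp (K + K') * 0"
    by (intro tendsto_mult tendsto_const LIMSEQ_power_zero) (use c in auto)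
  have ub: "eventually (\<lambda>n. gibbs_weight n (A n) \<le> exp (K + K') * exp (- (c / 2)) ^ n) sequentially"
    using bound eventually_ge_at_top[of 1]
  proof eventually_elim
    case (elim n)
    have Z: "partition_sum \<phi> n \<ge> exp (- (c / 2 * real n + K') + real n * P)"
    proof -
      have "exp (- (c / 2 * real n + K') + real n * P) = exp (- (c / 2 * real n + K')) * exp (real n * P)"
        by (rule exp_add)
      also have "\<dots> \<le> exp (- (c / 2 * real n + K')) * rwsum n"
        using rwsum_ge_exp_P[OF elim(2)] by (intro mult_left_mono) auto
      finally show ?thesis using K'[OF elim(2)] by linarith
    qed
    have "(\<Sum>\<^sub>\<infinity>x\<in>periodic_points n \<inter> A n. exp (S n x)) \<le> exp (real n * (P - c) + K)"
      by (rule infsum_le_finite_sums[OF gibbs_weight_summable[OF elim(2)]]) (use elim(1) in blast)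
    hence "gibbs_weight n (A n) \<le> exp (real n * (P - c) + K) / exp (- (c / 2 * real n + K') + real n * P)"
      unfolding gibbs_weight_def using Z by (intro frac_le) auto
    also have "\<dots> = exp (K + K') * exp (- (c / 2)) ^ n"
      by (simp add: exp_diff[symmetric] exp_add[symmetric] exp_of_nat_mult[symmetric] algebra_simps)
    finally show ?case .
  qed
  have lb: "eventually (\<lambda>n. 0 \<le> gibbs_weight n (A n)) sequentially"
    using eventually_ge_at_top[of 1] by eventually_elim (rule gibbs_weight_nonneg)
  show ?thesis using real_tendsto_sandwich[OF lb ub tendsto_const] lim by simp
qed

text \<open>The averaged empirical measures stay within \<open>d / 2\<close> of \<open>\<mu>\<close>
  on \<open>W\<close> by convexity, and blocking adds less than \<open>d / 2\<close> for large
  \<open>n\<close>. So the block measure lies in \<open>G\<close>, and its free energy being at most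
  \<open>-c\<close> turns into an upper bound on the total weight; \<open>c / 2\<close> of the rate
  pays for distortion.\<close>

lemma local_upper_bound:
  assumes G: "openin weak_star G" "\<mu> \<in> G" and c: "c > 0" "\<And>\<nu>. \<nu> \<in> G \<Longrightarrow> free_energy \<phi> \<nu> \<le> ereal (- c)"
  shows "\<exists>W d. finite W \<and> W \<subseteq> lists pos_nats \<and> d > 0 \<and>
    (\<lambda>n. gibbs_weight n {x. \<forall>w\<in>W. \<bar>cylinder_prob (empirical_measure n x) w - cylinder_prob \<mu> w\<bar> < d}) \<longlonglongrightarrow> 0"
proof -
  obtain W d where W: "finite W" "W \<subseteq> lists pos_nats" "d > 0"
    and nbhd: "\<And>\<nu>. \<nu> \<in> prob_measures \<Longrightarrow> (\<forall>w\<in>W. \<bar>cylinder_prob \<nu> w - cylinder_prob \<mu> w\<bar> < d) \<Longrightarrow> \<nu> \<in> G"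
    using weak_star_cylinder_nbhd[OF G] by blast
  obtain K where K: "\<And>n x y. x \<in> X \<Longrightarrow> y \<in> X \<Longrightarrow> (\<forall>i<n. x i = y i) \<Longrightarrow> \<bar>S n x - S n y\<bar> \<le> c / 2 * real n + K"
    using distortion[OF half_gt_zero[OF c(1)]] by blast
  let ?A = "\<lambda>n. {x. \<forall>w\<in>W. \<bar>cylinder_prob (empirical_measure n x) w - cylinder_prob \<mu> w\<bar> < d / 2}"
  obtain M where M: "\<And>w. w \<in> W \<Longrightarrow> real (length w) \<le> real M"
    using finite_imageI[OF W(1), of length] by (metis finite_nat_set_iff_bounded_le image_eqI of_nat_mono)
  obtain n0 where n0: "real n0 > 2 * real M / d" using reals_Archimedean2 by blast
  have "(\<lambda>n. gibbs_weight n (?A n)) \<longlonglongrightarrow> 0"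
  proof (rule gibbs_weight_exponential_decay[of "c / 2" _ K])
    show "c / 2 > 0" using c by simp
    show "eventually (\<lambda>n. \<forall>F. finite F \<longrightarrow> F \<subseteq> periodic_points n \<inter> ?A n \<longrightarrow>
      (\<Sum>x\<in>F. exp (S n x)) \<le> exp (real n * (P - c / 2) + K)) sequentially"
      using eventually_ge_at_top[of "Suc n0"]
    proof eventually_elim
      case (elim n)
      hence n: "n \<ge> 1" "real n > 2 * real M / d" using n0 by auto
      show ?case
      proof (intro allI impI)
        fix F assume F: "finite F" "F \<subseteq> periodic_points n \<inter> ?A n"
        show "(\<Sum>x\<in>F. exp (S n x)) \<le> exp (real n * (P - c / 2) + K)"
        proof (cases "F = {}")
          case False
          define T where "T = (\<Sum>x\<in>F. exp (S n x))"
          have T: "T > 0" unfolding T_def using F(1) False by (intro sum_pos) auto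
          obtain \<nu> q where \<nu>: "\<nu> \<in> prob_measures" "\<forall>x\<in>F. q x \<ge> 0" "(\<Sum>x\<in>F. q x) = 1"
            "\<And>w. \<bar>cylinder_prob \<nu> w - (\<Sum>x\<in>F. q x * cylinder_prob (empirical_measure n x) w)\<bar> \<le> real (length w) / real n"
            "ereal ((ln T - (c / 2 * real n + K)) / real n - P) \<le> free_energy \<phi> \<nu>"
            using block_measure_free_energy[OF n(1) F(1) False _ K] F(2) unfolding T_def by blast
          have "\<nu> \<in> G"
          proof (rule nbhd[OF \<nu>(1)], rule ballI)
            fix w assume w: "w \<in> W"
            have "(\<Sum>x\<in>F. q x * cylinder_prob (empirical_measure n x) w) - cylinder_prob \<mu> w
                = (\<Sum>x\<in>F. q x * (cylinder_prob (empirical_measure n x) w - cylinder_prob \<mu> w))"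
              using \<nu>(3) by (simp add: right_diff_distrib sum_subtractf sum_distrib_right[symmetric])
            also have "\<bar>\<dots>\<bar> \<le> (\<Sum>x\<in>F. \<bar>q x * (cylinder_prob (empirical_measure n x) w - cylinder_prob \<mu> w)\<bar>)"
              by (rule sum_abs)
            also have "\<dots> \<le> (\<Sum>x\<in>F. q x * (d / 2))"
              unfolding abs_mult using F(2) w \<nu>(2) by (intro sum_mono mult_mono) (auto simp: less_imp_le)
            also have "\<dots> = d / 2" by (simp only: sum_distrib_right[symmetric] \<nu>(3) mult_1)
            finally have "\<bar>(\<Sum>x\<in>F. q x * cylinder_prob (empirical_measure n x) w) - cylinder_prob \<mu> w\<bar> \<le> d / 2" .
            moreover have "real (length w) / real n < d / 2"
            proof -
              have "real (length w) / real n \<le> real M / real n" using M[OF w] by (intro divide_right_mono) auto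
              also have "\<dots> < d / 2" using n W(3) by (simp add: field_simps)
              finally show ?thesis .
            qed
            ultimately show "\<bar>cylinder_prob \<nu> w - cylinder_prob \<mu> w\<bar> < d" using \<nu>(4)[of w] by linarith
          qed
          from order_trans[OF \<nu>(5) c(2)[OF this]]
          have "(ln T - (c / 2 * real n + K)) / real n - P \<le> - c" by simp
          hence "(ln T - (c / 2 * real n + K)) / real n \<le> P - c" by simp
          hence "ln T - (c / 2 * real n + K) \<le> (P - c) * real n" using n(1) by (simp add: pos_divide_le_eq)
          hence "ln T \<le> real n * (P - c / 2) + K" by (simp add: algebra_simps)
          thus ?thesis using T unfolding T_def[symmetric] by (metis exp_le_cancel_iff exp_ln)
        qed simp
      qed
    qed
  qed
  thus ?thesis using W by (intro exI[of _ W] exI[of _ "d / 2"]) auto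
qed

section \<open>Rarity of large letters\<close>

text \<open>A finite set nearly attaining the supremum of the partial sums leaves less than
  \<open>e\<close> for any finite set beyond its maximum.\<close>

lemma letter_weight_tail:
  assumes "e > 0"
  shows "\<exists>N. \<forall>G. finite G \<longrightarrow> G \<subseteq> {N<..} \<longrightarrow> (\<Sum>p\<in>G. letter_weight p) < e"
proof -
  let ?C = "{F. finite F \<and> F \<subseteq> pos_nats}"
  let ?s = "SUP F\<in>?C. (\<Sum>p\<in>F. letter_weight p)"
  have bdd: "bdd_above ((\<lambda>F. \<Sum>p\<in>F. letter_weight p) ` ?C)"
    by (rule bdd_aboveI2[of _ _ "rwsum 1"]) (auto intro: sum_letter_weight_le)
  have "?s - e < ?s" using assms by simp
  then obtain G0 where G0: "G0 \<in> ?C" "?s - e < (\<Sum>p\<in>G0. letter_weight p)"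
    using less_cSUP_iff[OF _ bdd, of "?s - e"] by blast
  define N where "N = Max (insert 0 G0)"
  have "(\<Sum>p\<in>G. letter_weight p) < e" if G: "finite G" "G \<subseteq> {N<..}" for G
  proof -
    have "G0 \<inter> G = {}"
      using G G0(1) Max_ge[of "insert 0 G0"] by (fastforce simp: N_def)
    hence "(\<Sum>p\<in>G0. letter_weight p) + (\<Sum>p\<in>G. letter_weight p) = (\<Sum>p\<in>G0 \<union> G. letter_weight p)"
      using G0(1) G(1) by (intro sum.union_disjoint[symmetric]) auto
    also have "\<dots> \<le> ?s" by (rule cSUP_upper[OF _ bdd]) (use G0(1) G in auto)
    finally show ?thesis using G0(2) by linarith
  qed
  thus ?thesis by blast
qed

text \<open>Expanding the power produces every word of length \<open>n\<close> over \<open>L\<close>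
  once, and points with distinct prefixes use distinct words.\<close>

lemma sum_prod_letters_le:
  fixes u :: "nat \<Rightarrow> real"
  assumes "finite F" "inj_on (prefix_word n) F" "\<And>p. u p \<ge> 0" "finite L" "\<And>x k. x \<in> F \<Longrightarrow> k < n \<Longrightarrow> x k \<in> L"
  shows "(\<Sum>x\<in>F. \<Prod>k<n. u (x k)) \<le> (\<Sum>p\<in>L. u p) ^ n"
proof -
  let ?r = "\<lambda>x. restrict x {..<n}"
  have inj: "inj_on ?r F"
  proof (rule inj_onI)
    fix x y assume "x \<in> F" "y \<in> F" "?r x = ?r y"
    hence "prefix_word n x = prefix_word n y"
      unfolding prefix_word_eq_iff by (metis lessThan_iff restrict_apply')
    thus "x = y" using assms(2) \<open>x \<in> F\<close> \<open>y \<in> F\<close> by (auto dest: inj_onD)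
  qed
  have "(\<Sum>x\<in>F. \<Prod>k<n. u (x k)) = (\<Sum>f\<in>?r ` F. \<Prod>k<n. u (f k))"
    by (simp add: sum.reindex[OF inj])
  also have "\<dots> \<le> (\<Sum>f\<in>PiE {..<n} (\<lambda>_. L). \<Prod>k<n. u (f k))"
  proof (rule sum_mono2)
    show "finite (PiE {..<n} (\<lambda>_. L))" using assms(4) by (intro finite_PiE) auto
    show "?r ` F \<subseteq> PiE {..<n} (\<lambda>_. L)"
    proof (rule image_subsetI)
      fix x assume "x \<in> F"
      thus "?r x \<in> PiE {..<n} (\<lambda>_. L)" using assms(5) by (intro restrict_PiE_iff[THEN iffD2]) auto
    qed
    show "0 \<le> (\<Prod>k<n. u (f k))" for f using assms(3) by (intro prod_nonneg) auto
  qed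
  also have "\<dots> = (\<Prod>k<n. \<Sum>p\<in>L. u p)" by (rule prod_sum_PiE[symmetric]) (use assms in auto)
  finally show ?thesis by simp
qed

text \<open>Exponential Chebyshev: tilting by \<open>exp \<beta>\<close> on letters above \<open>N\<close> costs only a bounded factor per
  letter once \<open>N\<close> is large.\<close>

lemma large_letters_rare:
  assumes \<eta>: "\<eta> > 0"
  shows "\<exists>N. (\<lambda>n. gibbs_weight n {x. real (card {k. k < n \<and> N < x k}) \<ge> \<eta> * real n}) \<longlonglongrightarrow> 0"
proof -
  \<comment> \<open>Bounds the tilted letter sum: \<open>rwsum 1\<close> for the plain weights, and
    1 for the tail, which is below \<open>exp (- \<beta>)\<close> before tilting.\<close>
  define A where "A = rwsum 1 + 1"
  have A: "A > 0" using rwsum_pos[of 1] by (simp add: A_def)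
  \<comment> \<open>Makes \<open>A ^ n * exp (- \<beta> \<eta> n)\<close> at most
    \<open>exp (n (P - 1))\<close>, a rate lower than the pressure by 1. \<open>\<beta>\<close> is
    fixed before \<open>N\<close>, which \<open>A\<close> permits because it does not involve
    \<open>\<beta>\<close>.\<close>
  define \<beta> where "\<beta> = (\<bar>ln A - P\<bar> + 1) / \<eta>"
  have \<beta>: "\<beta> \<ge> 0" "\<beta> * \<eta> \<ge> ln A - P + 1" using \<eta> by (auto simp: \<beta>_def)
  obtain N where N: "\<And>G. finite G \<Longrightarrow> G \<subseteq> {N<..} \<Longrightarrow> (\<Sum>p\<in>G. letter_weight p) < exp (- \<beta>)"
    using letter_weight_tail[of "exp (- \<beta>)"] by auto
  define u where "u p = letter_weight p * (if N < p then exp \<beta> else 1)" for p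
  have u: "u p \<ge> 0" for p by (simp add: u_def letter_weight_nonneg)
  have u_sum: "(\<Sum>p\<in>L. u p) \<le> A" if L: "finite L" "L \<subseteq> pos_nats" for L
  proof -
    have "(\<Sum>p\<in>L. u p) \<le> (\<Sum>p\<in>L. letter_weight p + (if N < p then exp \<beta> * letter_weight p else 0))"
      by (intro sum_mono) (auto simp: u_def letter_weight_nonneg)
    also have "\<dots> = (\<Sum>p\<in>L. letter_weight p) + exp \<beta> * (\<Sum>p\<in>{p\<in>L. N < p}. letter_weight p)"
    proof -
      have "(\<Sum>p\<in>{p\<in>L. N < p}. exp \<beta> * letter_weight p)
          = (\<Sum>p\<in>L. if N < p then exp \<beta> * letter_weight p else 0)"
        by (rule sum.inter_filter[OF L(1)])
      thus ?thesis unfolding sum.distrib sum_distrib_left by simp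
    qed
    also have "\<dots> \<le> rwsum 1 + exp \<beta> * exp (- \<beta>)"
    proof (intro add_mono mult_left_mono)
      show "(\<Sum>p\<in>L. letter_weight p) \<le> rwsum 1" by (rule sum_letter_weight_le[OF L])
      have "finite {p\<in>L. N < p}" "{p\<in>L. N < p} \<subseteq> {N<..}" using L(1) by auto
      from N[OF this] show "(\<Sum>p\<in>{p\<in>L. N < p}. letter_weight p) \<le> exp (- \<beta>)" by (rule less_imp_le)
    qed simp
    also have "\<dots> = A" by (simp add: A_def exp_minus)
    finally show ?thesis .
  qed
  let ?A = "\<lambda>n. {x. real (card {k. k < n \<and> N < x k}) \<ge> \<eta> * real n}"
  have "(\<lambda>n. gibbs_weight n (?A n)) \<longlonglongrightarrow> 0"
  proof (rule gibbs_weight_exponential_decay[of 1 _ 0])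
    show "eventually (\<lambda>n. \<forall>F. finite F \<longrightarrow> F \<subseteq> periodic_points n \<inter> ?A n \<longrightarrow>
      (\<Sum>x\<in>F. exp (S n x)) \<le> exp (real n * (P - 1) + 0)) sequentially"
      using eventually_ge_at_top[of 1]
    proof eventually_elim
      case (elim n)
      show ?case
      proof (intro allI impI)
        fix F assume F: "finite F" "F \<subseteq> periodic_points n \<inter> ?A n"
        have FX: "x \<in> X" if "x \<in> F" for x using F(2) that periodic_points_subset by blast
        define L where "L = (\<lambda>(x, k). x k) ` (F \<times> {..<n})"
        have L: "finite L" "L \<subseteq> pos_nats" "\<And>x k. x \<in> F \<Longrightarrow> k < n \<Longrightarrow> x k \<in> L"
          using F(1) full_shiftD[OF FX] by (auto simp: L_def)
        have "exp (S n x) \<le> exp (- (\<beta> * \<eta> * real n)) * (\<Prod>k<n. u (x k))" if x: "x \<in> F" for x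
        proof -
          let ?m = "card {k. k < n \<and> N < x k}"
          have "(\<Prod>k<n. u (x k)) = (\<Prod>k<n. letter_weight (x k)) * (\<Prod>k<n. if N < x k then exp \<beta> else 1)"
            by (simp add: u_def prod.distrib)
          also have "(\<Prod>k<n. if N < x k then exp \<beta> else 1) = exp \<beta> ^ ?m"
            by (simp add: prod.If_cases Int_def)
          finally have pr: "(\<Prod>k<n. u (x k)) = (\<Prod>k<n. letter_weight (x k)) * exp (real ?m * \<beta>)"
            by (simp add: exp_of_nat_mult)
          have "\<eta> * real n \<le> real ?m" using F(2) x by auto
          hence "\<beta> * (\<eta> * real n) \<le> \<beta> * real ?m" using \<beta>(1) by (rule mult_left_mono)
          hence "1 \<le> exp (- (\<beta> * \<eta> * real n)) * exp (real ?m * \<beta>)"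
            unfolding exp_add[symmetric] by (simp add: algebra_simps)
          hence "(\<Prod>k<n. letter_weight (x k)) * 1
              \<le> (\<Prod>k<n. letter_weight (x k)) * (exp (- (\<beta> * \<eta> * real n)) * exp (real ?m * \<beta>))"
            by (intro mult_left_mono prod_nonneg) (auto simp: letter_weight_nonneg)
          thus ?thesis using exp_S_le_prod[OF FX[OF x], of n] unfolding pr by (simp add: algebra_simps)
        qed
        hence "(\<Sum>x\<in>F. exp (S n x)) \<le> exp (- (\<beta> * \<eta> * real n)) * (\<Sum>x\<in>F. \<Prod>k<n. u (x k))"
          unfolding sum_distrib_left by (rule sum_mono)
        also have "(\<Sum>x\<in>F. \<Prod>k<n. u (x k)) \<le> (\<Sum>p\<in>L. u p) ^ n"
          using F inj_on_subset[OF inj_on_prefix_word_periodic[OF elim]] L u by (intro sum_prod_letters_le) auto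
        also have "(\<Sum>p\<in>L. u p) ^ n \<le> A ^ n"
          using u_sum[OF L(1,2)] u by (intro power_mono sum_nonneg) auto
        also have "A ^ n = exp (real n * ln A)" using A by (simp add: exp_of_nat_mult)
        also have "exp (- (\<beta> * \<eta> * real n)) * exp (real n * ln A) \<le> exp (real n * (P - 1) + 0)"
        proof -
          have "real n * (ln A - P + 1) \<le> real n * (\<beta> * \<eta>)" using \<beta>(2) by (intro mult_left_mono) auto
          thus ?thesis unfolding exp_add[symmetric] by (simp add: algebra_simps)
        qed
        finally show "(\<Sum>x\<in>F. exp (S n x)) \<le> exp (real n * (P - 1) + 0)" by simp
      qed
    qed
  qed simp
  thus ?thesis by blast
qed

end

section \<open>Concentration of empirical measures\<close>

lemma compact_unit_cube: "compact {g :: nat list \<Rightarrow> real. \<forall>w. g w \<in> {0..1}}"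
proof -
  have "compactin (product_topology (\<lambda>_. euclidean) UNIV) (PiE UNIV (\<lambda>_ :: nat list. {0..1 :: real}))"
    unfolding compactin_PiE by (simp add: compactin_euclidean_iff)
  moreover have "PiE UNIV (\<lambda>_ :: nat list. {0..1 :: real}) = {g. \<forall>w. g w \<in> {0..1}}" by (auto simp: PiE_iff)
  ultimately show ?thesis by (simp add: euclidean_product_topology compactin_euclidean_iff)
qed

lemma open_cylinder_values:
  fixes g :: "nat list \<Rightarrow> real"
  assumes "finite W"
  shows "open {h. \<forall>w\<in>W. \<bar>h w - g w\<bar> < d}"
proof -
  have "open {h :: nat list \<Rightarrow> real. \<forall>w\<in>W. h (id w) \<in> ball (g w) d}"
    by (rule product_topology_basis'[OF assms]) simp
  thus ?thesis by (simp add: dist_real_def abs_minus_commute)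
qed

lemma sum_periodic_shift:
  fixes f :: "nat \<Rightarrow> real"
  assumes "\<And>k. f (k + n) = f k"
  shows "(\<Sum>k<n. f (k + m)) = (\<Sum>k<n. f k)"
proof (induction m)
  case (Suc m)
  have "f m + (\<Sum>k<n. f (k + Suc m)) = (\<Sum>k<Suc n. f (k + m))"
    using sum.lessThan_Suc_shift[of "\<lambda>k. f (k + m)" n] by simp
  also have "\<dots> = (\<Sum>k<n. f (k + m)) + f m" using assms[of m] by (simp add: add.commute)
  finally show ?case using Suc by simp
qed simp

lemma cylinder_Nil: "cylinder pos_nats [] = X"
  by (auto simp: cylinder_def)

lemma cylinder_snoc_iff:
  "x \<in> cylinder pos_nats (w @ [a]) \<longleftrightarrow> x \<in> cylinder pos_nats w \<and> x (length w) = a"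
  by (auto simp: in_cylinder_iff nth_append less_Suc_eq)

section \<open>Approximate additivity of cylinder probabilities\<close>

context shift_measure
begin

lemma cylinder_prob_Nil: "cylinder_prob \<mu> [] = 1"
  using prob_space by (simp add: cylinder_prob_def cylinder_Nil space_eq)

lemma cylinder_prob_range: "cylinder_prob \<mu> w \<in> {0..1}"
  by (simp add: cylinder_prob_def)

lemma cylinder_prob_sum_snoc:
  "(\<Sum>q<m. cylinder_prob \<mu> (w @ [Suc q])) = measure \<mu> {x \<in> cylinder pos_nats w. x (length w) \<le> m}"
proof -
  have "(\<Sum>q<m. cylinder_prob \<mu> (w @ [Suc q])) = measure \<mu> (\<Union>q<m. cylinder pos_nats (w @ [Suc q]))"
    unfolding cylinder_prob_def using cylinder_events
    by (intro finite_measure_finite_Union[symmetric]) (auto simp: disjoint_family_on_def cylinder_snoc_iff)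
  also have "(\<Union>q<m. cylinder pos_nats (w @ [Suc q])) = {x \<in> cylinder pos_nats w. x (length w) \<le> m}"
  proof (intro equalityI subsetI)
    fix x assume x: "x \<in> {x \<in> cylinder pos_nats w. x (length w) \<le> m}"
    hence "x \<in> X" by (simp add: in_cylinder_iff)
    from full_shiftD[OF this, of "length w"] have "x (length w) \<ge> 1" by simp
    then obtain q where q: "x (length w) = Suc q" using not0_implies_Suc not_one_le_zero by metis
    hence "q < m" "x \<in> cylinder pos_nats (w @ [Suc q])" using x by (simp_all add: cylinder_snoc_iff)
    thus "x \<in> (\<Union>q<m. cylinder pos_nats (w @ [Suc q]))" by blast
  next
    fix x assume "x \<in> (\<Union>q<m. cylinder pos_nats (w @ [Suc q]))"
    then obtain q where "q < m" "x \<in> cylinder pos_nats (w @ [Suc q])" by blast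
    thus "x \<in> {x \<in> cylinder pos_nats w. x (length w) \<le> m}" by (simp add: cylinder_snoc_iff)
  qed
  finally show ?thesis .
qed

lemma cylinder_prob_sum_le: "(\<Sum>q<m. cylinder_prob \<mu> (w @ [Suc q])) \<le> cylinder_prob \<mu> w"
proof -
  have "measure \<mu> {x \<in> cylinder pos_nats w. x (length w) \<le> m} \<le> measure \<mu> (cylinder pos_nats w)"
    using cylinder_events by (intro finite_measure_mono) auto
  thus ?thesis unfolding cylinder_prob_sum_snoc by (simp only: cylinder_prob_def)
qed

lemma coordinate_events: "{x \<in> X. x k \<in> A} \<in> events"
  using sets_borel_X_coordinates[of "{k}" "\<lambda>_. A"] by (simp add: sets_eq)

text \<open>The mass escaping beyond letter \<open>m\<close> after \<open>w\<close> is charged to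
  the next coordinate alone. For a periodic orbit this tail is the frequency of letters above
  \<open>m\<close>.\<close>

lemma cylinder_prob_defect:
  "cylinder_prob \<mu> w - (\<Sum>q<m. cylinder_prob \<mu> (w @ [Suc q])) \<le> measure \<mu> {x \<in> X. m < x (length w)}"
proof -
  let ?A = "{x \<in> cylinder pos_nats w. x (length w) \<le> m}" and ?B = "{x \<in> X. m < x (length w)}"
  have A: "?A \<in> events"
  proof -
    have "?A = cylinder pos_nats w \<inter> {x \<in> X. x (length w) \<in> {..m}}" by (auto simp: in_cylinder_iff)
    thus ?thesis using sets.Int[OF cylinder_events coordinate_events] by (simp only:)
  qed
  have B: "?B \<in> events" using coordinate_events[of "length w" "{m<..}"] by simp
  have "cylinder pos_nats w \<subseteq> X" by (simp add: cylinder_def)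
  hence "cylinder pos_nats w \<subseteq> ?A \<union> ?B" by (auto simp: not_le)
  hence "cylinder_prob \<mu> w \<le> measure \<mu> (?A \<union> ?B)"
    unfolding cylinder_prob_def using A B by (intro finite_measure_mono sets.Un)
  also have "\<dots> \<le> measure \<mu> ?A + measure \<mu> ?B" using A B by (rule measure_Un_le)
  finally show ?thesis unfolding cylinder_prob_sum_snoc by simp
qed

end

text \<open>Independent of \<open>i\<close>, since a sum over a full period is unchanged by a shift
  of the starting time.\<close>

lemma empirical_tail:
  assumes "n \<ge> 1" "x \<in> periodic_points n"
  shows "measure (empirical_measure n x) {y \<in> X. m < y i} = real (card {k. k < n \<and> m < x k}) / real n"
proof -
  have x: "x \<in> X" using assms(2) periodic_points_subset by blast
  have s: "{y \<in> X. m < y i} \<in> sets borel_X" using sets_borel_X_coordinates[of "{i}" "\<lambda>_. {m<..}"] by simp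
  have "(\<Sum>k<n. indicator {y \<in> X. m < y i} ((shift ^^ k) x) :: real) = (\<Sum>k<n. if m < x (k + i) then 1 else 0)"
    using shift_funpow_in[OF x] by (intro sum.cong) (auto simp: indicator_def)
  also have "\<dots> = (\<Sum>k<n. if m < x k then 1 else 0)"
    by (rule sum_periodic_shift[of "\<lambda>k. if m < x k then 1 else 0"]) (simp add: periodic_points_periodic[OF assms(2)])
  also have "\<dots> = real (card {k. k < n \<and> m < x k})"
    using sum_indicator_eq_card[of "{..<n}" "\<lambda>k. m < x k"] by simp
  finally show ?thesis using measure_empirical_measure[OF assms(1) x s] by simp
qed

context acceptable_potential
begin

text \<open>Each way of failing is witnessed by finitely many coordinates of \<open>g\<close>, hence
  persists on an open set of the cube. If none occurs, \<open>g\<close> agrees with the cylinder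
  probabilities of a measure on words over \<open>pos_nats\<close>, and the difference at a word of
  \<open>W0\<close> separates that measure from \<open>\<mu>0\<close>.\<close>

lemma cube_point_negligible:
  assumes unique: "\<And>\<mu>. \<mu> \<in> prob_measures \<Longrightarrow> rate_function \<phi> \<mu> = 0 \<Longrightarrow> \<mu> = \<mu>0"
    and W0: "W0 \<subseteq> lists pos_nats"
    and g: "\<forall>w. g w \<in> {0..1}" and out: "\<exists>w\<in>W0. g w \<noteq> cylinder_prob \<mu>0 w"
  shows "\<exists>U. open U \<and> g \<in> U \<and> (\<lambda>n. gibbs_weight n {x. cylinder_prob (empirical_measure n x) \<in> U}) \<longlonglongrightarrow> 0"
proof -
  have emp: "shift_measure (empirical_measure n x)" if "n \<ge> 1" "x \<in> periodic_points n" for n x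
    using empirical_measure_in_prob_measures[OF that(1)] periodic_points_subset that(2)
    by (intro prob_measures_shift_measure) auto
  have never: "(\<lambda>n. gibbs_weight n {x. cylinder_prob (empirical_measure n x) \<in> U}) \<longlonglongrightarrow> 0"
    if U: "\<And>n x. n \<ge> 1 \<Longrightarrow> x \<in> periodic_points n \<Longrightarrow> cylinder_prob (empirical_measure n x) \<notin> U" for U
  proof (rule tendsto_eventually, rule eventually_mono[OF eventually_ge_at_top[of 1]])
    fix n :: nat assume n: "1 \<le> n"
    hence "periodic_points n \<inter> {x. cylinder_prob (empirical_measure n x) \<in> U} = {}" using U by auto
    thus "gibbs_weight n {x. cylinder_prob (empirical_measure n x) \<in> U} = 0" by (simp add: gibbs_weight_def)
  qed
  have cont: "continuous_on UNIV (\<lambda>h :: nat list \<Rightarrow> real. h w)" for w by simp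
  have cont_sum: "continuous_on UNIV (\<lambda>h :: nat list \<Rightarrow> real. \<Sum>q<m. h (w @ [Suc q]))" for w and m :: nat
    by (intro continuous_on_sum cont)
  consider (Nil) "g [] \<noteq> 1"
    | (over) w and m :: nat where "g w < (\<Sum>q<m. g (w @ [Suc q]))"
    | (under) w and \<eta> :: real where "\<eta> > 0" "\<And>m :: nat. \<eta> < g w - (\<Sum>q<m. g (w @ [Suc q]))"
    | (consistent) "g [] = 1" "\<And>w. (\<lambda>q. g (w @ [Suc q])) sums g w"
  proof -
    have "(\<lambda>q. g (w @ [Suc q])) sums g w"
      if le: "\<And>m :: nat. (\<Sum>q<m. g (w @ [Suc q])) \<le> g w"
        and un: "\<And>\<eta>. \<eta> > 0 \<Longrightarrow> \<exists>m :: nat. g w - (\<Sum>q<m. g (w @ [Suc q])) \<le> \<eta>" for w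
      unfolding sums_def
    proof (rule LIMSEQ_I)
      fix e :: real assume e: "e > 0"
      obtain m0 :: nat where m0: "g w - (\<Sum>q<m0. g (w @ [Suc q])) \<le> e / 2" using un[of "e/2"] e by auto
      have "norm ((\<Sum>q<m. g (w @ [Suc q])) - g w) < e" if "m \<ge> m0" for m
      proof -
        have "(\<Sum>q<m0. g (w @ [Suc q])) \<le> (\<Sum>q<m. g (w @ [Suc q]))"
          using that g by (intro sum_mono2) auto
        thus ?thesis using m0 le[of m] e by simp
      qed
      thus "\<exists>m0. \<forall>m\<ge>m0. norm ((\<Sum>q<m. g (w @ [Suc q])) - g w) < e" by blast
    qed
    thus ?thesis using that by (metis not_le)
  qed
  thus ?thesis
  proof cases
    case Nil
    have "open {h :: nat list \<Rightarrow> real. h [] \<noteq> 1}" by (intro open_Collect_neq cont continuous_on_const)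
    moreover have "cylinder_prob (empirical_measure n x) \<notin> {h. h [] \<noteq> 1}" if "n \<ge> 1" "x \<in> periodic_points n" for n x
      using shift_measure.cylinder_prob_Nil[OF emp[OF that]] by simp
    ultimately show ?thesis using Nil never[of "{h. h [] \<noteq> 1}"] by (intro exI[of _ "{h. h [] \<noteq> 1}"] conjI) blast+
  next
    case over
    let ?U = "{h :: nat list \<Rightarrow> real. h w < (\<Sum>q<m. h (w @ [Suc q]))}"
    have "open ?U" by (intro open_Collect_less cont cont_sum)
    moreover have "cylinder_prob (empirical_measure n x) \<notin> ?U" if "n \<ge> 1" "x \<in> periodic_points n" for n x
      using shift_measure.cylinder_prob_sum_le[OF emp[OF that], of w m] by simp
    ultimately show ?thesis using over never[of ?U] by (intro exI[of _ ?U] conjI) blast+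
  next
    case under
    \<comment> \<open>The deficit exceeds \<open>\<eta>\<close> for every cutoff, so the cutoff may
      be the \<open>N\<close> that the rarity of large letters dictates for this
      \<open>\<eta>\<close>.\<close>
    obtain N where N: "(\<lambda>n. gibbs_weight n {x. real (card {k. k < n \<and> N < x k}) \<ge> \<eta> * real n}) \<longlonglongrightarrow> 0"
      using large_letters_rare[OF under(1)] by blast
    let ?U = "{h :: nat list \<Rightarrow> real. \<eta> < h w - (\<Sum>q<N. h (w @ [Suc q]))}"
    have op: "open ?U" by (intro open_Collect_less continuous_on_const continuous_on_diff cont cont_sum)
    have le: "gibbs_weight n {x. cylinder_prob (empirical_measure n x) \<in> ?U}
        \<le> gibbs_weight n {x. real (card {k. k < n \<and> N < x k}) \<ge> \<eta> * real n}" if n: "n \<ge> 1" for n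
    proof (rule gibbs_weight_mono[OF n], rule subsetI)
      fix x assume "x \<in> periodic_points n \<inter> {x. cylinder_prob (empirical_measure n x) \<in> ?U}"
      hence x: "x \<in> periodic_points n"
        "\<eta> < cylinder_prob (empirical_measure n x) w - (\<Sum>q<N. cylinder_prob (empirical_measure n x) (w @ [Suc q]))"
        by auto
      have "\<eta> < real (card {k. k < n \<and> N < x k}) / real n"
        using x(2) shift_measure.cylinder_prob_defect[OF emp[OF n x(1)], of w N] empirical_tail[OF n x(1)] by simp
      thus "x \<in> {x. real (card {k. k < n \<and> N < x k}) \<ge> \<eta> * real n}" using n by (simp add: pos_less_divide_eq)
    qed
    have "(\<lambda>n. gibbs_weight n {x. cylinder_prob (empirical_measure n x) \<in> ?U}) \<longlonglongrightarrow> 0"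
    proof (rule real_tendsto_sandwich[OF _ _ tendsto_const N])
      show "eventually (\<lambda>n. 0 \<le> gibbs_weight n {x. cylinder_prob (empirical_measure n x) \<in> ?U}) sequentially"
        by (rule eventually_mono[OF eventually_ge_at_top[of 1]]) (rule gibbs_weight_nonneg)
      show "eventually (\<lambda>n. gibbs_weight n {x. cylinder_prob (empirical_measure n x) \<in> ?U}
        \<le> gibbs_weight n {x. real (card {k. k < n \<and> N < x k}) \<ge> \<eta> * real n}) sequentially"
        by (rule eventually_mono[OF eventually_ge_at_top[of 1]]) (rule le)
    qed
    thus ?thesis using op under(2)[of N] by (intro exI[of _ ?U]) auto
  next
    case consistent
    have "\<And>w. g w \<ge> 0" using g by auto
    from consistent_weights_measure[OF consistent(1) this consistent(2)]
    obtain \<mu> where \<mu>: "\<mu> \<in> prob_measures" "\<forall>w\<in>lists pos_nats. cylinder_prob \<mu> w = g w" by blast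
    obtain w where w: "w \<in> W0" "g w \<noteq> cylinder_prob \<mu>0 w" using out by blast
    hence "cylinder_prob \<mu> w = g w" using bspec[OF \<mu>(2) subsetD[OF W0 w(1)]] by simp
    hence "\<mu> \<noteq> \<mu>0" using w(2) by auto
    hence "rate_function \<phi> \<mu> \<noteq> 0" using unique[OF \<mu>(1)] by blast
    then obtain G c where "openin weak_star G" "\<mu> \<in> G" "c > 0" "\<forall>\<nu>\<in>G. free_energy \<phi> \<nu> \<le> ereal (- c)"
      using rate_function_pos_nbhd[of \<mu>] \<mu>(1) topspace_weak_star by auto
    then obtain W d where W: "finite W" "W \<subseteq> lists pos_nats" "d > 0"
      "(\<lambda>n. gibbs_weight n {x. \<forall>w\<in>W. \<bar>cylinder_prob (empirical_measure n x) w - cylinder_prob \<mu> w\<bar> < d}) \<longlonglongrightarrow> 0"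
      using local_upper_bound[of G \<mu> c] by blast
    have eq: "{x. cylinder_prob (empirical_measure n x) \<in> {h. \<forall>w\<in>W. \<bar>h w - g w\<bar> < d}}
        = {x. \<forall>w\<in>W. \<bar>cylinder_prob (empirical_measure n x) w - cylinder_prob \<mu> w\<bar> < d}" for n
    proof -
      have "cylinder_prob \<mu> w = g w" if "w \<in> W" for w using bspec[OF \<mu>(2) subsetD[OF W(2) that]] .
      thus ?thesis by auto
    qed
    show ?thesis
      by (rule exI[of _ "{h. \<forall>w\<in>W. \<bar>h w - g w\<bar> < d}"])
         (simp only: eq W(4) open_cylinder_values[OF W(1)] simp_thms, simp add: W(3))
  qed
qed

text \<open>A finite subcover of the cube consists of the good neighbourhood and negligible sets.
  Empirical measures outside the former fall into finitely many of the latter, whose weights add up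
  to something vanishing.\<close>

lemma gibbs_weight_concentration:
  assumes unique: "\<And>\<mu>. \<mu> \<in> prob_measures \<Longrightarrow> rate_function \<phi> \<mu> = 0 \<Longrightarrow> \<mu> = \<mu>0"
    and W0: "finite W0" "W0 \<subseteq> lists pos_nats" and d: "d > 0"
  shows "(\<lambda>n. gibbs_weight n {x. \<not> (\<forall>w\<in>W0. \<bar>cylinder_prob (empirical_measure n x) w - cylinder_prob \<mu>0 w\<bar> < d)}) \<longlonglongrightarrow> 0"
proof -
  let ?K = "{g :: nat list \<Rightarrow> real. \<forall>w. g w \<in> {0..1}}"
  define G0 where "G0 = {h. \<forall>w\<in>W0. \<bar>h w - cylinder_prob \<mu>0 w\<bar> < d}"
  define neg where "neg U \<longleftrightarrow> (\<lambda>n. gibbs_weight n {x. cylinder_prob (empirical_measure n x) \<in> U}) \<longlonglongrightarrow> 0" for U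
  have "\<forall>g\<in>?K. \<exists>U. open U \<and> g \<in> U \<and> (U = G0 \<or> neg U)"
  proof
    fix g assume g: "g \<in> ?K"
    show "\<exists>U. open U \<and> g \<in> U \<and> (U = G0 \<or> neg U)"
    proof (cases "g \<in> G0")
      case True
      thus ?thesis using open_cylinder_values[OF W0(1)] by (auto simp: G0_def)
    next
      case False
      hence "\<exists>w\<in>W0. g w \<noteq> cylinder_prob \<mu>0 w" using d by (force simp: G0_def)
      moreover have "\<forall>w. g w \<in> {0..1}" using g by simp
      ultimately show ?thesis using cube_point_negligible[OF unique W0(2)] unfolding neg_def by blast
    qed
  qed
  from bchoice[OF this] obtain U where U: "\<And>g. g \<in> ?K \<Longrightarrow> open (U g)" "\<And>g. g \<in> ?K \<Longrightarrow> g \<in> U g"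
    "\<And>g. g \<in> ?K \<Longrightarrow> U g = G0 \<or> neg (U g)" by blast
  obtain C where C: "C \<subseteq> ?K" "finite C" "?K \<subseteq> (\<Union>g\<in>C. U g)"
  proof -
    have "?K \<subseteq> (\<Union>g\<in>?K. U g)" using U(2) by blast
    from compactE_image[OF compact_unit_cube U(1) this] show ?thesis using that by blast
  qed
  define C' where "C' = {g\<in>C. neg (U g)}"
  let ?B = "\<lambda>n. {x. \<not> (\<forall>w\<in>W0. \<bar>cylinder_prob (empirical_measure n x) w - cylinder_prob \<mu>0 w\<bar> < d)}"
  have le: "gibbs_weight n (?B n) \<le> (\<Sum>g\<in>C'. gibbs_weight n {x. cylinder_prob (empirical_measure n x) \<in> U g})"
    if n: "n \<ge> 1" for n
  proof -
    have "gibbs_weight n (?B n) \<le> gibbs_weight n (\<Union>g\<in>C'. {x. cylinder_prob (empirical_measure n x) \<in> U g})"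
    proof (rule gibbs_weight_mono[OF n], rule subsetI)
      fix x assume x: "x \<in> periodic_points n \<inter> ?B n"
      hence "empirical_measure n x \<in> prob_measures"
        using periodic_points_subset by (intro empirical_measure_in_prob_measures[OF n]) auto
      hence "cylinder_prob (empirical_measure n x) \<in> ?K"
        using shift_measure.cylinder_prob_range[OF prob_measures_shift_measure] by blast
      then obtain g where g: "g \<in> C" "cylinder_prob (empirical_measure n x) \<in> U g" using C(3) by blast
      moreover have "cylinder_prob (empirical_measure n x) \<notin> G0" using x by (auto simp: G0_def)
      ultimately have "neg (U g)" using U(3)[of g] C(1) by blast
      thus "x \<in> (\<Union>g\<in>C'. {x. cylinder_prob (empirical_measure n x) \<in> U g})" using g by (auto simp: C'_def)
    qed
    also have "\<dots> \<le> (\<Sum>g\<in>C'. gibbs_weight n {x. cylinder_prob (empirical_measure n x) \<in> U g})"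
      using C(2) by (intro gibbs_weight_finite_Union[OF n]) (simp add: C'_def)
    finally show ?thesis .
  qed
  have lim: "(\<lambda>n. \<Sum>g\<in>C'. gibbs_weight n {x. cylinder_prob (empirical_measure n x) \<in> U g}) \<longlonglongrightarrow> 0"
    by (rule tendsto_null_sum) (simp add: C'_def neg_def)
  show ?thesis
  proof (rule real_tendsto_sandwich[OF _ _ tendsto_const lim])
    show "eventually (\<lambda>n. 0 \<le> gibbs_weight n (?B n)) sequentially"
      by (rule eventually_mono[OF eventually_ge_at_top[of 1]]) (rule gibbs_weight_nonneg)
    show "eventually (\<lambda>n. gibbs_weight n (?B n) \<le> (\<Sum>g\<in>C'. gibbs_weight n {x. cylinder_prob (empirical_measure n x) \<in> U g})) sequentially"
      by (rule eventually_mono[OF eventually_ge_at_top[of 1]]) (rule le)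
  qed
qed

section \<open>From concentration to averages\<close>

text \<open>Off \<open>A\<close> the integrand deviates by at most \<open>e\<close>, on
  \<open>A\<close> by at most \<open>2 * B\<close>; everything is dominated by
  \<open>exp (S n x)\<close>, so the infinite sums may be split.\<close>

lemma gibbs_average_close:
  fixes h :: "(nat \<Rightarrow> nat) \<Rightarrow> real"
  assumes n: "n \<ge> 1" and B: "\<And>x. x \<in> periodic_points n \<Longrightarrow> \<bar>h x\<bar> \<le> B" "\<bar>a\<bar> \<le> B"
    and close: "\<And>x. x \<in> periodic_points n \<Longrightarrow> x \<notin> A \<Longrightarrow> \<bar>h x - a\<bar> \<le> e" and e: "e \<ge> 0"
  shows "\<bar>1 / partition_sum \<phi> n * (\<Sum>\<^sub>\<infinity>x\<in>periodic_points n. exp (S n x) * h x) - a\<bar> \<le> e + 2 * B * gibbs_weight n A"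
proof -
  let ?E = "periodic_points n" and ?Z = "partition_sum \<phi> n"
  have Z: "?Z > 0" by (rule partition_sum_pos[OF n])
  have B0: "B \<ge> 0" using B(2) by linarith
  note se = summable_periodic[OF n]
  have sh: "(\<lambda>x. exp (S n x) * h x) summable_on ?E"
  proof (rule abs_summable_summable[OF Infinite_Sum.abs_summable_on_comparison_test'])
    show "(\<lambda>x. B * exp (S n x)) summable_on ?E" by (rule summable_on_cmult_right[OF se])
    fix x assume "x \<in> ?E"
    thus "norm (exp (S n x) * h x) \<le> B * exp (S n x)" using B(1) by (simp add: abs_mult mult.commute mult_right_mono)
  qed
  have sa: "(\<lambda>x. exp (S n x) * a) summable_on ?E" by (rule summable_on_cmult_left[OF se])
  define f where "f x = e * exp (S n x) + 2 * B * (if x \<in> A then exp (S n x) else 0)" for x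
  have si: "(\<lambda>x. if x \<in> A then exp (S n x) else 0) summable_on ?E"
    by (rule summable_on_comparison_test[OF se]) auto
  have sf: "f summable_on ?E"
    unfolding f_def by (intro summable_on_add summable_on_cmult_right se si)
  have le: "norm (exp (S n x) * h x - exp (S n x) * a) \<le> f x" if x: "x \<in> ?E" for x
  proof -
    have "\<bar>h x - a\<bar> \<le> e + (if x \<in> A then 2 * B else 0)"
      using close[OF x] B(1)[OF x] B(2) e by auto
    hence "exp (S n x) * \<bar>h x - a\<bar> \<le> exp (S n x) * (e + (if x \<in> A then 2 * B else 0))"
      by (intro mult_left_mono) auto
    moreover have "norm (exp (S n x) * h x - exp (S n x) * a) = exp (S n x) * \<bar>h x - a\<bar>"
      unfolding right_diff_distrib[symmetric] by (simp add: abs_mult)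
    ultimately show ?thesis by (auto simp: f_def algebra_simps split: if_splits)
  qed
  have "(\<Sum>\<^sub>\<infinity>x\<in>?E. exp (S n x) * h x) - a * ?Z = (\<Sum>\<^sub>\<infinity>x\<in>?E. exp (S n x) * h x - exp (S n x) * a)"
    using infsum_add[OF sh summable_on_uminus[THEN iffD2, OF sa]] infsum_uminus[of "\<lambda>x. exp (S n x) * a" ?E]
      infsum_cmult_left'[of "\<lambda>x. exp (S n x)" a ?E] by (simp add: partition_sum_def mult.commute)
  also have "\<bar>\<dots>\<bar> \<le> (\<Sum>\<^sub>\<infinity>x\<in>?E. norm (exp (S n x) * h x - exp (S n x) * a))"
    using norm_infsum_bound[OF Infinite_Sum.abs_summable_on_comparison_test'[OF sf le]] by simp
  also have "\<dots> \<le> (\<Sum>\<^sub>\<infinity>x\<in>?E. f x)"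
    by (rule infsum_mono[OF Infinite_Sum.abs_summable_on_comparison_test'[OF sf le] sf le])
  also have "\<dots> = e * ?Z + 2 * B * (\<Sum>\<^sub>\<infinity>x\<in>?E. if x \<in> A then exp (S n x) else 0)"
    unfolding f_def partition_sum_def using infsum_add[OF summable_on_cmult_right[OF se, of e] summable_on_cmult_right[OF si, of "2 * B"]]
    by (simp only: infsum_cmult_right')
  also have "(\<Sum>\<^sub>\<infinity>x\<in>?E. if x \<in> A then exp (S n x) else 0) = (\<Sum>\<^sub>\<infinity>x\<in>?E \<inter> A. exp (S n x))"
    by (rule infsum_cong_neutral) auto
  also have "\<dots> = gibbs_weight n A * ?Z" using Z by (simp add: gibbs_weight_def)
  finally have "\<bar>(\<Sum>\<^sub>\<infinity>x\<in>?E. exp (S n x) * h x) - a * ?Z\<bar> \<le> (e + 2 * B * gibbs_weight n A) * ?Z"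
    by (simp add: algebra_simps)
  hence "\<bar>(\<Sum>\<^sub>\<infinity>x\<in>?E. exp (S n x) * h x) - a * ?Z\<bar> / ?Z \<le> e + 2 * B * gibbs_weight n A"
    using Z by (simp add: pos_divide_le_eq)
  moreover have "\<bar>(\<Sum>\<^sub>\<infinity>x\<in>?E. exp (S n x) * h x) - a * ?Z\<bar> / ?Z = \<bar>1 / ?Z * (\<Sum>\<^sub>\<infinity>x\<in>?E. exp (S n x) * h x) - a\<bar>"
  proof -
    have "1 / ?Z * (\<Sum>\<^sub>\<infinity>x\<in>?E. exp (S n x) * h x) - a = ((\<Sum>\<^sub>\<infinity>x\<in>?E. exp (S n x) * h x) - a * ?Z) / ?Z"
      using Z by (simp add: diff_divide_distrib)
    thus ?thesis using Z by (simp add: abs_divide)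
  qed
  ultimately show ?thesis by simp
qed

lemma periodic_averages_converge:
  fixes \<psi> :: "(nat \<Rightarrow> nat) measure \<Rightarrow> real"
  assumes unique: "\<And>\<mu>. \<mu> \<in> prob_measures \<Longrightarrow> rate_function \<phi> \<mu> = 0 \<Longrightarrow> \<mu> = \<mu>0"
    and \<mu>0: "\<mu>0 \<in> prob_measures"
    and cont: "continuous_map weak_star euclidean \<psi>" and bdd: "bounded (\<psi> ` prob_measures)"
  shows "(\<lambda>n. 1 / partition_sum \<phi> n *
      (\<Sum>\<^sub>\<infinity>x\<in>periodic_points n. exp (S n x) * \<psi> (empirical_measure n x))) \<longlonglongrightarrow> \<psi> \<mu>0"
proof (rule LIMSEQ_I)
  fix e :: real assume e: "e > 0"
  obtain B where "B > 0" "\<forall>y\<in>\<psi> ` prob_measures. norm y \<le> B" using bdd unfolding bounded_pos by blast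
  hence B: "B > 0" "\<And>\<nu>. \<nu> \<in> prob_measures \<Longrightarrow> \<bar>\<psi> \<nu>\<bar> \<le> B" by auto
  let ?G = "{\<nu> \<in> topspace weak_star. \<psi> \<nu> \<in> ball (\<psi> \<mu>0) (e / 2)}"
  have G: "openin weak_star ?G" by (rule openin_continuous_map_preimage[OF cont]) simp
  have "\<mu>0 \<in> ?G" using \<mu>0 e by (simp add: topspace_weak_star)
  from weak_star_cylinder_nbhd[OF G this] obtain W d where W: "finite W" "W \<subseteq> lists pos_nats" "d > 0"
    "\<And>\<nu>. \<nu> \<in> prob_measures \<Longrightarrow> (\<forall>w\<in>W. \<bar>cylinder_prob \<nu> w - cylinder_prob \<mu>0 w\<bar> < d) \<Longrightarrow> \<nu> \<in> ?G"
    by blast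
  define A where "A n = {x. \<not> (\<forall>w\<in>W. \<bar>cylinder_prob (empirical_measure n x) w - cylinder_prob \<mu>0 w\<bar> < d)}" for n
  have "(\<lambda>n. gibbs_weight n (A n)) \<longlonglongrightarrow> 0"
    unfolding A_def by (rule gibbs_weight_concentration[OF unique W(1-3)])
  \<comment> \<open>The bad set enters the final estimate with factor \<open>2 * B\<close>, so this
    threshold leaves it less than \<open>e / 2\<close>.\<close>
  moreover have "e / (4 * B) > 0" using e B by simp
  ultimately have "eventually (\<lambda>n. gibbs_weight n (A n) < e / (4 * B)) sequentially"
    by (rule order_tendstoD(2))
  then obtain n0 where n0: "\<And>n. n \<ge> n0 \<Longrightarrow> gibbs_weight n (A n) < e / (4 * B)"
    by (auto simp: eventually_sequentially)
  have "norm (1 / partition_sum \<phi> n * (\<Sum>\<^sub>\<infinity>x\<in>periodic_points n. exp (S n x) * \<psi> (empirical_measure n x)) - \<psi> \<mu>0) < e"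
    if "n \<ge> max 1 n0" for n
  proof -
    have n: "n \<ge> 1" "n \<ge> n0" using that by auto
    have emp: "empirical_measure n x \<in> prob_measures" if "x \<in> periodic_points n" for x
      using periodic_points_subset that by (intro empirical_measure_in_prob_measures[OF n(1)]) auto
    have "\<bar>1 / partition_sum \<phi> n * (\<Sum>\<^sub>\<infinity>x\<in>periodic_points n. exp (S n x) * \<psi> (empirical_measure n x)) - \<psi> \<mu>0\<bar>
        \<le> e / 2 + 2 * B * gibbs_weight n (A n)"
    proof (rule gibbs_average_close[OF n(1)])
      fix x assume x: "x \<in> periodic_points n"
      show "\<bar>\<psi> (empirical_measure n x)\<bar> \<le> B" by (rule B(2)[OF emp[OF x]])
      assume "x \<notin> A n"
      hence "empirical_measure n x \<in> ?G" using W(4)[OF emp[OF x]] by (simp add: A_def)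
      thus "\<bar>\<psi> (empirical_measure n x) - \<psi> \<mu>0\<bar> \<le> e / 2" by (simp add: dist_real_def abs_minus_commute)
    qed (use B(2)[OF \<mu>0] e in auto)
    also have "2 * B * gibbs_weight n (A n) < e / 2"
    proof -
      have "2 * B * gibbs_weight n (A n) < 2 * B * (e / (4 * B))"
        using n0[OF n(2)] B(1) by (intro mult_strict_left_mono) auto
      thus ?thesis using B(1) by simp
    qed
    finally show ?thesis by simp
  qed
  thus "\<exists>n0. \<forall>n\<ge>n0. norm (1 / partition_sum \<phi> n *
      (\<Sum>\<^sub>\<infinity>x\<in>periodic_points n. exp (S n x) * \<psi> (empirical_measure n x)) - \<psi> \<mu>0) < e" by blast
qed

end

theorem theoremB:
  fixes \<phi> :: "(nat \<Rightarrow> nat) \<Rightarrow> real"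
    and \<mu>min :: "(nat \<Rightarrow> nat) measure"
    and \<psi> :: "(nat \<Rightarrow> nat) measure \<Rightarrow> real"
  assumes "acceptable pos_nats \<phi>"
    and "pressure pos_nats \<phi> < \<infinity>"
    and "\<exists>ps\<ge>2. (\<forall>\<gamma>. induced_locally_Hoelder \<phi> ps \<gamma>) \<and> (\<exists>\<gamma>\<^sub>0. induced_pressure \<phi> ps \<gamma>\<^sub>0 = 0)"
    and "\<mu>min \<in> prob_measures"
    and "rate_function \<phi> \<mu>min = 0"
    and "\<And>\<mu>. \<mu> \<in> prob_measures \<Longrightarrow> rate_function \<phi> \<mu> = 0 \<Longrightarrow> \<mu> = \<mu>min"
    and "continuous_map weak_star euclidean \<psi>"
    and "bounded (\<psi> ` prob_measures)"
  shows "(\<lambda>n. 1 / partition_sum \<phi> n *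
            (\<Sum>\<^sub>\<infinity>x\<in>periodic_points n. exp (birkhoff_sum \<phi> n x) * \<psi> (empirical_measure n x)))
         \<longlonglongrightarrow> \<psi> \<mu>min"
proof -
  interpret acceptable_potential \<phi> by standard fact+
  show ?thesis by (rule periodic_averages_converge) fact+
qed

end
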